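(* Let $\mathcal{X}=[-1,1]^d$, let $\mu$ be a probability measure on $\mathcal{X}$ absolutely continuous with respect to the Lebesgue measure, let $m\ge1$ be fixed, let $X_n=\{x_1,\dots,x_n\}$ be drawn i.i.d. from $\mu$ with empirical measure $\mu_n=\frac1n\sum_i\delta_{x_i}$. Let $(\mathcal{P}_i)_{i=1}^m$ and $(P_i)_{i=1}^m$ be the multivariate orthonormal polynomials with respect to $\mu$ and $\mu_n$, and $\mathcal{K}(x,y)=\sum_{i=1}^m\mathcal{P}_i(x)\mathcal{P}_i(y)$ for $x,y\in\mathcal{X}$, $[K_n]_{j,k}=\sum_{i=1}^mP_i(x_j)P_i(x_k)$ for $j,k\in[n]$. There exist constants $A,B,C>0$ such that for all $\widetilde\delta\in(0,1)$, $\widetilde\varepsilon>0$, $$n\ge\frac{A^2B^2\log(C/\widetilde\delta)}{\widetilde\varepsilon^2}\ \Rightarrow\ \mathbb{P}\Big(\max_{i\in[m]}\max_{x\in X_n}|\mathcal{P}_i(x)-P_i(x)|\ge\widetilde\varepsilon\Big)<\widetilde\delta,$$ and such that, for these constants, $\mathrm{DPP}(K_n,\mu_n)$ is weakly coherent with $\mathrm{DPP}(\mathcal{K},\mu)$, with rate given by $$N_K(\delta,\varepsilon)=\frac{A^2B^2m^2M^2\log(C/\delta)}{\varepsilon^2},\qquad M=2\max_{i\in[m]}\max_{x\in\mathcal{X}}|\mathcal{P}_i(x)|;$$ that is, the weak-coherency concentration rate is the function $N(\delta,\varepsilon,\varphi_r)$ associated with this kernel rate $N_K$ (formula given in the cont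ext).
   Context: Orthonormal polynomials: order the monomial functions $x\mapsto x(1)^{\beta_1}\cdots x(d)^{\beta_d}$ on $\mathbb{R}^d$ by the graded lexicographic order on the degrees; $(\mathcal{P}_i)_{i=1}^m$ (resp. $(P_i)_{i=1}^m$) is obtained by applying the Gram-Schmidt orthonormalization process to the first $m$ of these functions in $L^2(\mathcal{X};\mu)$ (resp. to their restrictions to $X_n$, in $L^2(X_n;\mu_n)$). It is a standing assumption that these procedures are well defined and yield unique sequences. Point processes: a (simple) point process $\mathcal{Q}$ is a probability distribution over locally finite subsets $\mathcal{S}$. For bounded measurable $\varphi_r:\mathcal{X}^r\to\mathbb{R}$, $\Lambda^{(\varphi_r)}(\mathcal{S})=\sum\varphi_r(y_1,\dots,y_r)$ over $r$-tuples of pairwise distinct points of $\mathcal{S}$, and $\Phi^{(\varphi_r)}(\mathcal{Q})=\mathbf{E}_{\mathcal{S}\sim\mathcal{Q}}[\Lambda^{(\varphi_r)}(\mathcal{S})]$. $\mathrm{DPP}(K,\gamma)$ is the point process with $\Phi^{(\varphi_r)}=\int\varphi_r(y_1,\dots,y_r)\det([K(y_i,y_j)]_{i,j=1}^r)\,d\gamma^{\otimes r}$ for all $r,\varphi_r$; for the matrix $K_n$ and $\mu_n$ the kernel value at $(x_i,x_j)$ is $[K_n]_{i,j}$. Weak coherency: $\mathcal{P}_n$ is weakly coherent with $\mathcal{P}$ if for all $r\ge1$, bounded measurable compactly supported $\varphi_r:\mathcal{X}^r\to\mathbb{R}$, $\delta\in(0,1)$, $\varepsilon>0$ there is $N(\delta,\varepsilon,\varphi_r)$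 (the weak-coherency rate) with $n\ge N(\delta,\varepsilon,\varphi_r)\Rightarrow\mathbb{P}(|\Phi^{(\varphi_r)}(\mathcal{P}_n)-\Phi^{(\varphi_r)}(\mathcal{P})|\ge\varepsilon)\le\delta$, where $\mathbb{P}$ is over the draw of $X_n$. Rate associated with a kernel rate $N_K$: $$N(\delta,\varepsilon,\varphi_r)=\max\Big(N_K(\tfrac\delta4,\mathcal{K}_\infty),\,N_K(\tfrac\delta4,\tfrac{\varepsilon}{c}),\,\tfrac{2^{r+5}\beta^2\log(4/\delta)}{\varepsilon^2},\,\tfrac{C_r}{\varepsilon}\Big),$$ where $\mathcal{K}_\infty=\max_{x,y\in\mathcal{X}}|\mathcal{K}(x,y)|$, $c=2^r(r\times r!)\|\varphi_r\|_{L^1(\mu_n^{\otimes r})}\mathcal{K}_\infty^{r-1}$, $\beta=\max_{y\in\mathcal{X}^r}\det([\mathcal{K}(y_j,y_k)]_{j,k=1}^r)\,\|\varphi_r\|_\infty$, $C_r=2^{r+1}(\mu^{\otimes r}(\mathrm{supp}(\varphi_r))\beta+\beta^2)$, $\|\varphi_r\|_{L^1(\mu_n^{\otimes r})}=n^{-r}\sum_{i_1,\dots,i_r}|\varphi_r(x_{i_1},\dots,x_{i_r})|$. Since $c$ depends on $X_n$, $n\ge N$ is understood to hold almost surely.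
   Formalization: The concentration claim is proved for tolerances ε̃ in (0,E] with E>0 fixed first, and A,B,C may depend on E; for all ε̃>0 with constants independent of n it is false when m≥2 (e.g. d=1, m=2, μ uniform). The weak coherency part is unrestricted. *)

theory Defs
  imports "HOL-Probability.Probability" "Jordan_Normal_Form.Determinant"
begin

text \<open>Both \<open>HOL-Analysis\<close> and \<open>Jordan_Normal_Form\<close> use the infix \<open>$\<close>;
  here it denotes the components of a vector in \<open>real ^ 'd\<close>.\<close>
no_notation vec_index (infixl "$" 100)

definition cube :: "(real ^ 'd) set"
  where "cube = {x. \<forall>k. x $ k \<in> {-1..1}}"


section \<open>Orthonormal polynomials\<close>

text \<open>Any finite linearly ordered type \<open>'d\<close> plays the role of \<open>{1, \<dots>, d}\<close>. As usual, \<open>\<alpha>\<close> precedes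
  \<open>\<beta>\<close> lexicographically iff \<open>\<alpha> k < \<beta> k\<close> at the first coordinate \<open>k\<close> where they differ.\<close>

definition grlex_less :: "('d::{finite,linorder} \<Rightarrow> nat) \<Rightarrow> ('d \<Rightarrow> nat) \<Rightarrow> bool"
  where "grlex_less \<alpha> \<beta> \<longleftrightarrow>
    (\<Sum>k\<in>UNIV. \<alpha> k) < (\<Sum>k\<in>UNIV. \<beta> k) \<or>
    (\<Sum>k\<in>UNIV. \<alpha> k) = (\<Sum>k\<in>UNIV. \<beta> k) \<and> (\<exists>k. \<alpha> k < \<beta> k \<and> (\<forall>l<k. \<alpha> l = \<beta> l))"

text \<open>Sequences are indexed from \<open>0\<close>. Every multidegree has finitely many predecessors, so the one
  at position \<open>i\<close> is the one with exactly \<open>i\<close> predecessors.\<close>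

definition grlex_nth :: "nat \<Rightarrow> ('d::{finite,linorder} \<Rightarrow> nat)"
  where "grlex_nth i = (THE \<beta>. card {\<alpha>. grlex_less \<alpha> \<beta>} = i)"

definition monomial_fun :: "nat \<Rightarrow> real ^ 'd::{finite,linorder} \<Rightarrow> real"
  where "monomial_fun i x = (\<Prod>k\<in>UNIV. x $ k ^ grlex_nth i k)"

definition L2_inner :: "'a measure \<Rightarrow> ('a \<Rightarrow> real) \<Rightarrow> ('a \<Rightarrow> real) \<Rightarrow> real"
  where "L2_inner \<gamma> f g = (\<integral>x. f x * g x \<partial>\<gamma>)"

text \<open>The Gram-Schmidt orthonormalization of a sequence of functions in \<open>L\<^sup>2(\<gamma>)\<close>. A function that
  depends linearly on its predecessors in \<open>L\<^sup>2(\<gamma>)\<close> has a remainder of norm \<open>0\<close>, for which the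
  process is not defined; division by zero then gives the zero function.\<close>

fun gram_schmidt_fun :: "'a measure \<Rightarrow> (nat \<Rightarrow> 'a \<Rightarrow> real) \<Rightarrow> nat \<Rightarrow> 'a \<Rightarrow> real"
  where "gram_schmidt_fun \<gamma> f i =
    (let v = (\<lambda>x. f i x - (\<Sum>j<i. L2_inner \<gamma> (f i) (gram_schmidt_fun \<gamma> f j) * gram_schmidt_fun \<gamma> f j x))
     in (\<lambda>x. v x / sqrt (L2_inner \<gamma> v v)))"

declare gram_schmidt_fun.simps [simp del]

definition orthonormal_poly :: "(real ^ 'd::{finite,linorder}) measure \<Rightarrow> nat \<Rightarrow> real ^ 'd::{finite,linorder} \<Rightarrow> real"
  where "orthonormal_poly \<gamma> = gram_schmidt_fun \<gamma> monomial_fun"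

definition poly_kernel ::
    "(real ^ 'd::{finite,linorder}) measure \<Rightarrow> nat \<Rightarrow> real ^ 'd::{finite,linorder} \<Rightarrow> real ^ 'd::{finite,linorder} \<Rightarrow> real"
  where "poly_kernel \<gamma> m x y = (\<Sum>i<m. orthonormal_poly \<gamma> i x * orthonormal_poly \<gamma> i y)"


section \<open>Samples\<close>

definition tuples :: "nat \<Rightarrow> 'a measure \<Rightarrow> (nat \<Rightarrow> 'a) measure"
  where "tuples r \<gamma> = (\<Pi>\<^sub>M i\<in>{..<r}. \<gamma>)"

text \<open>The law of \<open>x i\<close> for \<open>i\<close> uniform in \<open>{..<n}\<close>, that is the average of the Dirac masses at
  the points \<open>x i\<close>. The kernel \<open>poly_kernel (empirical X n x) m\<close> takes the value
  \<open>[K\<^sub>n]\<^sub>j\<^sub>k\<close> at \<open>(x j, x k)\<close>; its values off the sample are irrelevant.\<close>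

definition empirical :: "'a::topological_space set \<Rightarrow> nat \<Rightarrow> (nat \<Rightarrow> 'a) \<Rightarrow> 'a measure"
  where "empirical X n x = distr (uniform_count_measure {..<n}) (restrict_space borel X) x"


section \<open>Point processes\<close>

definition locally_finite_subsets :: "'a::topological_space set \<Rightarrow> 'a set set"
  where "locally_finite_subsets X = {S. S \<subseteq> X \<and> (\<forall>C. compact C \<and> C \<subseteq> X \<longrightarrow> finite (S \<inter> C))}"

text \<open>The locally finite subsets carry the \<open>\<sigma>\<close>-algebra generated by the numbers of points in
  relatively compact Borel sets.\<close>

definition configurations :: "'a::topological_space set \<Rightarrow> 'a set measure"
  where "configurations X = sigma (locally_finite_subsets X)
    {{S \<in> locally_finite_subsets X. card (S \<inter> B) = k} | B k.
       B \<in> sets borel \<and> (\<exists>C. compact C \<and> B \<subseteq> C \<and> C \<subseteq> X)}"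

definition point_process :: "'a::topological_space set \<Rightarrow> 'a set measure \<Rightarrow> bool"
  where "point_process X Q \<longleftrightarrow> prob_space Q \<and> sets Q = sets (configurations X)"

definition linear_statistic :: "nat \<Rightarrow> ((nat \<Rightarrow> 'a) \<Rightarrow> real) \<Rightarrow> 'a set \<Rightarrow> real"
  where "linear_statistic r \<phi> S = (\<Sum>\<^sub>\<infinity>y\<in>{y \<in> {..<r} \<rightarrow>\<^sub>E S. inj_on y {..<r}}. \<phi> y)"

definition expected_statistic :: "nat \<Rightarrow> ((nat \<Rightarrow> 'a) \<Rightarrow> real) \<Rightarrow> 'a set measure \<Rightarrow> real"
  where "expected_statistic r \<phi> Q = (\<integral>S. linear_statistic r \<phi> S \<partial>Q)"

definition bounded_measurable :: "nat \<Rightarrow> 'a measure \<Rightarrow> ((nat \<Rightarrow> 'a) \<Rightarrow> real) \<Rightarrow> bool"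
  where "bounded_measurable r \<gamma> \<phi> \<longleftrightarrow>
    \<phi> \<in> borel_measurable (tuples r \<gamma>) \<and> bounded (\<phi> ` space (tuples r \<gamma>))"

definition kernel_det :: "('a \<Rightarrow> 'a \<Rightarrow> real) \<Rightarrow> nat \<Rightarrow> (nat \<Rightarrow> 'a) \<Rightarrow> real"
  where "kernel_det K r y = Determinant.det (Matrix.mat r r (\<lambda>(i, j). K (y i) (y j)))"

definition is_DPP ::
    "'a::topological_space set measure \<Rightarrow> ('a \<Rightarrow> 'a \<Rightarrow> real) \<Rightarrow> 'a measure \<Rightarrow> bool"
  where "is_DPP Q K \<gamma> \<longleftrightarrow> point_process (space \<gamma>) Q \<and>
    (\<forall>r\<ge>1. \<forall>\<phi>. bounded_measurable r \<gamma> \<phi> \<longrightarrow>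
       integrable Q (linear_statistic r \<phi>) \<and>
       expected_statistic r \<phi> Q = (\<integral>y. \<phi> y * kernel_det K r y \<partial>tuples r \<gamma>))"


section \<open>Weak coherency\<close>

text \<open>Elements of \<open>{..<r} \<rightarrow>\<^sub>E X\<close> are constant outside \<open>{..<r}\<close>, so for closed \<open>X\<close> the closure in
  the product topology of \<open>nat \<Rightarrow> 'a\<close> is the closure in \<open>X\<^sup>r\<close>.\<close>

definition fun_supp :: "nat \<Rightarrow> 'a::topological_space set \<Rightarrow> ((nat \<Rightarrow> 'a) \<Rightarrow> real) \<Rightarrow> (nat \<Rightarrow> 'a) set"
  where "fun_supp r X \<phi> = closure {y \<in> {..<r} \<rightarrow>\<^sub>E X. \<phi> y \<noteq> 0}"

definition test_function :: "nat \<Rightarrow> 'a::topological_space measure \<Rightarrow> ((nat \<Rightarrow> 'a) \<Rightarrow> real) \<Rightarrow> bool"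
  where "test_function r \<mu> \<phi> \<longleftrightarrow> bounded_measurable r \<mu> \<phi> \<and> compact (fun_supp r (space \<mu>) \<phi>)"

text \<open>A sample of size \<open>n\<close> is a point \<open>x\<close> of \<open>tuples n \<mu>\<close>, and \<open>Qn n x\<close> is the point process built
  from it.\<close>

definition deviation_prob ::
    "'a measure \<Rightarrow> (nat \<Rightarrow> (nat \<Rightarrow> 'a) \<Rightarrow> 'a set measure) \<Rightarrow> 'a set measure \<Rightarrow>
     nat \<Rightarrow> ((nat \<Rightarrow> 'a) \<Rightarrow> real) \<Rightarrow> real \<Rightarrow> nat \<Rightarrow> real"
  where "deviation_prob \<mu> Qn Q r \<phi> \<epsilon> n =
    \<P>(x in tuples n \<mu>. \<bar>expected_statistic r \<phi> (Qn n x) - expected_statistic r \<phi> Q\<bar> \<ge> \<epsilon>)"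

definition weakly_coherent ::
    "'a::topological_space measure \<Rightarrow> (nat \<Rightarrow> (nat \<Rightarrow> 'a) \<Rightarrow> 'a set measure) \<Rightarrow> 'a set measure \<Rightarrow> bool"
  where "weakly_coherent \<mu> Qn Q \<longleftrightarrow>
    (\<forall>r\<ge>1. \<forall>\<phi>. test_function r \<mu> \<phi> \<longrightarrow> (\<forall>\<delta>\<in>{0<..<1}. \<forall>\<epsilon>>0.
       \<exists>N::real. \<forall>n\<ge>1. real n \<ge> N \<longrightarrow> deviation_prob \<mu> Qn Q r \<phi> \<epsilon> n \<le> \<delta>))"

text \<open>A rate \<open>N n x \<delta> \<epsilon> r \<phi>\<close> may depend on the sample \<open>x\<close>; the condition that \<open>n\<close> is at least the
  rate is then required almost surely.\<close>

definition weak_coherency_rate ::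
    "'a::topological_space measure \<Rightarrow> (nat \<Rightarrow> (nat \<Rightarrow> 'a) \<Rightarrow> 'a set measure) \<Rightarrow> 'a set measure \<Rightarrow>
     (nat \<Rightarrow> (nat \<Rightarrow> 'a) \<Rightarrow> real \<Rightarrow> real \<Rightarrow> nat \<Rightarrow> ((nat \<Rightarrow> 'a) \<Rightarrow> real) \<Rightarrow> real) \<Rightarrow> bool"
  where "weak_coherency_rate \<mu> Qn Q N \<longleftrightarrow>
    (\<forall>r\<ge>1. \<forall>\<phi>. test_function r \<mu> \<phi> \<longrightarrow> (\<forall>\<delta>\<in>{0<..<1}. \<forall>\<epsilon>>0. \<forall>n\<ge>1.
       (AE x in tuples n \<mu>. real n \<ge> N n x \<delta> \<epsilon> r \<phi>) \<longrightarrow> deviation_prob \<mu> Qn Q r \<phi> \<epsilon> n \<le> \<delta>))"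

definition kernel_sup :: "'a set \<Rightarrow> ('a \<Rightarrow> 'a \<Rightarrow> real) \<Rightarrow> real"
  where "kernel_sup X K = (SUP (x, y)\<in>X \<times> X. \<bar>K x y\<bar>)"

definition empirical_L1_norm :: "nat \<Rightarrow> (nat \<Rightarrow> 'a) \<Rightarrow> nat \<Rightarrow> ((nat \<Rightarrow> 'a) \<Rightarrow> real) \<Rightarrow> real"
  where "empirical_L1_norm n x r \<phi> =
    (\<Sum>i\<in>{..<r} \<rightarrow>\<^sub>E {..<n}. \<bar>\<phi> (\<lambda>k\<in>{..<r}. x (i k))\<bar>) / real n ^ r"

definition rate_c :: "'a set \<Rightarrow> ('a \<Rightarrow> 'a \<Rightarrow> real) \<Rightarrow> nat \<Rightarrow> (nat \<Rightarrow> 'a) \<Rightarrow> nat \<Rightarrow> ((nat \<Rightarrow> 'a) \<Rightarrow> real) \<Rightarrow> real"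
  where "rate_c X K n x r \<phi> =
    2 ^ r * (real r * fact r) * empirical_L1_norm n x r \<phi> * kernel_sup X K ^ (r - 1)"

definition rate_beta :: "'a set \<Rightarrow> ('a \<Rightarrow> 'a \<Rightarrow> real) \<Rightarrow> nat \<Rightarrow> ((nat \<Rightarrow> 'a) \<Rightarrow> real) \<Rightarrow> real"
  where "rate_beta X K r \<phi> =
    (SUP y\<in>{..<r} \<rightarrow>\<^sub>E X. kernel_det K r y) * (SUP y\<in>{..<r} \<rightarrow>\<^sub>E X. \<bar>\<phi> y\<bar>)"

definition rate_C ::
    "'a::topological_space measure \<Rightarrow> ('a \<Rightarrow> 'a \<Rightarrow> real) \<Rightarrow> nat \<Rightarrow> ((nat \<Rightarrow> 'a) \<Rightarrow> real) \<Rightarrow> real"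
  where "rate_C \<mu> K r \<phi> = 2 ^ (r + 1) *
    (measure (tuples r \<mu>) (fun_supp r (space \<mu>) \<phi>) * rate_beta (space \<mu>) K r \<phi>
     + (rate_beta (space \<mu>) K r \<phi>)\<^sup>2)"

text \<open>The rate associated with a kernel rate \<open>NK\<close>. If \<open>rate_c\<close> is \<open>0\<close>, the tolerance in the second
  term is meant to be infinite; since \<open>\<epsilon> / 0 = 0\<close> and division by
  \<open>0\<^sup>2\<close> gives \<open>0\<close>, \<open>poly_kernel_rate\<close> takes the same value \<open>0\<close> at both.\<close>

definition associated_rate ::
    "'a::topological_space measure \<Rightarrow> ('a \<Rightarrow> 'a \<Rightarrow> real) \<Rightarrow> (real \<Rightarrow> real \<Rightarrow> real) \<Rightarrow>
     nat \<Rightarrow> (nat \<Rightarrow> 'a) \<Rightarrow> real \<Rightarrow> real \<Rightarrow> nat \<Rightarrow> ((nat \<Rightarrow> 'a) \<Rightarrow> real) \<Rightarrow> real"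
  where "associated_rate \<mu> K NK n x \<delta> \<epsilon> r \<phi> =
    Max {NK (\<delta> / 4) (kernel_sup (space \<mu>) K),
         NK (\<delta> / 4) (\<epsilon> / rate_c (space \<mu>) K n x r \<phi>),
         2 ^ (r + 5) * (rate_beta (space \<mu>) K r \<phi>)\<^sup>2 * ln (4 / \<delta>) / \<epsilon>\<^sup>2,
         rate_C \<mu> K r \<phi> / \<epsilon>}"

definition poly_bound :: "(real ^ 'd::{finite,linorder}) measure \<Rightarrow> nat \<Rightarrow> real"
  where "poly_bound \<mu> m = 2 * (MAX i\<in>{..<m}. SUP x\<in>space \<mu>. \<bar>orthonormal_poly \<mu> i x\<bar>)"

definition poly_kernel_rate ::
    "(real ^ 'd::{finite,linorder}) measure \<Rightarrow> nat \<Rightarrow> real \<Rightarrow> real \<Rightarrow> real \<Rightarrow> real \<Rightarrow> real \<Rightarrow> real"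
  where "poly_kernel_rate \<mu> m A B C \<delta> \<epsilon> =
    A\<^sup>2 * B\<^sup>2 * (real m)\<^sup>2 * (poly_bound \<mu> m)\<^sup>2 * ln (C / \<delta>) / \<epsilon>\<^sup>2"

end

theory Submission
  imports Defs "Jordan_Normal_Form.Char_Poly"
begin

text \<open>The polynomials \<open>\<P>\<^sub>i\<close> and \<open>P\<^sub>i\<close> are linear combinations of the first \<open>m\<close> monomials. The coefficients are
functions of the Gram matrix of these monomials, built from ring operations and \<open>t \<mapsto> 1 / sqrt t\<close>, where \<open>t\<close>
is the squared norm of a Gram-Schmidt remainder. For \<open>\<mu>\<close> these norms are
positive: \<open>\<mu>\<close> has a density, and the zero set of a nonzero polynomial is a Lebesgue null set
(\<open>L2_norm_polynomial_pos\<close>). Hence the Gram-Schmidt process is Lipschitz at the Gram matrix of \<open>\<mu>\<close>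
(\<open>gram_schmidt_perturbation\<close>). The entries of the empirical Gram matrix are means of independent
variables bounded by \<open>1\<close>, so a union bound over the \<open>m\<^sup>2\<close> entries gives the first claim
(\<open>orthonormal_poly_concentration\<close>). The Lipschitz bound is local, and the constants depend on
the upper limit \<open>E\<close> for the tolerance.

For the second claim, \<open>\<Phi>\<close> of the empirical process is a V-statistic of the sample, with the kernel
\<open>\<phi> \<cdot> det K\<^sub>n\<close>. If \<open>K\<^sub>n\<close> and \<open>\<K>\<close> differ by at most \<open>\<eta> \<le> \<K>\<^sub>\<infinity>\<close>, then replacing \<open>K\<^sub>n\<close> by \<open>\<K>\<close> changes the V-statistic
by at most \<open>c \<cdot> \<eta> / 2\<close>. The V-statistic with kernel \<open>\<phi> \<cdot> det \<K>\<close> is treated by the bounded differences inequality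
(\<open>bounded_differences_tail\<close>). Its bias comes from the index tuples with a repetition only, because the
determinant vanishes there (\<open>expectation_V_statistic\<close>). The number \<open>c\<close> depends on the sample, but the
requirement on \<open>n\<close> is the same as \<open>c \<cdot> \<eta> \<le> \<epsilon>\<close> for a number \<open>\<eta>\<close> that does not; so it suffices that
the kernels are \<open>\<eta>\<close>-close (\<open>poly_kernel_weak_coherency_rate\<close>).\<close>

text \<open>Importing characteristic polynomials reintroduces this infix, which would make \<open>x $ k\<close> ambiguous for
\<open>x :: real ^ 'd\<close>.\<close>

no_notation vec_index (infixl "$" 100)

section \<open>The bounded differences inequality\<close>

text \<open>Induction on the set of coordinates. When all coordinates but one are fixed, the function varies by at
most \<open>c\<close>, and Hoeffding's lemma applies to the remaining one; the function that results from
integrating this coordinate out has bounded differences again.\<close>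

lemma bounded_differences_mgf:
  fixes f :: "('i \<Rightarrow> 'a) \<Rightarrow> real"
  assumes M: "prob_space M" and I: "finite I"
    and meas: "f \<in> borel_measurable (PiM I (\<lambda>_. M))"
    and bdd: "\<And>x. x \<in> space (PiM I (\<lambda>_. M)) \<Longrightarrow> \<bar>f x\<bar> \<le> b"
    and diff: "\<And>x i y. x \<in> space (PiM I (\<lambda>_. M)) \<Longrightarrow> i \<in> I \<Longrightarrow> y \<in> space M \<Longrightarrow>
                 \<bar>f (x(i := y)) - f x\<bar> \<le> c"
    and l: "l > 0"
  shows "(\<integral>\<^sup>+x. exp (l * (f x - (\<integral>x. f x \<partial>PiM I (\<lambda>_. M)))) \<partial>PiM I (\<lambda>_. M))
           \<le> ennreal (exp (l\<^sup>2 * real (card I) * c\<^sup>2 / 8))"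
  using I meas bdd diff
proof (induction I arbitrary: f rule: finite_induct)
  case empty
  interpret product_prob_space "\<lambda>_::'i. M" UNIV
    using M by (auto simp: product_prob_space_def product_prob_space_axioms_def
        product_sigma_finite_def prob_space_imp_sigma_finite)
  show ?case
    by (simp add: PiM_empty nn_integral_count_space_finite lebesgue_integral_count_space_finite)
next
  case (insert i I)
  interpret product_prob_space "\<lambda>_::'i. M" UNIV
    using M by (auto simp: product_prob_space_def product_prob_space_axioms_def
        product_sigma_finite_def prob_space_imp_sigma_finite)
  interpret M: prob_space M by fact
  interpret PI: prob_space "PiM I (\<lambda>_. M)" by (rule prob_space_PiM) (rule M)
  interpret PiI: prob_space "PiM (insert i I) (\<lambda>_. M)" by (rule prob_space_PiM) (rule M)
  note [measurable] = insert.prems(1)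
  let ?P = "PiM I (\<lambda>_. M)"
  let ?Q = "PiM (insert i I) (\<lambda>_. M)"
  have upd: "x(i := y) \<in> space ?Q" if "x \<in> space ?P" "y \<in> space M" for x y
    using that by (auto simp: space_PiM PiE_iff extensional_def)
  have m2: "(\<lambda>(x, y). f (x(i := y))) \<in> borel_measurable (?P \<Otimes>\<^sub>M M)"
    by measurable
  have m1: "(\<lambda>y. f (x(i := y))) \<in> borel_measurable M" if "x \<in> space ?P" for x
    using measurable_compose[OF measurable_Pair1'[OF that] m2] by simp
  define g where "g x = (\<integral>y. f (x(i := y)) \<partial>M)" for x
  have g_meas[measurable]: "g \<in> borel_measurable ?P"
    unfolding g_def using m2 by (rule M.borel_measurable_lebesgue_integral)
  have int1: "integrable M (\<lambda>y. f (x(i := y)))" if x: "x \<in> space ?P" for x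
    by (rule M.integrable_const_bound[where B = b]) (use insert.prems(2) upd[OF x] m1[OF x] in auto)
  have g_bdd: "\<bar>g x\<bar> \<le> b" if x: "x \<in> space ?P" for x
  proof -
    have "\<bar>g x\<bar> \<le> (\<integral>y. \<bar>f (x(i := y))\<bar> \<partial>M)"
      unfolding g_def by (rule integral_abs_bound)
    also have "\<dots> \<le> (\<integral>y. b \<partial>M)"
      by (rule integral_mono) (use int1[OF x] insert.prems(2) upd[OF x] in auto)
    finally show ?thesis by (simp add: M.prob_space)
  qed
  have g_diff: "\<bar>g (x(j := y)) - g x\<bar> \<le> c" if x: "x \<in> space ?P" and j: "j \<in> I" and y: "y \<in> space M"
    for x j y
  proof -
    have x': "x(j := y) \<in> space ?P"
      using x j y by (auto simp: space_PiM PiE_iff extensional_def)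
    have ij: "i \<noteq> j" using insert.hyps j by auto
    have "g (x(j := y)) - g x = (\<integral>z. f (x(j := y, i := z)) - f (x(i := z)) \<partial>M)"
      unfolding g_def using int1[OF x] int1[OF x'] by simp
    also have "\<bar>\<dots>\<bar> \<le> (\<integral>z. \<bar>f (x(j := y, i := z)) - f (x(i := z))\<bar> \<partial>M)"
      by (rule integral_abs_bound)
    also have "\<dots> \<le> (\<integral>z. c \<partial>M)"
    proof (rule integral_mono)
      show "\<bar>f (x(j := y, i := z)) - f (x(i := z))\<bar> \<le> c" if z: "z \<in> space M" for z
      proof -
        have "\<bar>f ((x(i := z))(j := y)) - f (x(i := z))\<bar> \<le> c"
          by (rule insert.prems(3)[OF upd[OF x z] insertI2[OF j] y])
        thus ?thesis unfolding fun_upd_twist[OF ij] .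
      qed
    qed (use int1[OF x] int1[OF x'] in auto)
    finally show ?thesis by (simp add: M.prob_space)
  qed
  have inner: "(\<integral>\<^sup>+y. exp (l * (f (x(i := y)) - g x)) \<partial>M) \<le> ennreal (exp (l\<^sup>2 * c\<^sup>2 / 8))"
    if x: "x \<in> space ?P" for x
  proof -
    define a where "a = (INF y\<in>space M. f (x(i := y)))"
    have bb: "bdd_below ((\<lambda>y. f (x(i := y))) ` space M)"
      by (rule bdd_belowI2[where m = "- b"]) (use insert.prems(2) upd[OF x] in \<open>fastforce simp: abs_le_iff\<close>)
    have range: "f (x(i := y)) \<in> {a..a + c}" if y: "y \<in> space M" for y
    proof -
      have "f (x(i := y)) - c \<le> f (x(i := z))" if z: "z \<in> space M" for z
      proof -
        have "\<bar>f ((x(i := z))(i := y)) - f (x(i := z))\<bar> \<le> c"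
          by (rule insert.prems(3)[OF upd[OF x z] insertI1 y])
        thus ?thesis unfolding fun_upd_upd by linarith
      qed
      hence "f (x(i := y)) - c \<le> a"
        unfolding a_def using M.not_empty by (intro cINF_greatest) auto
      moreover have "a \<le> f (x(i := y))"
        unfolding a_def using bb y by (rule cINF_lower)
      ultimately show ?thesis by simp
    qed
    interpret interval_bounded_random_variable M "\<lambda>y. f (x(i := y))" a "a + c"
      by unfold_locales (use m1[OF x] range in auto)
    show ?thesis
      using Hoeffdings_lemma_nn_integral[OF l] by (simp add: g_def)
  qed
  have int: "integrable ?Q f"
    by (rule PiI.integrable_const_bound[where B = b]) (use insert.prems(2) in auto)
  have E: "(\<integral>x. f x \<partial>?Q) = (\<integral>x. g x \<partial>?P)"
    unfolding g_def using insert.hyps int by (rule product_integral_insert)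
  define e where "e = (\<integral>x. g x \<partial>?P)"
  have "(\<integral>\<^sup>+x. exp (l * (f x - e)) \<partial>?Q) = (\<integral>\<^sup>+x. \<integral>\<^sup>+y. exp (l * (f (x(i := y)) - e)) \<partial>M \<partial>?P)"
    using insert.hyps by (intro product_nn_integral_insert) auto
  also have "\<dots> = (\<integral>\<^sup>+x. exp (l * (g x - e)) * (\<integral>\<^sup>+y. exp (l * (f (x(i := y)) - g x)) \<partial>M) \<partial>?P)"
  proof (rule nn_integral_cong)
    fix x assume x: "x \<in> space ?P"
    note [measurable] = m1[OF x]
    have "(\<integral>\<^sup>+y. exp (l * (f (x(i := y)) - e)) \<partial>M) =
          (\<integral>\<^sup>+y. ennreal (exp (l * (g x - e))) * exp (l * (f (x(i := y)) - g x)) \<partial>M)"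
      by (rule nn_integral_cong) (simp flip: ennreal_mult exp_add add: algebra_simps)
    also have "\<dots> = exp (l * (g x - e)) * (\<integral>\<^sup>+y. exp (l * (f (x(i := y)) - g x)) \<partial>M)"
      by (rule nn_integral_cmult) measurable
    finally show "(\<integral>\<^sup>+y. exp (l * (f (x(i := y)) - e)) \<partial>M) = \<dots>" .
  qed
  also have "\<dots> \<le> (\<integral>\<^sup>+x. exp (l * (g x - e)) * ennreal (exp (l\<^sup>2 * c\<^sup>2 / 8)) \<partial>?P)"
    by (intro nn_integral_mono mult_left_mono inner) auto
  also have "\<dots> = (\<integral>\<^sup>+x. exp (l * (g x - e)) \<partial>?P) * ennreal (exp (l\<^sup>2 * c\<^sup>2 / 8))"
    by (rule nn_integral_multc) measurable
  also have "\<dots> \<le> ennreal (exp (l\<^sup>2 * real (card I) * c\<^sup>2 / 8)) * ennreal (exp (l\<^sup>2 * c\<^sup>2 / 8))"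
    unfolding e_def by (intro mult_right_mono insert.IH g_meas g_bdd g_diff) auto
  also have "\<dots> = ennreal (exp (l\<^sup>2 * real (card (insert i I)) * c\<^sup>2 / 8))"
    using insert.hyps by (simp flip: ennreal_mult exp_add add: field_simps)
  finally show ?case unfolding E e_def .
qed

lemma bounded_differences_upper_tail:
  fixes f :: "('i \<Rightarrow> 'a) \<Rightarrow> real"
  assumes M: "prob_space M" and I: "finite I" "I \<noteq> {}"
    and meas[measurable]: "f \<in> borel_measurable (PiM I (\<lambda>_. M))"
    and bdd: "\<And>x. x \<in> space (PiM I (\<lambda>_. M)) \<Longrightarrow> \<bar>f x\<bar> \<le> b"
    and diff: "\<And>x i y. x \<in> space (PiM I (\<lambda>_. M)) \<Longrightarrow> i \<in> I \<Longrightarrow> y \<in> space M \<Longrightarrow>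
                 \<bar>f (x(i := y)) - f x\<bar> \<le> c"
    and c: "c > 0" and t: "t > 0"
  shows "measure (PiM I (\<lambda>_. M)) {x \<in> space (PiM I (\<lambda>_. M)). f x - (\<integral>x. f x \<partial>PiM I (\<lambda>_. M)) \<ge> t}
           \<le> exp (- 2 * t\<^sup>2 / (real (card I) * c\<^sup>2))"
proof -
  let ?P = "PiM I (\<lambda>_. M)"
  interpret P: prob_space ?P by (rule prob_space_PiM) (rule M)
  define d where "d = real (card I) * c\<^sup>2"
  define e where "e = (\<integral>x. f x \<partial>?P)"
  have d: "d > 0" using I c by (auto simp: d_def card_gt_0_iff)
  \<comment> \<open>the minimizer of the exponent \<open>l\<^sup>2 * d / 8 - l * t\<close> of Chernoff's bound\<close>
  define l where "l = 4 * t / d"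
  have l: "l > 0" using t d by (simp add: l_def)
  have "ennreal (measure ?P {x \<in> space ?P. f x - e \<ge> t}) = emeasure ?P {x \<in> space ?P. f x - e \<ge> t}"
    by (simp add: P.emeasure_eq_measure)
  also have "\<dots> \<le> ennreal (exp (- l * t)) * (\<integral>\<^sup>+x\<in>space ?P. exp (l * (f x - e)) \<partial>?P)"
    by (intro Chernoff_ineq_nn_integral_ge l) auto
  also have "(\<integral>\<^sup>+x\<in>space ?P. exp (l * (f x - e)) \<partial>?P) = (\<integral>\<^sup>+x. exp (l * (f x - e)) \<partial>?P)"
    by (intro nn_integral_cong) simp
  also have "\<dots> \<le> ennreal (exp (l\<^sup>2 * real (card I) * c\<^sup>2 / 8))"
    unfolding e_def by (rule bounded_differences_mgf[OF M I(1) meas bdd diff l])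
  also have "ennreal (exp (- l * t)) * \<dots> = ennreal (exp (l\<^sup>2 * d / 8 - l * t))"
    by (simp flip: ennreal_mult exp_add add: d_def algebra_simps)
  also have "l\<^sup>2 * d / 8 - l * t = - 2 * t\<^sup>2 / d"
    using d by (simp add: l_def field_simps power2_eq_square)
  finally show ?thesis by (simp add: d_def e_def mult_left_mono)
qed

text \<open>McDiarmid's inequality.\<close>

lemma bounded_differences_tail:
  fixes f :: "('i \<Rightarrow> 'a) \<Rightarrow> real"
  assumes M: "prob_space M" and I: "finite I" "I \<noteq> {}"
    and meas[measurable]: "f \<in> borel_measurable (PiM I (\<lambda>_. M))"
    and bdd: "\<And>x. x \<in> space (PiM I (\<lambda>_. M)) \<Longrightarrow> \<bar>f x\<bar> \<le> b"
    and diff: "\<And>x i y. x \<in> space (PiM I (\<lambda>_. M)) \<Longrightarrow> i \<in> I \<Longrightarrow> y \<in> space M \<Longrightarrow>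
                 \<bar>f (x(i := y)) - f x\<bar> \<le> c"
    and c: "c > 0" and t: "t > 0"
  shows "measure (PiM I (\<lambda>_. M)) {x \<in> space (PiM I (\<lambda>_. M)). \<bar>f x - (\<integral>x. f x \<partial>PiM I (\<lambda>_. M))\<bar> \<ge> t}
           \<le> 2 * exp (- 2 * t\<^sup>2 / (real (card I) * c\<^sup>2))"
proof -
  let ?P = "PiM I (\<lambda>_. M)"
  interpret P: prob_space ?P by (rule prob_space_PiM) (rule M)
  define e where "e = (\<integral>x. f x \<partial>?P)"
  let ?U = "{x \<in> space ?P. f x - e \<ge> t}" and ?L = "{x \<in> space ?P. - f x - (- e) \<ge> t}"
  have "measure ?P {x \<in> space ?P. \<bar>f x - e\<bar> \<ge> t} \<le> measure ?P (?U \<union> ?L)"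
    by (intro P.finite_measure_mono) (auto simp: abs_if split: if_splits)
  also have "\<dots> \<le> measure ?P ?U + measure ?P ?L"
    by (intro measure_Un_le) auto
  also have "measure ?P ?U \<le> exp (- 2 * t\<^sup>2 / (real (card I) * c\<^sup>2))"
    unfolding e_def by (rule bounded_differences_upper_tail[OF M I meas bdd diff c t])
  also have "measure ?P ?L \<le> exp (- 2 * t\<^sup>2 / (real (card I) * c\<^sup>2))"
  proof -
    have "- f x - (- e) = - f x - (\<integral>x. - f x \<partial>?P)" for x by (simp add: e_def)
    thus ?thesis
      using bounded_differences_upper_tail[OF M I, of "\<lambda>x. - f x" b c t] bdd diff c t
      by (simp add: abs_minus_commute)
  qed
  finally show ?thesis by (simp add: e_def)
qed

section \<open>The graded lexicographic order\<close>

lemma grlex_less_irrefl: "\<not> grlex_less \<alpha> \<alpha>"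
  by (auto simp: grlex_less_def)

lemma lex_less_trans:
  fixes \<alpha> \<beta> \<gamma> :: "'d::{finite,linorder} \<Rightarrow> nat"
  assumes "\<alpha> k < \<beta> k" "\<forall>l<k. \<alpha> l = \<beta> l" "\<beta> k' < \<gamma> k'" "\<forall>l<k'. \<beta> l = \<gamma> l"
  shows "\<exists>k. \<alpha> k < \<gamma> k \<and> (\<forall>l<k. \<alpha> l = \<gamma> l)"
proof (rule exI[of _ "min k k'"], intro conjI allI impI)
  show "\<alpha> (min k k') < \<gamma> (min k k')"
    using assms by (cases k k' rule: linorder_cases) (auto simp: min_def)
qed (use assms in auto)

lemma grlex_less_trans: "grlex_less \<alpha> \<beta> \<Longrightarrow> grlex_less \<beta> \<gamma> \<Longrightarrow> grlex_less \<alpha> \<gamma>"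
  unfolding grlex_less_def using lex_less_trans[of \<alpha> _ \<beta> _ \<gamma>] by (elim disjE conjE exE) auto

lemma grlex_less_linear:
  fixes \<alpha> \<beta> :: "'d::{finite,linorder} \<Rightarrow> nat"
  assumes "\<alpha> \<noteq> \<beta>"
  shows "grlex_less \<alpha> \<beta> \<or> grlex_less \<beta> \<alpha>"
proof -
  define k where "k = Min {k. \<alpha> k \<noteq> \<beta> k}"
  have ne: "{k. \<alpha> k \<noteq> \<beta> k} \<noteq> {}" using assms by auto
  have "k \<in> {k. \<alpha> k \<noteq> \<beta> k}" unfolding k_def by (intro Min_in) (use ne in auto)
  moreover have "\<forall>l<k. \<alpha> l = \<beta> l"
  proof (intro allI impI, rule ccontr)
    fix l assume "l < k" "\<alpha> l \<noteq> \<beta> l"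
    hence "k \<le> l" unfolding k_def by (intro Min_le) auto
    with \<open>l < k\<close> show False by simp
  qed
  ultimately have "\<exists>k. (\<alpha> k < \<beta> k \<or> \<beta> k < \<alpha> k) \<and> (\<forall>l<k. \<alpha> l = \<beta> l)"
    by (auto simp: neq_iff)
  thus ?thesis unfolding grlex_less_def by (metis nat_neq_iff)
qed

lemma finite_grlex_predecessors:
  fixes \<beta> :: "'d::{finite,linorder} \<Rightarrow> nat"
  shows "finite {\<alpha>. grlex_less \<alpha> \<beta>}"
proof (rule finite_subset)
  let ?s = "\<Sum>k\<in>UNIV. \<beta> k"
  show "{\<alpha>. grlex_less \<alpha> \<beta>} \<subseteq> (UNIV :: 'd set) \<rightarrow>\<^sub>E {..?s}"
  proof (intro subsetI PiE_I)
    fix \<alpha> :: "'d \<Rightarrow> nat" and k assume "\<alpha> \<in> {\<alpha>. grlex_less \<alpha> \<beta>}"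
    hence "(\<Sum>k\<in>UNIV. \<alpha> k) \<le> ?s" by (auto simp: grlex_less_def)
    moreover have "\<alpha> k \<le> (\<Sum>k\<in>UNIV. \<alpha> k)" by (rule member_le_sum) auto
    ultimately show "\<alpha> k \<in> {..?s}" by simp
  qed simp
qed (simp add: finite_PiE)

definition grlex_rank :: "('d::{finite,linorder} \<Rightarrow> nat) \<Rightarrow> nat"
  where "grlex_rank \<beta> = card {\<alpha>. grlex_less \<alpha> \<beta>}"

lemma grlex_rank_less: "grlex_less \<alpha> \<beta> \<Longrightarrow> grlex_rank \<alpha> < grlex_rank \<beta>"
  unfolding grlex_rank_def using grlex_less_irrefl grlex_less_trans
  by (intro psubset_card_mono finite_grlex_predecessors) blast

lemma inj_grlex_rank: "inj grlex_rank"
  by (rule injI) (metis grlex_less_linear grlex_rank_less less_irrefl)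

text \<open>The predecessors of \<open>\<beta>\<close> have distinct ranks below the rank of \<open>\<beta>\<close>, and there are as many
predecessors as such numbers. So the ranks form an initial segment of the natural numbers, which is
infinite because there are infinitely many multidegrees.\<close>

lemma surj_grlex_rank:
  "\<exists>\<beta> :: 'd::{finite,linorder} \<Rightarrow> nat. grlex_rank \<beta> = i"
proof -
  have "infinite (UNIV :: ('d \<Rightarrow> nat) set)"
    by (metis finite_fun_UNIVD2 infinite_UNIV_nat)
  hence "infinite (range (grlex_rank :: ('d \<Rightarrow> nat) \<Rightarrow> nat))"
    using inj_grlex_rank finite_imageD by blast
  then obtain \<beta> :: "'d \<Rightarrow> nat" where \<beta>: "grlex_rank \<beta> > i"
    unfolding infinite_nat_iff_unbounded by blast
  have "grlex_rank ` {\<alpha>. grlex_less \<alpha> \<beta>} = {..<grlex_rank \<beta>}"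
  proof (rule card_subset_eq)
    show "card (grlex_rank ` {\<alpha>. grlex_less \<alpha> \<beta>}) = card {..<grlex_rank \<beta>}"
      using card_image[OF inj_on_subset[OF inj_grlex_rank subset_UNIV], of "{\<alpha>. grlex_less \<alpha> \<beta>}"]
      by (simp add: grlex_rank_def)
  qed (auto intro: grlex_rank_less)
  with \<beta> show ?thesis by (metis imageE lessThan_iff)
qed

lemma grlex_rank_nth: "grlex_rank (grlex_nth i :: 'd::{finite,linorder} \<Rightarrow> nat) = i"
proof -
  obtain \<beta> :: "'d \<Rightarrow> nat" where \<beta>: "grlex_rank \<beta> = i" using surj_grlex_rank by blast
  show ?thesis
    unfolding grlex_nth_def grlex_rank_def[symmetric]
    by (rule theI[of "\<lambda>\<beta>. grlex_rank \<beta> = i" \<beta>]) (use \<beta> injD[OF inj_grlex_rank] in auto)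
qed

lemma inj_grlex_nth: "inj grlex_nth"
  by (rule inj_on_inverseI[where g = grlex_rank]) (rule grlex_rank_nth)

section \<open>Zero sets of polynomials\<close>

text \<open>Kronecker's substitution: if \<open>N\<close> exceeds all exponents, then \<open>\<beta> j + N * s\<close> determines \<open>\<beta> j\<close>, as the
remainder modulo \<open>N\<close>, and \<open>s\<close>. Here \<open>s\<close> is the weighted sum over the coordinates that were treated
before \<open>j\<close>.\<close>

lemma separating_weights:
  fixes T :: "('d::finite \<Rightarrow> nat) set"
  assumes "finite T"
  shows "\<exists>a :: 'd \<Rightarrow> nat. (\<forall>k. a k > 0) \<and> inj_on (\<lambda>\<beta>. \<Sum>k\<in>UNIV. a k * \<beta> k) T"
proof -
  obtain N where N: "\<And>\<beta> k. \<beta> \<in> T \<Longrightarrow> \<beta> k < N" and N0: "N > 0"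
  proof
    show "Suc (\<Sum>\<beta>\<in>T. \<Sum>k\<in>UNIV. \<beta> k) > 0" by simp
    fix \<beta> k assume "\<beta> \<in> T"
    thus "\<beta> k < Suc (\<Sum>\<beta>\<in>T. \<Sum>k\<in>UNIV. \<beta> k)"
      using member_le_sum[of k UNIV \<beta>] member_le_sum[of \<beta> T "\<lambda>\<beta>. \<Sum>k\<in>UNIV. \<beta> k"] assms
      by (simp add: less_Suc_eq_le)
  qed
  have "\<exists>a. (\<forall>k. a k > 0) \<and> (\<forall>\<beta>\<in>T. \<forall>\<beta>'\<in>T. (\<Sum>k\<in>J. a k * \<beta> k) = (\<Sum>k\<in>J. a k * \<beta>' k) \<longrightarrow> (\<forall>k\<in>J. \<beta> k = \<beta>' k))"
    if "finite J" for J :: "'d set"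
    using that
  proof (induction J)
    case empty
    show ?case by (intro exI[of _ "\<lambda>_. 1"]) auto
  next
    case (insert j J)
    then obtain a where apos: "\<And>k. a k > 0" and a: "\<And>\<beta> \<beta>'. \<beta> \<in> T \<Longrightarrow> \<beta>' \<in> T \<Longrightarrow>
        (\<Sum>k\<in>J. a k * \<beta> k) = (\<Sum>k\<in>J. a k * \<beta>' k) \<Longrightarrow> \<forall>k\<in>J. \<beta> k = \<beta>' k" by blast
    define a' where "a' k = (if k = j then 1 else N * a k)" for k
    have eq: "(\<Sum>k\<in>insert j J. a' k * \<beta> k) = \<beta> j + N * (\<Sum>k\<in>J. a k * \<beta> k)" for \<beta>
    proof -
      have "(\<Sum>k\<in>J. a' k * \<beta> k) = (\<Sum>k\<in>J. N * (a k * \<beta> k))"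
        using insert.hyps by (intro sum.cong) (auto simp: a'_def)
      thus ?thesis using insert.hyps by (simp add: a'_def sum_distrib_left)
    qed
    have "\<forall>k\<in>insert j J. \<beta> k = \<beta>' k" if T: "\<beta> \<in> T" "\<beta>' \<in> T"
      and e: "\<beta> j + N * (\<Sum>k\<in>J. a k * \<beta> k) = \<beta>' j + N * (\<Sum>k\<in>J. a k * \<beta>' k)" for \<beta> \<beta>'
    proof -
      have "\<beta> j = \<beta>' j"
        using arg_cong[OF e, of "\<lambda>x. x mod N"] N[OF T(1)] N[OF T(2)] by simp
      thus ?thesis using e a[OF T] N0 by auto
    qed
    moreover have "a' k > 0" for k using apos N0 by (simp add: a'_def)
    ultimately show ?case by (intro exI[of _ a']) (simp only: eq, blast)
  qed
  from this[of UNIV] show ?thesis by (auto simp: inj_on_def fun_eq_iff)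
qed

text \<open>Consider the measure of all pairs \<open>(x, t)\<close> with \<open>x + \<gamma> t \<in> Z\<close>. Integrating over \<open>t\<close> first gives \<open>0\<close>.
Integrating over \<open>x\<close> first gives the measure of \<open>Z\<close>, by translation invariance, times the measure of
the real line.\<close>

lemma null_sets_if_curve_translates_finite:
  fixes Z :: "(real ^ 'd) set" and \<gamma> :: "real \<Rightarrow> real ^ 'd"
  assumes Z: "closed Z" and \<gamma>: "continuous_on UNIV \<gamma>"
    and fin: "\<And>x. finite {t. x + \<gamma> t \<in> Z}"
  shows "Z \<in> null_sets lborel"
proof -
  have cl: "closed {p :: (real ^ 'd) \<times> real. fst p + \<gamma> (snd p) \<in> Z}"
  proof -
    have "continuous_on UNIV (\<lambda>p :: (real ^ 'd) \<times> real. fst p + \<gamma> (snd p))"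
      by (intro continuous_intros continuous_on_compose2[OF \<gamma>]) auto
    from closed_vimage[OF Z this] show ?thesis by (simp add: vimage_def)
  qed
  define g where "g p = (indicator Z (fst p + \<gamma> (snd p)) :: ennreal)" for p :: "(real ^ 'd) \<times> real"
  have "g = indicator {p. fst p + \<gamma> (snd p) \<in> Z}"
    by (auto simp: g_def indicator_def fun_eq_iff)
  hence g: "g \<in> borel_measurable (lborel \<Otimes>\<^sub>M lborel)"
    using borel_closed[OF cl] by (simp add: lborel_prod)
  have Zb[measurable]: "Z \<in> sets borel" using Z by simp
  have "(\<integral>\<^sup>+t. \<integral>\<^sup>+x. g (x, t) \<partial>lborel \<partial>(lborel :: real measure)) =
        (\<integral>\<^sup>+x. \<integral>\<^sup>+t. g (x, t) \<partial>lborel \<partial>(lborel :: (real ^ 'd) measure))"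
    using g by (intro pair_sigma_finite.Fubini' pair_sigma_finite.intro sigma_finite_lborel) simp
  also have "\<dots> = (\<integral>\<^sup>+x. 0 \<partial>(lborel :: (real ^ 'd) measure))"
  proof (rule nn_integral_cong)
    fix x :: "real ^ 'd"
    have "(\<integral>\<^sup>+t. g (x, t) \<partial>lborel) = (\<integral>\<^sup>+t. indicator {t. x + \<gamma> t \<in> Z} t \<partial>lborel)"
      by (intro nn_integral_cong) (auto simp: g_def indicator_def)
    also have "\<dots> = emeasure lborel {t. x + \<gamma> t \<in> Z}"
      using finite_imp_closed[OF fin[of x]] by (intro nn_integral_indicator) auto
    also have "\<dots> = 0"
      using fin[of x] by (intro emeasure_lborel_countable countable_finite)
    finally show "(\<integral>\<^sup>+t. g (x, t) \<partial>lborel) = 0" .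
  qed
  also have "\<dots> = 0" by simp
  also have "(\<lambda>t. \<integral>\<^sup>+x. g (x, t) \<partial>lborel) = (\<lambda>t. emeasure lborel Z)"
  proof
    fix t
    have "(\<integral>\<^sup>+x. g (x, t) \<partial>lborel) = (\<integral>\<^sup>+x. indicator Z (\<gamma> t + x) \<partial>lborel)"
      by (simp add: g_def add.commute)
    also have "\<dots> = (\<integral>\<^sup>+x. indicator Z x \<partial>distr lborel borel (\<lambda>x. \<gamma> t + x))"
      by (subst nn_integral_distr) auto
    also have "\<dots> = emeasure lborel Z" by (simp add: lborel_distr_plus)
    finally show "(\<integral>\<^sup>+x. g (x, t) \<partial>lborel) = emeasure lborel Z" .
  qed
  finally have "emeasure lborel Z * emeasure lborel (UNIV :: real set) = 0" by simp
  thus ?thesis by (auto simp: null_sets_def)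
qed

text \<open>As polynomials in \<open>t\<close>, the factors are monic of degree \<open>a k\<close>, since \<open>a k > 0\<close>. So \<open>\<beta>\<close> contributes a monic polynomial
of degree \<open>\<Sum>k. a k * \<beta> k\<close>; these degrees are distinct, and the term of largest degree with a nonzero
coefficient cannot cancel.\<close>

lemma polynomial_along_curve:
  fixes T :: "('d::finite \<Rightarrow> nat) set" and x :: "real ^ 'd"
  assumes T: "finite T" and \<beta>0: "\<beta>0 \<in> T" "c \<beta>0 \<noteq> 0"
    and a: "\<And>k. a k > 0" and inj: "inj_on (\<lambda>\<beta>. \<Sum>k\<in>UNIV. a k * \<beta> k) T"
  shows "finite {t. (\<Sum>\<beta>\<in>T. c \<beta> * (\<Prod>k\<in>UNIV. (x $ k + t ^ a k) ^ \<beta> k)) = 0}"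
proof -
  define w where "w \<beta> = (\<Sum>k\<in>UNIV. a k * \<beta> k)" for \<beta> :: "'d \<Rightarrow> nat"
  define b where "b k = [:x $ k:] + monom 1 (a k)" for k
  have b: "degree (b k) = a k" "lead_coeff (b k) = 1" for k
  proof -
    have "degree [:x $ k:] < degree (monom 1 (a k) :: real poly)"
      using a[of k] by (simp add: degree_monom_eq)
    thus d: "degree (b k) = a k" unfolding b_def
      by (simp add: degree_add_eq_right degree_monom_eq)
    show "lead_coeff (b k) = 1" unfolding d using a[of k]
      by (simp add: b_def coeff_pCons split: nat.splits)
  qed
  have b0: "b k \<noteq> 0" for k using b(2)[of k] by auto
  define p where "p \<beta> = (\<Prod>k\<in>UNIV. b k ^ \<beta> k)" for \<beta>
  have p_deg: "degree (p \<beta>) = w \<beta>" for \<beta>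
    unfolding p_def w_def using b0 b(1)
    by (subst degree_prod_eq_sum_degree) (auto simp: degree_power_eq mult.commute)
  have p_lead: "coeff (p \<beta>) (w \<beta>) = 1" for \<beta>
  proof -
    have "lead_coeff (p \<beta>) = 1"
      unfolding p_def using b(2) by (simp add: lead_coeff_prod lead_coeff_power)
    thus ?thesis by (simp add: p_deg)
  qed
  define q where "q = (\<Sum>\<beta>\<in>T. Polynomial.smult (c \<beta>) (p \<beta>))"
  define T' where "T' = {\<beta> \<in> T. c \<beta> \<noteq> 0}"
  have T': "finite T'" "T' \<noteq> {}" using T \<beta>0 by (auto simp: T'_def)
  hence "Max (w ` T') \<in> w ` T'" by (intro Max_in) auto
  then obtain \<beta> where \<beta>: "\<beta> \<in> T'" and w_max: "w \<beta> = Max (w ` T')" by auto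
  have max: "w \<beta>' \<le> w \<beta>" if "\<beta>' \<in> T'" for \<beta>'
    unfolding w_max using T' that by (intro Max_ge) auto
  have "coeff q (w \<beta>) = (\<Sum>\<beta>'\<in>T. if \<beta>' = \<beta> then c \<beta> else 0)"
    unfolding q_def coeff_sum coeff_smult
  proof (rule sum.cong)
    fix \<beta>' assume \<beta>': "\<beta>' \<in> T"
    show "c \<beta>' * coeff (p \<beta>') (w \<beta>) = (if \<beta>' = \<beta> then c \<beta> else 0)"
    proof (cases "\<beta>' \<in> T' \<and> \<beta>' \<noteq> \<beta>")
      case True
      hence "w \<beta>' < w \<beta>"
        using max[of \<beta>'] inj_onD[OF inj, of \<beta>' \<beta>] \<beta> by (auto simp: T'_def w_def le_less)
      thus ?thesis using True by (simp add: coeff_eq_0 p_deg)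
    qed (use \<beta>' p_lead in \<open>auto simp: T'_def\<close>)
  qed simp
  also have "\<dots> \<noteq> 0" using T \<beta> by (simp add: T'_def)
  finally have "q \<noteq> 0" by auto
  moreover have "(\<Sum>\<beta>\<in>T. c \<beta> * (\<Prod>k\<in>UNIV. (x $ k + t ^ a k) ^ \<beta> k)) = poly q t" for t
    by (simp add: q_def p_def b_def poly_sum poly_prod poly_monom)
  ultimately show ?thesis by (simp add: poly_roots_finite)
qed

lemma null_sets_zeros_of_polynomial:
  fixes T :: "('d::finite \<Rightarrow> nat) set" and c :: "('d \<Rightarrow> nat) \<Rightarrow> real"
  assumes T: "finite T" and \<beta>0: "\<beta>0 \<in> T" "c \<beta>0 \<noteq> 0"
  shows "{x :: real ^ 'd. (\<Sum>\<beta>\<in>T. c \<beta> * (\<Prod>k\<in>UNIV. x $ k ^ \<beta> k)) = 0} \<in> null_sets lborel"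
proof -
  obtain a :: "'d \<Rightarrow> nat" where a: "\<And>k. a k > 0" and inj: "inj_on (\<lambda>\<beta>. \<Sum>k\<in>UNIV. a k * \<beta> k) T"
    using separating_weights[OF T] by (elim exE conjE) auto
  let ?Z = "{x :: real ^ 'd. (\<Sum>\<beta>\<in>T. c \<beta> * (\<Prod>k\<in>UNIV. x $ k ^ \<beta> k)) = 0}"
  show ?thesis
  proof (rule null_sets_if_curve_translates_finite[where \<gamma> = "\<lambda>t. \<chi> k. t ^ a k"])
    show "closed ?Z"
      by (intro closed_Collect_eq continuous_intros)
    show "continuous_on UNIV (\<lambda>t :: real. \<chi> k. t ^ a k)"
      by (intro continuous_on_vec_lambda continuous_intros)
    show "finite {t. x + (\<chi> k. t ^ a k) \<in> ?Z}" for x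
      using polynomial_along_curve[where a = a and T = T and c = c and x = x, OF T \<beta>0 a inj] by simp
  qed
qed

section \<open>Calm functions\<close>

text \<open>Lipschitz continuity at the single point \<open>p\<close>, known as calmness, measured by a gauge \<open>D\<close> that stands for the
distance from \<open>p\<close>. Below, the points are measures and \<open>D\<close> compares Gram matrices.\<close>

definition calm_at :: "'g set \<Rightarrow> ('g \<Rightarrow> real) \<Rightarrow> 'g \<Rightarrow> ('g \<Rightarrow> real) \<Rightarrow> bool"
  where "calm_at S D p F \<longleftrightarrow>
    (\<exists>L>0. \<exists>\<rho>>0. \<forall>\<gamma>\<in>S. 0 \<le> D \<gamma> \<and> D \<gamma> \<le> \<rho> \<longrightarrow> \<bar>F \<gamma> - F p\<bar> \<le> L * D \<gamma>)"

lemma calm_atI: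
  assumes "L > 0" "\<rho> > 0" "\<And>\<gamma>. \<gamma> \<in> S \<Longrightarrow> 0 \<le> D \<gamma> \<Longrightarrow> D \<gamma> \<le> \<rho> \<Longrightarrow> \<bar>F \<gamma> - F p\<bar> \<le> L * D \<gamma>"
  shows "calm_at S D p F"
  using assms unfolding calm_at_def by blast

lemma calm_atE:
  assumes "calm_at S D p F"
  obtains L \<rho> where "L > 0" "\<rho> > 0"
    "\<And>\<gamma>. \<gamma> \<in> S \<Longrightarrow> 0 \<le> D \<gamma> \<Longrightarrow> D \<gamma> \<le> \<rho> \<Longrightarrow> \<bar>F \<gamma> - F p\<bar> \<le> L * D \<gamma>"
  using assms unfolding calm_at_def by blast

lemma calm_at_const: "calm_at S D p (\<lambda>_. c)"
  by (rule calm_atI[of 1 1]) auto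

lemma calm_at_add:
  assumes "calm_at S D p F" "calm_at S D p G"
  shows "calm_at S D p (\<lambda>\<gamma>. F \<gamma> + G \<gamma>)"
proof -
  from assms(1) obtain L \<rho> where F: "L > 0" "\<rho> > 0"
    "\<And>\<gamma>. \<gamma> \<in> S \<Longrightarrow> 0 \<le> D \<gamma> \<Longrightarrow> D \<gamma> \<le> \<rho> \<Longrightarrow> \<bar>F \<gamma> - F p\<bar> \<le> L * D \<gamma>" by (rule calm_atE) blast
  from assms(2) obtain L' \<rho>' where G: "L' > 0" "\<rho>' > 0"
    "\<And>\<gamma>. \<gamma> \<in> S \<Longrightarrow> 0 \<le> D \<gamma> \<Longrightarrow> D \<gamma> \<le> \<rho>' \<Longrightarrow> \<bar>G \<gamma> - G p\<bar> \<le> L' * D \<gamma>" by (rule calm_atE) blast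
  show ?thesis
  proof (rule calm_atI[of "L + L'" "min \<rho> \<rho>'"])
    fix \<gamma> assume "\<gamma> \<in> S" "0 \<le> D \<gamma>" "D \<gamma> \<le> min \<rho> \<rho>'"
    thus "\<bar>F \<gamma> + G \<gamma> - (F p + G p)\<bar> \<le> (L + L') * D \<gamma>"
      using F(3)[of \<gamma>] G(3)[of \<gamma>] by (simp add: distrib_right)
  qed (use F G in auto)
qed

lemma calm_at_mult:
  assumes "calm_at S D p F" "calm_at S D p G"
  shows "calm_at S D p (\<lambda>\<gamma>. F \<gamma> * G \<gamma>)"
proof -
  from assms(1) obtain L \<rho> where F: "L > 0" "\<rho> > 0"
    "\<And>\<gamma>. \<gamma> \<in> S \<Longrightarrow> 0 \<le> D \<gamma> \<Longrightarrow> D \<gamma> \<le> \<rho> \<Longrightarrow> \<bar>F \<gamma> - F p\<bar> \<le> L * D \<gamma>" by (rule calm_atE) blast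
  from assms(2) obtain L' \<rho>' where G: "L' > 0" "\<rho>' > 0"
    "\<And>\<gamma>. \<gamma> \<in> S \<Longrightarrow> 0 \<le> D \<gamma> \<Longrightarrow> D \<gamma> \<le> \<rho>' \<Longrightarrow> \<bar>G \<gamma> - G p\<bar> \<le> L' * D \<gamma>" by (rule calm_atE) blast
  show ?thesis
  proof (rule calm_atI[of "L * (\<bar>G p\<bar> + L' * \<rho>') + \<bar>F p\<bar> * L'" "min \<rho> \<rho>'"])
    fix \<gamma> assume \<gamma>: "\<gamma> \<in> S" "0 \<le> D \<gamma>" "D \<gamma> \<le> min \<rho> \<rho>'"
    have f: "\<bar>F \<gamma> - F p\<bar> \<le> L * D \<gamma>" and g: "\<bar>G \<gamma> - G p\<bar> \<le> L' * D \<gamma>"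
      using \<gamma> F(3)[of \<gamma>] G(3)[of \<gamma>] by auto
    have "L' * D \<gamma> \<le> L' * \<rho>'" using \<gamma> G(1) by (intro mult_left_mono) auto
    with g have g': "\<bar>G \<gamma>\<bar> \<le> \<bar>G p\<bar> + L' * \<rho>'" by linarith
    have "\<bar>F \<gamma> * G \<gamma> - F p * G p\<bar> = \<bar>(F \<gamma> - F p) * G \<gamma> + F p * (G \<gamma> - G p)\<bar>"
      by (simp add: algebra_simps)
    also have "\<dots> \<le> \<bar>F \<gamma> - F p\<bar> * \<bar>G \<gamma>\<bar> + \<bar>F p\<bar> * \<bar>G \<gamma> - G p\<bar>"
      unfolding abs_mult[symmetric] by (rule abs_triangle_ineq)
    also have "\<dots> \<le> L * D \<gamma> * (\<bar>G p\<bar> + L' * \<rho>') + \<bar>F p\<bar> * (L' * D \<gamma>)"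
      using f g g' F(1) \<gamma> by (intro add_mono mult_mono) auto
    finally show "\<bar>F \<gamma> * G \<gamma> - F p * G p\<bar> \<le> (L * (\<bar>G p\<bar> + L' * \<rho>') + \<bar>F p\<bar> * L') * D \<gamma>"
      by (simp add: algebra_simps)
  next
    have pos: "\<bar>G p\<bar> + L' * \<rho>' > 0" using mult_pos_pos[OF G(1,2)] by linarith
    show "L * (\<bar>G p\<bar> + L' * \<rho>') + \<bar>F p\<bar> * L' > 0"
      by (rule add_pos_nonneg[OF mult_pos_pos[OF F(1) pos]]) (use G(1) in auto)
    show "min \<rho> \<rho>' > 0" using F(2) G(2) by simp
  qed
qed

lemma calm_at_sum:
  "(\<And>i. i \<in> I \<Longrightarrow> calm_at S D p (F i)) \<Longrightarrow> calm_at S D p (\<lambda>\<gamma>. \<Sum>i\<in>I. F i \<gamma>)"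
  by (induction I rule: infinite_finite_induct) (auto intro: calm_at_const calm_at_add)

lemma calm_at_diff:
  assumes "calm_at S D p F" "calm_at S D p G"
  shows "calm_at S D p (\<lambda>\<gamma>. F \<gamma> - G \<gamma>)"
  using calm_at_add[OF assms(1) calm_at_mult[OF calm_at_const[of S D p "-1"] assms(2)]] by simp

lemma calm_at_abs:
  assumes "calm_at S D p F"
  shows "calm_at S D p (\<lambda>\<gamma>. \<bar>F \<gamma>\<bar>)"
proof -
  from assms obtain L \<rho> where L: "L > 0" "\<rho> > 0"
    "\<And>\<gamma>. \<gamma> \<in> S \<Longrightarrow> 0 \<le> D \<gamma> \<Longrightarrow> D \<gamma> \<le> \<rho> \<Longrightarrow> \<bar>F \<gamma> - F p\<bar> \<le> L * D \<gamma>" by (rule calm_atE) blast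
  show ?thesis
    by (rule calm_atI[OF L(1,2)]) (rule order_trans[OF abs_triangle_ineq3 L(3)])
qed

lemma calm_at_compose:
  assumes F: "calm_at S D p F" and g: "(g has_real_derivative d) (at (F p))"
  shows "calm_at S D p (\<lambda>\<gamma>. g (F \<gamma>))"
proof -
  from F obtain L \<rho> where L: "L > 0" "\<rho> > 0"
    "\<And>\<gamma>. \<gamma> \<in> S \<Longrightarrow> 0 \<le> D \<gamma> \<Longrightarrow> D \<gamma> \<le> \<rho> \<Longrightarrow> \<bar>F \<gamma> - F p\<bar> \<le> L * D \<gamma>" by (rule calm_atE) blast
  have "((\<lambda>y. (g y - g (F p)) / (y - F p)) \<longlongrightarrow> d) (at (F p))"
    using g by (simp add: has_field_derivative_iff)
  from tendstoD[OF this, of 1] obtain e where e: "e > 0"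
    "\<And>y. y \<noteq> F p \<Longrightarrow> dist y (F p) < e \<Longrightarrow> dist ((g y - g (F p)) / (y - F p)) d < 1"
    by (auto simp: eventually_at)
  have g_lip: "\<bar>g y - g (F p)\<bar> \<le> (\<bar>d\<bar> + 1) * \<bar>y - F p\<bar>" if "\<bar>y - F p\<bar> < e" for y
  proof (cases "y = F p")
    case False
    have "\<bar>(g y - g (F p)) / (y - F p)\<bar> \<le> \<bar>d\<bar> + 1"
      using e(2)[OF False] that unfolding dist_real_def by linarith
    thus ?thesis using False by (simp add: abs_divide pos_divide_le_eq)
  qed simp
  show ?thesis
  proof (rule calm_atI[of "(\<bar>d\<bar> + 1) * L" "min \<rho> (e / (2 * L))"])
    fix \<gamma> assume \<gamma>: "\<gamma> \<in> S" "0 \<le> D \<gamma>" "D \<gamma> \<le> min \<rho> (e / (2 * L))"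
    have f: "\<bar>F \<gamma> - F p\<bar> \<le> L * D \<gamma>" using L(3)[of \<gamma>] \<gamma> by simp
    also have "L * D \<gamma> \<le> L * (e / (2 * L))" using \<gamma> L(1) by (intro mult_left_mono) auto
    also have "\<dots> < e" using L(1) e(1) by simp
    finally have "\<bar>g (F \<gamma>) - g (F p)\<bar> \<le> (\<bar>d\<bar> + 1) * \<bar>F \<gamma> - F p\<bar>" by (rule g_lip)
    also have "\<dots> \<le> (\<bar>d\<bar> + 1) * (L * D \<gamma>)" using f by (intro mult_left_mono) auto
    finally show "\<bar>g (F \<gamma>) - g (F p)\<bar> \<le> (\<bar>d\<bar> + 1) * L * D \<gamma>" by (simp add: mult.assoc)
  qed (use L e in auto)
qed

section \<open>Perturbation of the Gram-Schmidt process\<close>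

lemma L2_inner_sums:
  assumes "\<And>k l. k < m \<Longrightarrow> l < m \<Longrightarrow> integrable \<gamma> (\<lambda>x. f k x * f l x)"
  shows "L2_inner \<gamma> (\<lambda>x. \<Sum>k<m. a k * f k x) (\<lambda>x. \<Sum>l<m. b l * f l x) =
         (\<Sum>k<m. \<Sum>l<m. a k * b l * L2_inner \<gamma> (f k) (f l))"
proof -
  have "L2_inner \<gamma> (\<lambda>x. \<Sum>k<m. a k * f k x) (\<lambda>x. \<Sum>l<m. b l * f l x) =
        (\<integral>x. (\<Sum>k<m. \<Sum>l<m. a k * b l * (f k x * f l x)) \<partial>\<gamma>)"
    unfolding L2_inner_def by (simp add: sum_product mult_ac)
  also have "\<dots> = (\<Sum>k<m. \<integral>x. (\<Sum>l<m. a k * b l * (f k x * f l x)) \<partial>\<gamma>)"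
    by (rule Bochner_Integration.integral_sum) (auto intro!: Bochner_Integration.integrable_sum assms)
  also have "\<dots> = (\<Sum>k<m. \<Sum>l<m. a k * b l * L2_inner \<gamma> (f k) (f l))"
    unfolding L2_inner_def
    by (intro sum.cong refl, subst Bochner_Integration.integral_sum) (auto intro!: assms)
  finally show ?thesis .
qed

text \<open>The remainder is a combination of \<open>f 0, \<dots>, f i\<close> whose coefficients \<open>w\<close> arise from the Gram matrix and
the earlier coefficients by ring operations. Since \<open>f i\<close> has coefficient \<open>1\<close> in it, the norm of the
remainder is positive at \<open>\<mu>\<close>, and dividing by the norm preserves calmness. That the coefficients
beyond \<open>i\<close> vanish is what keeps this leading coefficient equal to \<open>1\<close> in the induction.\<close>

lemma gram_schmidt_calm_coefficients:
  assumes int: "\<And>\<gamma> k l. \<gamma> \<in> S \<Longrightarrow> k < m \<Longrightarrow> l < m \<Longrightarrow> integrable \<gamma> (\<lambda>x. f k x * f l x)"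
    and gram: "\<And>k l. k < m \<Longrightarrow> l < m \<Longrightarrow> calm_at S D \<mu> (\<lambda>\<gamma>. L2_inner \<gamma> (f k) (f l))"
    and \<mu>: "\<mu> \<in> S"
    and indep: "\<And>a i. i < m \<Longrightarrow> a i = 1 \<Longrightarrow>
                  L2_inner \<mu> (\<lambda>x. \<Sum>l<m. a l * f l x) (\<lambda>x. \<Sum>l<m. a l * f l x) > 0"
    and "i < m"
  shows "\<exists>c. (\<forall>l. calm_at S D \<mu> (\<lambda>\<gamma>. c \<gamma> l)) \<and> (\<forall>\<gamma>\<in>S. \<forall>l>i. c \<gamma> l = 0) \<and>
             (\<forall>\<gamma>\<in>S. \<forall>x. gram_schmidt_fun \<gamma> f i x = (\<Sum>l<m. c \<gamma> l * f l x))"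
  using \<open>i < m\<close>
proof (induction i rule: less_induct)
  case (less i)
  have "\<forall>j\<in>{..<i}. \<exists>c. (\<forall>l. calm_at S D \<mu> (\<lambda>\<gamma>. c \<gamma> l)) \<and> (\<forall>\<gamma>\<in>S. \<forall>l>j. c \<gamma> l = 0) \<and>
             (\<forall>\<gamma>\<in>S. \<forall>x. gram_schmidt_fun \<gamma> f j x = (\<Sum>l<m. c \<gamma> l * f l x))"
    using less by auto
  then obtain C where C0: "\<forall>j\<in>{..<i}. (\<forall>l. calm_at S D \<mu> (\<lambda>\<gamma>. C j \<gamma> l)) \<and> (\<forall>\<gamma>\<in>S. \<forall>l>j. C j \<gamma> l = 0) \<and>
             (\<forall>\<gamma>\<in>S. \<forall>x. gram_schmidt_fun \<gamma> f j x = (\<Sum>l<m. C j \<gamma> l * f l x))"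
    by (rule bchoice[THEN exE])
  have C: "\<And>j l. j < i \<Longrightarrow> calm_at S D \<mu> (\<lambda>\<gamma>. C j \<gamma> l)"
    "\<And>\<gamma> j l. \<gamma> \<in> S \<Longrightarrow> j < i \<Longrightarrow> j < l \<Longrightarrow> C j \<gamma> l = 0"
    "\<And>\<gamma> j. \<gamma> \<in> S \<Longrightarrow> j < i \<Longrightarrow> gram_schmidt_fun \<gamma> f j = (\<lambda>x. \<Sum>l<m. C j \<gamma> l * f l x)"
    using C0 by (auto simp: fun_eq_iff)
  define b where "b \<gamma> j = (\<Sum>l<m. C j \<gamma> l * L2_inner \<gamma> (f i) (f l))" for \<gamma> j
  define w where "w \<gamma> l = (if l = i then 1 else 0) - (\<Sum>j<i. b \<gamma> j * C j \<gamma> l)" for \<gamma> l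
  define N where "N \<gamma> = (\<Sum>k<m. \<Sum>l<m. w \<gamma> k * w \<gamma> l * L2_inner \<gamma> (f k) (f l))" for \<gamma>
  have b_calm: "calm_at S D \<mu> (\<lambda>\<gamma>. b \<gamma> j)" if "j < i" for j
    unfolding b_def using that less.prems by (intro calm_at_sum calm_at_mult C gram) auto
  have w_calm: "calm_at S D \<mu> (\<lambda>\<gamma>. w \<gamma> l)" for l
    unfolding w_def by (intro calm_at_sum calm_at_mult calm_at_diff calm_at_const b_calm C) auto
  have N_calm: "calm_at S D \<mu> N"
    unfolding N_def by (intro calm_at_sum calm_at_mult w_calm gram) auto
  have w_i: "w \<gamma> i = 1" if "\<gamma> \<in> S" for \<gamma>
    using C(2)[OF that] by (simp add: w_def)
  have w_0: "w \<gamma> l = 0" if "\<gamma> \<in> S" "l > i" for \<gamma> l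
    using C(2)[OF that(1)] that(2) by (simp add: w_def)
  have N_eq: "N \<gamma> = L2_inner \<gamma> (\<lambda>x. \<Sum>l<m. w \<gamma> l * f l x) (\<lambda>x. \<Sum>l<m. w \<gamma> l * f l x)"
    if "\<gamma> \<in> S" for \<gamma>
    unfolding N_def by (rule L2_inner_sums[symmetric]) (rule int[OF that])
  have N_pos: "N \<mu> > 0"
    unfolding N_eq[OF \<mu>] using less.prems w_i[OF \<mu>] by (rule indep)
  have b_eq: "L2_inner \<gamma> (f i) (gram_schmidt_fun \<gamma> f j) = b \<gamma> j" if \<gamma>: "\<gamma> \<in> S" and j: "j < i" for \<gamma> j
  proof -
    have "L2_inner \<gamma> (f i) (gram_schmidt_fun \<gamma> f j) =
          (\<integral>x. (\<Sum>l<m. C j \<gamma> l * (f i x * f l x)) \<partial>\<gamma>)"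
      unfolding C(3)[OF \<gamma> j] L2_inner_def by (simp add: sum_distrib_left mult_ac)
    also have "\<dots> = b \<gamma> j"
      unfolding b_def L2_inner_def using int[OF \<gamma> less.prems] by (simp add: Bochner_Integration.integral_sum)
    finally show ?thesis .
  qed
  have v_eq: "f i x - (\<Sum>j<i. L2_inner \<gamma> (f i) (gram_schmidt_fun \<gamma> f j) * gram_schmidt_fun \<gamma> f j x) =
              (\<Sum>l<m. w \<gamma> l * f l x)" if \<gamma>: "\<gamma> \<in> S" for \<gamma> x
  proof -
    have "(\<Sum>j<i. L2_inner \<gamma> (f i) (gram_schmidt_fun \<gamma> f j) * gram_schmidt_fun \<gamma> f j x) =
          (\<Sum>j<i. \<Sum>l<m. b \<gamma> j * C j \<gamma> l * f l x)"
    proof (rule sum.cong)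
      fix j assume "j \<in> {..<i}"
      hence j: "j < i" by simp
      show "L2_inner \<gamma> (f i) (gram_schmidt_fun \<gamma> f j) * gram_schmidt_fun \<gamma> f j x =
            (\<Sum>l<m. b \<gamma> j * C j \<gamma> l * f l x)"
        unfolding b_eq[OF \<gamma> j] unfolding C(3)[OF \<gamma> j] by (simp add: sum_distrib_left mult_ac)
    qed simp
    also have "\<dots> = (\<Sum>l<m. (\<Sum>j<i. b \<gamma> j * C j \<gamma> l) * f l x)"
      by (subst sum.swap) (simp add: sum_distrib_right)
    finally have 1: "(\<Sum>j<i. L2_inner \<gamma> (f i) (gram_schmidt_fun \<gamma> f j) * gram_schmidt_fun \<gamma> f j x) =
          (\<Sum>l<m. (\<Sum>j<i. b \<gamma> j * C j \<gamma> l) * f l x)" .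
    have "f i x = (\<Sum>l<m. if l = i then f l x else 0)" using less.prems by simp
    also have "\<dots> = (\<Sum>l<m. (if l = i then 1 else 0) * f l x)" by (rule sum.cong) auto
    finally show ?thesis unfolding 1 w_def left_diff_distrib sum_subtractf by simp
  qed
  define c where "c \<gamma> l = w \<gamma> l * (1 / sqrt (N \<gamma>))" for \<gamma> l
  have "calm_at S D \<mu> (\<lambda>\<gamma>. 1 / sqrt (N \<gamma>))"
  proof (rule calm_at_compose[OF N_calm])
    show "((\<lambda>x. 1 / sqrt x) has_real_derivative
        - (inverse (sqrt (N \<mu>)) / 2) / (sqrt (N \<mu>) * sqrt (N \<mu>))) (at (N \<mu>))"
      using N_pos by (auto intro!: derivative_eq_intros)
  qed
  hence "calm_at S D \<mu> (\<lambda>\<gamma>. c \<gamma> l)" for l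
    unfolding c_def by (intro calm_at_mult w_calm)
  moreover have "c \<gamma> l = 0" if "\<gamma> \<in> S" "l > i" for \<gamma> l
    using w_0[OF that] by (simp add: c_def)
  moreover have "gram_schmidt_fun \<gamma> f i x = (\<Sum>l<m. c \<gamma> l * f l x)" if \<gamma>: "\<gamma> \<in> S" for \<gamma> x
    by (subst gram_schmidt_fun.simps)
      (simp add: v_eq[OF \<gamma>] N_eq[OF \<gamma>] Let_def c_def sum_divide_distrib)
  ultimately show ?case by blast
qed

lemma gram_schmidt_perturbation:
  assumes int: "\<And>\<gamma> k l. \<gamma> \<in> S \<Longrightarrow> k < m \<Longrightarrow> l < m \<Longrightarrow> integrable \<gamma> (\<lambda>x. f k x * f l x)"
    and gram: "\<And>k l. k < m \<Longrightarrow> l < m \<Longrightarrow> calm_at S D \<mu> (\<lambda>\<gamma>. L2_inner \<gamma> (f k) (f l))"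
    and \<mu>: "\<mu> \<in> S"
    and indep: "\<And>a i. i < m \<Longrightarrow> a i = 1 \<Longrightarrow>
                  L2_inner \<mu> (\<lambda>x. \<Sum>l<m. a l * f l x) (\<lambda>x. \<Sum>l<m. a l * f l x) > 0"
    and bdd: "\<And>l x. l < m \<Longrightarrow> x \<in> X \<Longrightarrow> \<bar>f l x\<bar> \<le> 1"
  shows "\<exists>L>0. \<exists>\<rho>>0. \<forall>\<gamma>\<in>S. 0 \<le> D \<gamma> \<and> D \<gamma> \<le> \<rho> \<longrightarrow>
           (\<forall>i<m. \<forall>x\<in>X. \<bar>gram_schmidt_fun \<mu> f i x - gram_schmidt_fun \<gamma> f i x\<bar> \<le> L * D \<gamma>)"
proof -
  have "\<forall>i\<in>{..<m}. \<exists>c. (\<forall>l. calm_at S D \<mu> (\<lambda>\<gamma>. c \<gamma> l)) \<and>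
             (\<forall>\<gamma>\<in>S. \<forall>x. gram_schmidt_fun \<gamma> f i x = (\<Sum>l<m. c \<gamma> l * f l x))"
    using gram_schmidt_calm_coefficients[OF int gram \<mu> indep] by fast
  then obtain C where C0: "\<forall>i\<in>{..<m}. (\<forall>l. calm_at S D \<mu> (\<lambda>\<gamma>. C i \<gamma> l)) \<and>
             (\<forall>\<gamma>\<in>S. \<forall>x. gram_schmidt_fun \<gamma> f i x = (\<Sum>l<m. C i \<gamma> l * f l x))"
    by (rule bchoice[THEN exE])
  define H where "H \<gamma> = (\<Sum>i<m. \<Sum>l<m. \<bar>C i \<gamma> l - C i \<mu> l\<bar>)" for \<gamma>
  have "calm_at S D \<mu> H"
    unfolding H_def using C0 by (intro calm_at_sum calm_at_abs calm_at_diff calm_at_const) auto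
  then obtain L \<rho> where L: "L > 0" "\<rho> > 0"
    "\<And>\<gamma>. \<gamma> \<in> S \<Longrightarrow> 0 \<le> D \<gamma> \<Longrightarrow> D \<gamma> \<le> \<rho> \<Longrightarrow> \<bar>H \<gamma> - H \<mu>\<bar> \<le> L * D \<gamma>" by (rule calm_atE) blast
  have "\<bar>gram_schmidt_fun \<mu> f i x - gram_schmidt_fun \<gamma> f i x\<bar> \<le> L * D \<gamma>"
    if \<gamma>: "\<gamma> \<in> S" "0 \<le> D \<gamma>" "D \<gamma> \<le> \<rho>" and i: "i < m" and x: "x \<in> X" for \<gamma> i x
  proof -
    have "gram_schmidt_fun \<mu> f i x - gram_schmidt_fun \<gamma> f i x = (\<Sum>l<m. (C i \<mu> l - C i \<gamma> l) * f l x)"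
      using C0 \<gamma> \<mu> i by (simp add: sum_subtractf left_diff_distrib)
    also have "\<bar>\<dots>\<bar> \<le> (\<Sum>l<m. \<bar>(C i \<mu> l - C i \<gamma> l) * f l x\<bar>)" by (rule sum_abs)
    also have "\<dots> \<le> (\<Sum>l<m. \<bar>C i \<gamma> l - C i \<mu> l\<bar> * 1)"
      unfolding abs_mult using bdd x by (intro sum_mono mult_mono) (auto simp: abs_minus_commute)
    also have "\<dots> \<le> H \<gamma>"
      unfolding H_def using i by (simp, intro member_le_sum[of i]) (auto intro: sum_nonneg)
    also have "\<dots> \<le> L * D \<gamma>" using L(3)[OF \<gamma>] by (simp add: H_def)
    finally show ?thesis .
  qed
  thus ?thesis using L(1,2) by blast
qed

section \<open>Determinants of kernel matrices\<close>

text \<open>In \<open>t\<close>, the determinant of \<open>t \<cdot> 1 + A\<close> is a monic polynomial. If it is negative at \<open>t = 0\<close>, it has a root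
\<open>t > 0\<close>; so \<open>- t\<close> is an eigenvalue of \<open>A\<close>, and the quadratic form is negative at an
eigenvector.\<close>

lemma det_nonneg_of_quadratic_form:
  fixes A :: "real mat"
  assumes A: "A \<in> carrier_mat n n" and psd: "\<And>v. v \<in> carrier_vec n \<Longrightarrow> scalar_prod v (A *\<^sub>v v) \<ge> 0"
  shows "Determinant.det A \<ge> 0"
proof (rule ccontr)
  assume neg: "\<not> Determinant.det A \<ge> 0"
  define p where "p = char_poly (- A)"
  have mA: "- A \<in> carrier_mat n n" using A by simp
  have "- char_matrix (- A) 0 = A"
    using A by (intro eq_matI) (auto simp: char_matrix_def)
  hence p0: "poly p 0 < 0"
    using neg char_poly_matrix[OF mA, of 0] by (simp add: p_def)
  have "lead_coeff p > 0"
    using degree_monic_char_poly[OF mA] by (simp add: p_def)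
  from poly_pinfty_gt_lc[OF this] obtain b where b: "\<And>x. x \<ge> b \<Longrightarrow> poly p x \<ge> lead_coeff p" by blast
  have "poly p (max b 1) > 0" using b[of "max b 1"] \<open>lead_coeff p > 0\<close> by simp
  then obtain t where t: "0 < t" "poly p t = 0"
    using poly_IVT_pos[of 0 "max b 1" p] p0 by (auto simp: less_max_iff_disj)
  hence "eigenvalue (- A) t" using eigenvalue_root_char_poly[OF mA] by (simp add: p_def)
  then obtain v where v: "v \<in> carrier_vec n" "v \<noteq> 0\<^sub>v n" "(- A) *\<^sub>v v = t \<cdot>\<^sub>v v"
    using A by (auto simp: eigenvalue_def eigenvector_def)
  have "A *\<^sub>v v = - ((- A) *\<^sub>v v)"
    using A v(1) by (intro eq_vecI) auto
  hence "scalar_prod v (A *\<^sub>v v) = - (t * (scalar_prod v v))"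
    using v A by simp
  moreover have "scalar_prod v v > 0"
  proof -
    obtain i where "i < n" "vec_index v i \<noteq> 0" using v(1,2) by (metis carrier_vecD eq_vecI index_zero_vec)
    moreover from this have "0 < vec_index v i * vec_index v i"
      using not_real_square_gt_zero[of "vec_index v i"] by blast
    ultimately show ?thesis using v(1) by (auto simp: scalar_prod_def intro!: sum_pos2[of _ i])
  qed
  hence "t * scalar_prod v v > 0" using t(1) by simp
  ultimately show False using psd[OF v(1)] by linarith
qed

lemma kernel_det_nonneg:
  fixes P :: "nat \<Rightarrow> 'a \<Rightarrow> real"
  shows "kernel_det (\<lambda>x y. \<Sum>i<m. P i x * P i y) r y \<ge> 0"
  unfolding kernel_det_def
proof (rule det_nonneg_of_quadratic_form)
  let ?A = "Matrix.mat r r (\<lambda>(j, k). \<Sum>i<m. P i (y j) * P i (y k))"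
  fix v :: "real Matrix.vec" assume v: "v \<in> carrier_vec r"
  have "scalar_prod v (?A *\<^sub>v v) = (\<Sum>j<r. \<Sum>k<r. \<Sum>i<m. (vec_index v j * P i (y j)) * (vec_index v k * P i (y k)))"
    using v by (simp add: scalar_prod_def sum_distrib_left sum_distrib_right atLeast0LessThan mult_ac)
  also have "\<dots> = (\<Sum>i<m. \<Sum>j<r. \<Sum>k<r. (vec_index v j * P i (y j)) * (vec_index v k * P i (y k)))"
    by (subst sum.swap, subst (2) sum.swap) simp
  also have "\<dots> = (\<Sum>i<m. (\<Sum>j<r. vec_index v j * P i (y j))\<^sup>2)"
    by (simp add: power2_eq_square sum_product)
  also have "\<dots> \<ge> 0" by (intro sum_nonneg) auto
  finally show "scalar_prod v (?A *\<^sub>v v) \<ge> 0" .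
qed simp

lemma kernel_det_expand:
  "kernel_det K r y = (\<Sum>p\<in>{p. p permutes {..<r}}. signof p * (\<Prod>j<r. K (y j) (y (p j))))"
  unfolding kernel_det_def
  by (subst det_def')
    (auto simp: atLeast0LessThan permutes_in_image intro!: sum.cong prod.cong)

lemma kernel_det_eq_0:
  assumes "a < r" "b < r" "a \<noteq> b" "y a = y b"
  shows "kernel_det K r y = 0"
  unfolding kernel_det_def
  by (rule det_identical_rows[of _ r a b]) (use assms in \<open>auto intro!: eq_vecI\<close>)

lemma kernel_det_abs_le:
  assumes K: "\<And>j k. j < r \<Longrightarrow> k < r \<Longrightarrow> \<bar>K (y j) (y k)\<bar> \<le> b"
  shows "\<bar>kernel_det K r y\<bar> \<le> fact r * b ^ r"
proof -
  have "\<bar>kernel_det K r y\<bar> \<le> (\<Sum>p\<in>{p. p permutes {..<r}}. \<bar>signof p * (\<Prod>j<r. K (y j) (y (p j)))\<bar>)"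
    unfolding kernel_det_expand by (rule sum_abs)
  also have "\<dots> \<le> (\<Sum>p\<in>{p. p permutes {..<r}}. b ^ r)"
  proof (rule sum_mono)
    fix p assume p: "p \<in> {p. p permutes {..<r}}"
    have "\<bar>\<Prod>j<r. K (y j) (y (p j))\<bar> \<le> (\<Prod>j<r. b)"
      unfolding abs_prod using p K permutes_in_image[of p "{..<r}"] by (intro prod_mono) auto
    thus "\<bar>signof p * (\<Prod>j<r. K (y j) (y (p j)))\<bar> \<le> b ^ r"
      by (simp add: abs_mult sign_def)
  qed
  also have "\<dots> = fact r * b ^ r" by (simp add: card_permutations)
  finally show ?thesis .
qed

text \<open>Telescoping: exchange one factor at a time.\<close>

lemma abs_prod_diff_le:
  fixes z w :: "nat \<Rightarrow> real"
  assumes "\<And>j. j < r \<Longrightarrow> \<bar>z j\<bar> \<le> b" "\<And>j. j < r \<Longrightarrow> \<bar>w j\<bar> \<le> b" "\<And>j. j < r \<Longrightarrow> \<bar>z j - w j\<bar> \<le> \<eta>"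
  shows "\<bar>(\<Prod>j<r. z j) - (\<Prod>j<r. w j)\<bar> \<le> real r * b ^ (r - 1) * \<eta>"
  using assms
proof (induction r)
  case (Suc r)
  show ?case
  proof (cases "r = 0")
    case True
    thus ?thesis using Suc.prems(3)[of 0] by simp
  next
    case False
    have b: "b \<ge> 0" and e: "\<eta> \<ge> 0"
      using abs_ge_zero order_trans Suc.prems(1,3)[of 0] by blast+
    have "\<bar>\<Prod>j<r. z j\<bar> \<le> (\<Prod>j<r. b)" unfolding abs_prod using Suc.prems(1) by (intro prod_mono) auto
    hence z: "\<bar>\<Prod>j<r. z j\<bar> \<le> b ^ r" by simp
    have IH: "\<bar>(\<Prod>j<r. z j) - (\<Prod>j<r. w j)\<bar> \<le> real r * b ^ (r - 1) * \<eta>"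
      using Suc.prems by (intro Suc.IH) auto
    have "(\<Prod>j<Suc r. z j) - (\<Prod>j<Suc r. w j) =
          (\<Prod>j<r. z j) * (z r - w r) + ((\<Prod>j<r. z j) - (\<Prod>j<r. w j)) * w r"
      by (simp add: algebra_simps)
    also have "\<bar>\<dots>\<bar> \<le> \<bar>\<Prod>j<r. z j\<bar> * \<bar>z r - w r\<bar> + \<bar>(\<Prod>j<r. z j) - (\<Prod>j<r. w j)\<bar> * \<bar>w r\<bar>"
      unfolding abs_mult[symmetric] by (rule abs_triangle_ineq)
    also have "\<dots> \<le> b ^ r * \<eta> + (real r * b ^ (r - 1) * \<eta>) * b"
      by (intro add_mono mult_mono z IH) (use Suc.prems b e in auto)
    also have "\<dots> = real (Suc r) * b ^ (Suc r - 1) * \<eta>"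
      using False by (simp add: algebra_simps power_eq_if)
    finally show ?thesis .
  qed
qed simp

lemma kernel_det_diff_le:
  assumes "\<And>j k. j < r \<Longrightarrow> k < r \<Longrightarrow> \<bar>K (y j) (y k)\<bar> \<le> b"
    and "\<And>j k. j < r \<Longrightarrow> k < r \<Longrightarrow> \<bar>K' (y j) (y k)\<bar> \<le> b"
    and "\<And>j k. j < r \<Longrightarrow> k < r \<Longrightarrow> \<bar>K (y j) (y k) - K' (y j) (y k)\<bar> \<le> \<eta>"
  shows "\<bar>kernel_det K r y - kernel_det K' r y\<bar> \<le> real r * fact r * b ^ (r - 1) * \<eta>"
proof -
  have "kernel_det K r y - kernel_det K' r y =
        (\<Sum>p\<in>{p. p permutes {..<r}}. signof p * ((\<Prod>j<r. K (y j) (y (p j))) - (\<Prod>j<r. K' (y j) (y (p j)))))"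
    unfolding kernel_det_expand by (simp add: sum_subtractf right_diff_distrib)
  also have "\<bar>\<dots>\<bar> \<le> (\<Sum>p\<in>{p. p permutes {..<r}}.
        \<bar>signof p * ((\<Prod>j<r. K (y j) (y (p j))) - (\<Prod>j<r. K' (y j) (y (p j))))\<bar>)"
    by (rule sum_abs)
  also have "\<dots> \<le> (\<Sum>p\<in>{p. p permutes {..<r}}. real r * b ^ (r - 1) * \<eta>)"
  proof (rule sum_mono)
    fix p assume p: "p \<in> {p. p permutes {..<r}}"
    have "p j < r" if "j < r" for j using p that permutes_in_image[of p "{..<r}" j] by auto
    hence "\<bar>(\<Prod>j<r. K (y j) (y (p j))) - (\<Prod>j<r. K' (y j) (y (p j)))\<bar> \<le> real r * b ^ (r - 1) * \<eta>"
      using assms by (intro abs_prod_diff_le) auto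
    thus "\<bar>signof p * ((\<Prod>j<r. K (y j) (y (p j))) - (\<Prod>j<r. K' (y j) (y (p j))))\<bar> \<le> real r * b ^ (r - 1) * \<eta>"
      by (simp add: abs_mult sign_def)
  qed
  also have "\<dots> = real r * fact r * b ^ (r - 1) * \<eta>" by (simp add: card_permutations)
  finally show ?thesis .
qed

section \<open>Empirical measures\<close>

lemma measurable_sample:
  assumes "\<And>i. i < n \<Longrightarrow> x i \<in> X"
  shows "x \<in> measurable (uniform_count_measure {..<n}) (restrict_space borel X)"
  using assms by (subst measurable_cong_sets[OF sets_uniform_count_measure_count_space refl])
    (auto simp: space_restrict_space)

lemma sets_empirical: "sets (empirical X n x) = sets (restrict_space borel X)"
  by (simp add: empirical_def)

lemma prob_space_empirical:
  assumes "n \<ge> 1" "\<And>i. i < n \<Longrightarrow> x i \<in> X"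
  shows "prob_space (empirical X n x)"
  unfolding empirical_def using assms
  by (intro prob_space.prob_space_distr prob_space_uniform_count_measure measurable_sample)
    (auto simp: lessThan_empty_iff)

lemma integral_empirical:
  fixes g :: "'a::topological_space \<Rightarrow> real"
  assumes "\<And>i. i < n \<Longrightarrow> x i \<in> X" "g \<in> borel_measurable (restrict_space borel X)"
  shows "(\<integral>y. g y \<partial>empirical X n x) = (\<Sum>i<n. g (x i)) / real n"
  unfolding empirical_def
  by (subst integral_distr[OF measurable_sample]) (use assms in \<open>auto simp: integral_uniform_count_measure\<close>)

lemma emeasure_empirical:
  assumes "\<And>i. i < n \<Longrightarrow> x i \<in> X" "A \<in> sets (restrict_space borel X)"
  shows "emeasure (empirical X n x) A = ennreal (real (card {i. i < n \<and> x i \<in> A}) / real n)"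
proof -
  have "emeasure (empirical X n x) A = emeasure (uniform_count_measure {..<n}) (x -` A \<inter> {..<n})"
    unfolding empirical_def using assms by (subst emeasure_distr[OF measurable_sample])
      (auto simp: space_uniform_count_measure)
  also have "x -` A \<inter> {..<n} = {i. i < n \<and> x i \<in> A}" by auto
  also have "emeasure (uniform_count_measure {..<n}) \<dots> = ennreal (real (card \<dots>) / real n)"
    by (subst emeasure_uniform_count_measure) auto
  finally show ?thesis .
qed

text \<open>To a box, both measures assign the product over its sides of the fraction of sample points in that
side.\<close>

lemma tuples_empirical:
  fixes X :: "'a::topological_space set"
  assumes n: "n \<ge> 1" and x: "\<And>i. i < n \<Longrightarrow> x i \<in> X"
  shows "tuples r (empirical X n x) =
    distr (uniform_count_measure ({..<r} \<rightarrow>\<^sub>E {..<n})) (PiM {..<r} (\<lambda>_. restrict_space borel X))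
      (\<lambda>i. \<lambda>k\<in>{..<r}. x (i k))"
    (is "_ = distr ?U ?P ?s")
proof -
  interpret emp: prob_space "empirical X n x" by (rule prob_space_empirical[OF n x])
  interpret product_sigma_finite "\<lambda>_::nat. empirical X n x" ..
  have fin: "finite ({..<r} \<rightarrow>\<^sub>E {..<n})" by (intro finite_PiE) auto
  have s: "?s \<in> measurable ?U ?P"
    using x by (subst measurable_cong_sets[OF sets_uniform_count_measure_count_space refl])
      (auto simp: space_PiM space_restrict_space PiE_iff)
  have sets_P: "sets ?P = sets (PiM {..<r} (\<lambda>_. empirical X n x))"
    by (intro sets_PiM_cong) (auto simp: sets_empirical)
  show ?thesis
    unfolding tuples_def
  proof (rule PiM_eqI[symmetric])
    fix A assume A: "\<And>i. i \<in> {..<r} \<Longrightarrow> A i \<in> sets (empirical X n x)"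
    have "Pi\<^sub>E {..<r} A \<in> sets ?P" unfolding sets_P using A by (intro sets_PiM_I_finite) auto
    hence "emeasure (distr ?U ?P ?s) (Pi\<^sub>E {..<r} A) =
           emeasure ?U (?s -` Pi\<^sub>E {..<r} A \<inter> ({..<r} \<rightarrow>\<^sub>E {..<n}))"
      by (subst emeasure_distr[OF s]) (auto simp: space_uniform_count_measure)
    also have "?s -` Pi\<^sub>E {..<r} A \<inter> ({..<r} \<rightarrow>\<^sub>E {..<n}) = Pi\<^sub>E {..<r} (\<lambda>k. {i. i < n \<and> x i \<in> A k})"
    proof (intro equalityI subsetI)
      fix i assume "i \<in> ?s -` Pi\<^sub>E {..<r} A \<inter> ({..<r} \<rightarrow>\<^sub>E {..<n})"
      hence i: "?s i \<in> Pi\<^sub>E {..<r} A" "i \<in> {..<r} \<rightarrow>\<^sub>E {..<n}" by auto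
      show "i \<in> Pi\<^sub>E {..<r} (\<lambda>k. {i. i < n \<and> x i \<in> A k})"
      proof (rule PiE_I)
        fix k assume k: "k \<in> {..<r}"
        show "i k \<in> {i. i < n \<and> x i \<in> A k}"
          using PiE_mem[OF i(1) k] PiE_mem[OF i(2) k] k by simp
      qed (rule PiE_arb[OF i(2)])
    next
      fix i assume i: "i \<in> Pi\<^sub>E {..<r} (\<lambda>k. {i. i < n \<and> x i \<in> A k})"
      have "i \<in> {..<r} \<rightarrow>\<^sub>E {..<n}" using PiE_mem[OF i] PiE_arb[OF i] by (intro PiE_I) auto
      moreover have "?s i \<in> Pi\<^sub>E {..<r} A" using PiE_mem[OF i] by simp
      ultimately show "i \<in> ?s -` Pi\<^sub>E {..<r} A \<inter> ({..<r} \<rightarrow>\<^sub>E {..<n})" by simp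
    qed
    also have "emeasure ?U \<dots> = ennreal (real (card (Pi\<^sub>E {..<r} (\<lambda>k. {i. i < n \<and> x i \<in> A k}))) /
                 real (card ({..<r} \<rightarrow>\<^sub>E {..<n})))"
      using fin by (intro emeasure_uniform_count_measure) (auto simp: PiE_iff)
    also have "\<dots> = ennreal (\<Prod>k<r. real (card {i. i < n \<and> x i \<in> A k}) / real n)"
      by (simp add: card_PiE prod_dividef)
    also have "\<dots> = (\<Prod>k<r. ennreal (real (card {i. i < n \<and> x i \<in> A k}) / real n))"
      by (intro prod_ennreal[symmetric]) auto
    also have "\<dots> = (\<Prod>k<r. emeasure (empirical X n x) (A k))"
      using A x by (intro prod.cong emeasure_empirical[symmetric]) (auto simp: sets_empirical)
    finally show "emeasure (distr ?U ?P ?s) (Pi\<^sub>E {..<r} A) = \<dots>" .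
  qed (auto simp: sets_P)
qed

text \<open>The von Mises statistic with kernel \<open>h\<close>: unlike in a U-statistic, index tuples may have
repetitions, as they do in an integral with respect to a power of the empirical measure.\<close>

definition V_statistic :: "nat \<Rightarrow> nat \<Rightarrow> ((nat \<Rightarrow> 'a) \<Rightarrow> real) \<Rightarrow> (nat \<Rightarrow> 'a) \<Rightarrow> real"
  where "V_statistic r n h x = (\<Sum>i\<in>{..<r} \<rightarrow>\<^sub>E {..<n}. h (\<lambda>k\<in>{..<r}. x (i k))) / real n ^ r"

lemma integral_tuples_empirical:
  fixes h :: "(nat \<Rightarrow> 'a::topological_space) \<Rightarrow> real"
  assumes n: "n \<ge> 1" and x: "\<And>i. i < n \<Longrightarrow> x i \<in> X"
    and h: "h \<in> borel_measurable (PiM {..<r} (\<lambda>_. restrict_space borel X))"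
  shows "(\<integral>y. h y \<partial>tuples r (empirical X n x)) = V_statistic r n h x"
proof -
  have s: "(\<lambda>i. \<lambda>k\<in>{..<r}. x (i k)) \<in> measurable (uniform_count_measure ({..<r} \<rightarrow>\<^sub>E {..<n}))
      (PiM {..<r} (\<lambda>_. restrict_space borel X))"
    using x by (subst measurable_cong_sets[OF sets_uniform_count_measure_count_space refl])
      (auto simp: space_PiM space_restrict_space PiE_iff)
  have "(\<integral>y. h y \<partial>tuples r (empirical X n x)) =
        (\<integral>i. h (\<lambda>k\<in>{..<r}. x (i k)) \<partial>uniform_count_measure ({..<r} \<rightarrow>\<^sub>E {..<n}))"
    by (subst tuples_empirical[OF n x], assumption) (rule integral_distr[OF s h])
  also have "\<dots> = V_statistic r n h x"
    by (subst integral_uniform_count_measure) (auto simp: V_statistic_def finite_PiE card_PiE)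
  finally show ?thesis .
qed

section \<open>V-statistics\<close>

text \<open>Forgetting coordinate \<open>b\<close> is injective on \<open>S\<close>.\<close>

lemma card_functions_determined_coordinate_le:
  assumes S: "S \<subseteq> {..<r} \<rightarrow>\<^sub>E {..<n}" and b: "b < r"
    and det: "\<And>i i'. i \<in> S \<Longrightarrow> i' \<in> S \<Longrightarrow> (\<And>k. k < r \<Longrightarrow> k \<noteq> b \<Longrightarrow> i k = i' k) \<Longrightarrow> i b = i' b"
  shows "card S \<le> n ^ (r - 1)"
proof -
  let ?J = "{..<r} - {b}"
  have "inj_on (\<lambda>i. restrict i ?J) S"
  proof (rule inj_onI)
    fix i i' assume i: "i \<in> S" "i' \<in> S" and eq: "restrict i ?J = restrict i' ?J"
    have k: "i k = i' k" if "k < r" "k \<noteq> b" for k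
      using fun_cong[OF eq, of k] that by simp
    have ib: "i b = i' b" by (rule det[OF i]) (rule k)
    have "i k = i' k" if "k < r" for k
      using k[OF that] ib by (cases "k = b") auto
    thus "i = i'" using subsetD[OF S i(1)] subsetD[OF S i(2)]
      by (intro PiE_ext[of i "{..<r}" "\<lambda>_. {..<n}"]) auto
  qed
  moreover have "(\<lambda>i. restrict i ?J) ` S \<subseteq> ?J \<rightarrow>\<^sub>E {..<n}"
  proof (rule image_subsetI)
    fix i assume "i \<in> S"
    with S have "i \<in> {..<r} \<rightarrow>\<^sub>E {..<n}" by (rule subsetD)
    thus "restrict i ?J \<in> ?J \<rightarrow>\<^sub>E {..<n}" by (simp add: PiE_iff)
  qed
  ultimately have "card S \<le> card (?J \<rightarrow>\<^sub>E {..<n})"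
    by (intro card_inj_on_le) (auto intro: finite_PiE)
  thus ?thesis using b by (simp add: card_PiE)
qed

text \<open>Union bound over the \<open>r (r - 1) / 2\<close> pairs of positions that may carry the same index.\<close>

lemma card_noninjective_le:
  "real (card {i \<in> {..<r} \<rightarrow>\<^sub>E {..<n}. \<not> inj_on i {..<r}}) \<le> real (r * (r - 1)) / 2 * real n ^ (r - 1)"
proof -
  let ?S = "\<lambda>a b. {i \<in> {..<r} \<rightarrow>\<^sub>E {..<n}. i a = i b}"
  have fin: "finite ({..<r} \<rightarrow>\<^sub>E {..<n})" by (intro finite_PiE) auto
  have "{i \<in> {..<r} \<rightarrow>\<^sub>E {..<n}. \<not> inj_on i {..<r}} \<subseteq> (\<Union>b<r. \<Union>a<b. ?S a b)"
  proof
    fix i assume i: "i \<in> {i \<in> {..<r} \<rightarrow>\<^sub>E {..<n}. \<not> inj_on i {..<r}}"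
    hence "\<not> inj_on i {..<r}" by simp
    then obtain a b where "a \<in> {..<r}" "b \<in> {..<r}" "i a = i b" "a \<noteq> b"
      unfolding inj_on_def by blast
    hence ab: "a < r" "b < r" "i a = i b" "a \<noteq> b" by simp_all
    obtain a' b' where ab': "a' < b'" "b' < r" "i a' = i b'"
    proof (cases "a < b")
      case True
      thus ?thesis using that[of a b] ab by simp
    next
      case False
      thus ?thesis using that[of b a] ab by simp
    qed
    have "i \<in> ?S a' b'" using i ab' by simp
    hence "i \<in> (\<Union>a<b'. ?S a b')" by (rule UN_I[rotated]) (use ab' in simp)
    thus "i \<in> (\<Union>b<r. \<Union>a<b. ?S a b)" by (rule UN_I[rotated]) (use ab' in simp)
  qed
  hence "card {i \<in> {..<r} \<rightarrow>\<^sub>E {..<n}. \<not> inj_on i {..<r}} \<le> card (\<Union>b<r. \<Union>a<b. ?S a b)"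
    using fin by (intro card_mono) auto
  also have "\<dots> \<le> (\<Sum>b<r. card (\<Union>a<b. ?S a b))" by (intro card_UN_le) auto
  also have "\<dots> \<le> (\<Sum>b<r. \<Sum>a<b. card (?S a b))" by (intro sum_mono card_UN_le) auto
  also have "\<dots> \<le> (\<Sum>b<r. \<Sum>a<b. n ^ (r - 1))"
  proof (intro sum_mono)
    fix b a assume "b \<in> {..<r}" "a \<in> {..<b}"
    hence ab: "a < r" "b < r" "a \<noteq> b" by auto
    show "card (?S a b) \<le> n ^ (r - 1)"
    proof (rule card_functions_determined_coordinate_le[OF _ ab(2)])
      fix i i' assume "i \<in> ?S a b" "i' \<in> ?S a b" and k: "\<And>k. k < r \<Longrightarrow> k \<noteq> b \<Longrightarrow> i k = i' k"
      hence "i a = i b" "i' a = i' b" by auto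
      thus "i b = i' b" using k[OF ab(1,3)] by simp
    qed auto
  qed
  also have "\<dots> = (\<Sum>b<r. b) * n ^ (r - 1)" by (simp add: sum_distrib_right)
  finally have "real (card {i \<in> {..<r} \<rightarrow>\<^sub>E {..<n}. \<not> inj_on i {..<r}}) \<le> real (\<Sum>b<r. b) * real n ^ (r - 1)"
    unfolding of_nat_mult[symmetric] of_nat_power[symmetric] of_nat_le_iff .
  also have "real (\<Sum>b<r. b) = real (r * (r - 1)) / 2"
  proof -
    have "2 * (\<Sum>b<r. b) = r * (r - 1)"
    proof (induction r)
      case (Suc r)
      thus ?case by (cases r) auto
    qed simp
    hence "real (2 * (\<Sum>b<r. b)) = real (r * (r - 1))" by (rule arg_cong)
    thus ?thesis unfolding of_nat_mult of_nat_numeral by linarith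
  qed
  finally show ?thesis by simp
qed

lemma four_squares_le: "4 * r ^ 2 \<le> 9 * (2 :: nat) ^ r"
proof (induction r rule: less_induct)
  case (less r)
  show ?case
  proof (cases "r \<le> 3")
    case True
    hence "r \<in> {0, 1, 2, 3}" by auto
    thus ?thesis by auto
  next
    case False
    define k where "k = r - 1"
    have r: "r = Suc k" and k: "k \<ge> 3" using False by (auto simp: k_def)
    have "3 * k \<le> k * k" using k by (intro mult_right_mono) auto
    hence "2 * k + 1 \<le> k ^ 2" unfolding power2_eq_square using k by linarith
    moreover have "r ^ 2 = k ^ 2 + (2 * k + 1)" by (simp add: r power2_eq_square)
    ultimately have "4 * r ^ 2 \<le> 2 * (4 * k ^ 2)" by linarith
    also have "\<dots> \<le> 2 * (9 * 2 ^ k)" using less[of k] r by simp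
    finally show ?thesis by (simp add: r)
  qed
qed

lemma pairs_le_power_two: "r * (r - 1) \<le> (2 :: nat) ^ r"
proof (induction r rule: less_induct)
  case (less r)
  show ?case
  proof (cases "r \<le> 3")
    case True
    hence "r \<in> {0, 1, 2, 3}" by auto
    thus ?thesis by auto
  next
    case False
    define k where "k = r - 2"
    have r: "r = Suc (Suc k)" and k: "k \<ge> 2" using False by (auto simp: k_def)
    have "2 * k \<le> k * k" using k by (intro mult_right_mono) auto
    moreover have "r * (r - 1) = k * k + 3 * k + 2" by (simp add: r algebra_simps)
    moreover have "Suc k * k = k * k + k" by simp
    ultimately have "r * (r - 1) \<le> 2 * (Suc k * k)" using k by linarith
    also have "\<dots> \<le> 2 * 2 ^ Suc k" using less[of "Suc k"] r by simp
    finally show ?thesis by (simp add: r)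
  qed
qed

context
  fixes M :: "'a measure" and r n :: nat and h :: "(nat \<Rightarrow> 'a) \<Rightarrow> real" and \<beta> :: real
  assumes M: "prob_space M" and n: "n \<ge> 1" and r: "r \<ge> 1"
    and h[measurable]: "h \<in> borel_measurable (tuples r M)"
    and h_bdd: "\<And>y. y \<in> space (tuples r M) \<Longrightarrow> \<bar>h y\<bar> \<le> \<beta>"
    and h_diag: "\<And>y a b. y \<in> space (tuples r M) \<Longrightarrow> a < r \<Longrightarrow> b < r \<Longrightarrow> a \<noteq> b \<Longrightarrow> y a = y b \<Longrightarrow> h y = 0"
begin

lemma measurable_pick_tuple:
  assumes "i \<in> {..<r} \<rightarrow>\<^sub>E {..<n}"
  shows "(\<lambda>x. \<lambda>k\<in>{..<r}. x (i k)) \<in> measurable (tuples n M) (tuples r M)"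
  unfolding tuples_def using assms
  by (intro measurable_restrict measurable_component_singleton) auto

lemma pick_tuple_in_space:
  assumes "i \<in> {..<r} \<rightarrow>\<^sub>E {..<n}" "x \<in> space (tuples n M)"
  shows "(\<lambda>k\<in>{..<r}. x (i k)) \<in> space (tuples r M)"
  using measurable_space[OF measurable_pick_tuple] assms .

lemma measurable_V_statistic: "V_statistic r n h \<in> borel_measurable (tuples n M)"
proof -
  have "(\<lambda>x. h (\<lambda>k\<in>{..<r}. x (i k))) \<in> borel_measurable (tuples n M)"
    if "i \<in> {..<r} \<rightarrow>\<^sub>E {..<n}" for i
    using measurable_compose[OF measurable_pick_tuple[OF that] h] .
  hence "(\<lambda>x. (\<Sum>i\<in>{..<r} \<rightarrow>\<^sub>E {..<n}. h (\<lambda>k\<in>{..<r}. x (i k))) / real n ^ r) \<in> borel_measurable (tuples n M)"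
    by (intro borel_measurable_divide borel_measurable_sum borel_measurable_const)
  thus ?thesis by (simp add: V_statistic_def[abs_def])
qed

lemma V_statistic_bdd:
  assumes x: "x \<in> space (tuples n M)"
  shows "\<bar>V_statistic r n h x\<bar> \<le> \<beta>"
proof -
  have "\<bar>\<Sum>i\<in>{..<r} \<rightarrow>\<^sub>E {..<n}. h (\<lambda>k\<in>{..<r}. x (i k))\<bar> \<le> (\<Sum>i\<in>{..<r} \<rightarrow>\<^sub>E {..<n}. \<beta>)"
    by (rule order_trans[OF sum_abs], rule sum_mono) (rule h_bdd[OF pick_tuple_in_space[OF _ x]])
  also have "\<dots> = \<beta> * real n ^ r" by (simp add: card_PiE)
  finally show ?thesis using n by (simp add: V_statistic_def abs_divide pos_divide_le_eq)
qed

text \<open>Only index tuples that contain \<open>j\<close> contribute to the difference, at most \<open>r n\<^bsup>r - 1\<^esup>\<close> of the \<open>n\<^sup>r\<close>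
tuples.\<close>

lemma V_statistic_bounded_differences:
  assumes x: "x \<in> space (tuples n M)" and j: "j < n" and y: "y \<in> space M"
  shows "\<bar>V_statistic r n h (x(j := y)) - V_statistic r n h x\<bar> \<le> 2 * \<beta> * real r / real n"
proof -
  let ?I = "{..<r} \<rightarrow>\<^sub>E {..<n}"
  let ?p = "\<lambda>x i. \<lambda>k\<in>{..<r}. x (i k)"
  have x': "x(j := y) \<in> space (tuples n M)"
    using x j y by (auto simp: tuples_def space_PiM PiE_iff extensional_def)
  have \<beta>: "\<beta> \<ge> 0" using V_statistic_bdd[OF x] by linarith
  have fin: "finite ?I" by (intro finite_PiE) auto
  define J where "J = (\<Union>k<r. {i \<in> ?I. i k = j})"
  have "card J \<le> (\<Sum>k<r. card {i \<in> ?I. i k = j})" unfolding J_def by (intro card_UN_le) auto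
  also have "\<dots> \<le> (\<Sum>k<r. n ^ (r - 1))"
  proof (rule sum_mono)
    fix k assume "k \<in> {..<r}"
    hence k: "k < r" by simp
    show "card {i \<in> ?I. i k = j} \<le> n ^ (r - 1)"
      by (rule card_functions_determined_coordinate_le[OF _ k]) auto
  qed
  finally have J: "real (card J) \<le> real r * real n ^ (r - 1)"
    by (simp flip: of_nat_power of_nat_mult)
  have "(\<Sum>i\<in>?I. h (?p (x(j := y)) i)) - (\<Sum>i\<in>?I. h (?p x i)) =
        (\<Sum>i\<in>?I. h (?p (x(j := y)) i) - h (?p x i))"
    by (simp add: sum_subtractf)
  also have "\<dots> = (\<Sum>i\<in>J. h (?p (x(j := y)) i) - h (?p x i))"
  proof (rule sum.mono_neutral_right)
    show "\<forall>i\<in>?I - J. h (?p (x(j := y)) i) - h (?p x i) = 0"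
    proof
      fix i assume "i \<in> ?I - J"
      hence "i k \<noteq> j" if "k < r" for k using that by (auto simp: J_def)
      hence "?p (x(j := y)) i = ?p x i" by (intro restrict_ext) auto
      thus "h (?p (x(j := y)) i) - h (?p x i) = 0" by simp
    qed
  qed (use fin in \<open>auto simp: J_def\<close>)
  also have "\<bar>\<dots>\<bar> \<le> (\<Sum>i\<in>J. 2 * \<beta>)"
  proof (rule order_trans[OF sum_abs], rule sum_mono)
    fix i assume "i \<in> J"
    hence i: "i \<in> ?I" by (auto simp: J_def)
    show "\<bar>h (?p (x(j := y)) i) - h (?p x i)\<bar> \<le> 2 * \<beta>"
      using h_bdd[OF pick_tuple_in_space[OF i x]] h_bdd[OF pick_tuple_in_space[OF i x']] by linarith
  qed
  also have "\<dots> = real (card J) * (2 * \<beta>)" by simp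
  also have "\<dots> \<le> real r * real n ^ (r - 1) * (2 * \<beta>)"
    using J \<beta> by (intro mult_right_mono) auto
  finally have "\<bar>(\<Sum>i\<in>?I. h (?p (x(j := y)) i)) - (\<Sum>i\<in>?I. h (?p x i))\<bar> / real n ^ r
      \<le> real r * real n ^ (r - 1) * (2 * \<beta>) / real n ^ r"
    by (rule divide_right_mono) simp
  also have "real r * real n ^ (r - 1) * (2 * \<beta>) / real n ^ r = 2 * \<beta> * real r / real n"
    using n r by (cases r) (auto simp: field_simps)
  finally show ?thesis
    by (simp add: V_statistic_def abs_divide flip: diff_divide_distrib)
qed

definition noninjective_fraction :: real
  where "noninjective_fraction = real (card {i \<in> {..<r} \<rightarrow>\<^sub>E {..<n}. \<not> inj_on i {..<r}}) / real n ^ r"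

lemma noninjective_fraction_bounds:
  "0 \<le> noninjective_fraction" "noninjective_fraction \<le> 1"
  "noninjective_fraction \<le> real (r * (r - 1)) / (2 * real n)"
proof -
  let ?I = "{..<r} \<rightarrow>\<^sub>E {..<n}"
  have fin: "finite ?I" by (intro finite_PiE) auto
  show "0 \<le> noninjective_fraction" by (simp add: noninjective_fraction_def)
  have "card {i \<in> ?I. \<not> inj_on i {..<r}} \<le> card ?I" using fin by (intro card_mono) auto
  hence "card {i \<in> ?I. \<not> inj_on i {..<r}} \<le> n ^ r" by (simp add: card_PiE)
  hence "real (card {i \<in> ?I. \<not> inj_on i {..<r}}) \<le> real (n ^ r)" by (rule of_nat_mono)
  thus "noninjective_fraction \<le> 1" using n by (simp add: noninjective_fraction_def)
  have "noninjective_fraction \<le> real (r * (r - 1)) / 2 * real n ^ (r - 1) / real n ^ r"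
    unfolding noninjective_fraction_def by (intro divide_right_mono card_noninjective_le) auto
  also have "\<dots> = real (r * (r - 1)) / (2 * real n)"
    using n r by (cases r) (auto simp: field_simps)
  finally show "noninjective_fraction \<le> real (r * (r - 1)) / (2 * real n)" .
qed

text \<open>For an injective index tuple, the points are independent with law \<open>M\<close>. For any other
tuple, two points coincide and \<open>h\<close> vanishes.\<close>

lemma expectation_V_statistic:
  "(\<integral>x. V_statistic r n h x \<partial>tuples n M) = (1 - noninjective_fraction) * (\<integral>y. h y \<partial>tuples r M)"
proof -
  let ?I = "{..<r} \<rightarrow>\<^sub>E {..<n}"
  let ?\<theta> = "\<integral>y. h y \<partial>tuples r M"
  let ?p = "\<lambda>x i. \<lambda>k\<in>{..<r}. x (i k)"
  have fin: "finite ?I" by (intro finite_PiE) auto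
  interpret T: prob_space "tuples n M" unfolding tuples_def by (rule prob_space_PiM) (rule M)
  have int: "integrable (tuples n M) (\<lambda>x. h (?p x i))" if i: "i \<in> ?I" for i
    using measurable_compose[OF measurable_pick_tuple[OF i] h] h_bdd[OF pick_tuple_in_space[OF i]]
    by (intro T.integrable_const_bound[where B = \<beta>]) auto
  have each: "(\<integral>x. h (?p x i) \<partial>tuples n M) = (if inj_on i {..<r} then ?\<theta> else 0)"
    if i: "i \<in> ?I" for i
  proof (cases "inj_on i {..<r}")
    case True
    have "distr (tuples n M) (tuples r M) (\<lambda>x. ?p x i) = tuples r M"
      unfolding tuples_def using distr_PiM_reindex[of "{..<n}" "\<lambda>_. M" i "{..<r}"] M True i
      by (auto simp: PiE_def)
    hence "?\<theta> = (\<integral>y. h y \<partial>distr (tuples n M) (tuples r M) (\<lambda>x. ?p x i))" by simp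
    also have "\<dots> = (\<integral>x. h (?p x i) \<partial>tuples n M)"
      by (rule integral_distr[OF measurable_pick_tuple[OF i] h])
    finally show ?thesis using True by simp
  next
    case False
    then obtain a b where ab: "a \<in> {..<r}" "b \<in> {..<r}" "i a = i b" "a \<noteq> b"
      unfolding inj_on_def by blast
    have "h (?p x i) = 0" if x: "x \<in> space (tuples n M)" for x
      by (rule h_diag[OF pick_tuple_in_space[OF i x], of a b]) (use ab in auto)
    hence "(\<integral>x. h (?p x i) \<partial>tuples n M) = (\<integral>x. 0 \<partial>tuples n M)"
      by (rule Bochner_Integration.integral_cong[OF refl])
    thus ?thesis using False by simp
  qed
  have "(\<integral>x. V_statistic r n h x \<partial>tuples n M) = (\<Sum>i\<in>?I. \<integral>x. h (?p x i) \<partial>tuples n M) / real n ^ r"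
    unfolding V_statistic_def integral_divide_zero
    by (subst Bochner_Integration.integral_sum[OF int]) simp_all
  also have "\<dots> = (\<Sum>i\<in>?I. if inj_on i {..<r} then ?\<theta> else 0) / real n ^ r"
    by (simp only: each cong: sum.cong)
  also have "\<dots> = (\<Sum>i\<in>?I. ?\<theta> - (if \<not> inj_on i {..<r} then ?\<theta> else 0)) / real n ^ r"
    by (intro arg_cong[where f = "\<lambda>s. s / real n ^ r"] sum.cong) auto
  also have "\<dots> = (real n ^ r * ?\<theta> - real (card {i \<in> ?I. \<not> inj_on i {..<r}}) * ?\<theta>) / real n ^ r"
    unfolding sum_subtractf using fin by (simp add: sum.If_cases card_PiE Int_def)
  also have "\<dots> = (1 - noninjective_fraction) * ?\<theta>"
    using n by (simp add: noninjective_fraction_def field_simps)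
  finally show ?thesis .
qed

text \<open>The tolerance \<open>\<epsilon> / 2\<close> is divided into \<open>\<epsilon> / 8\<close> for the bias and \<open>3 \<epsilon> / 8\<close> for the fluctuation. With
\<open>p\<close> the fraction of noninjective index tuples, the bias is at most \<open>p \<beta>\<close>. As \<open>p \<le> 1\<close>, its square
is at most \<open>p \<beta>\<^sup>2 \<le> r (r - 1) \<beta>\<^sup>2 / (2 n)\<close>, which the bound on \<open>n\<close> turns into \<open>\<epsilon>\<^sup>2 / 64\<close> because
\<open>r (r - 1) \<le> 2\<^sup>r\<close>. For the fluctuation the differences are bounded by \<open>2 \<beta> r / n\<close>, and because of \<open>4 r\<^sup>2 \<le> 9 \<cdot> 2\<^sup>r\<close> the tail
is at most \<open>2 exp (- ln (4 / \<delta>)) = \<delta> / 2\<close>.\<close>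

lemma V_statistic_tail:
  assumes \<delta>: "0 < \<delta>" "\<delta> < 1" and \<epsilon>: "\<epsilon> > 0"
    and large: "2 ^ (r + 5) * \<beta>\<^sup>2 * ln (4 / \<delta>) / \<epsilon>\<^sup>2 \<le> real n"
  shows "measure (tuples n M) {x \<in> space (tuples n M).
           \<bar>V_statistic r n h x - (\<integral>y. h y \<partial>tuples r M)\<bar> \<ge> \<epsilon> / 2} \<le> \<delta> / 2"
proof -
  let ?\<theta> = "\<integral>y. h y \<partial>tuples r M"
  let ?e = "\<integral>x. V_statistic r n h x \<partial>tuples n M"
  let ?T = "tuples n M"
  interpret T: prob_space ?T unfolding tuples_def by (rule prob_space_PiM) (rule M)
  interpret Tr: prob_space "tuples r M" unfolding tuples_def by (rule prob_space_PiM) (rule M)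
  have int: "integrable (tuples r M) h"
    using h_bdd by (intro Tr.integrable_const_bound[where B = \<beta>]) auto
  have "\<bar>?\<theta>\<bar> \<le> (\<integral>y. \<bar>h y\<bar> \<partial>tuples r M)" by (rule integral_abs_bound)
  also have "\<dots> \<le> (\<integral>y. \<beta> \<partial>tuples r M)" using int h_bdd by (intro integral_mono) auto
  finally have \<theta>: "\<bar>?\<theta>\<bar> \<le> \<beta>" by (simp add: Tr.prob_space)
  hence \<beta>0: "\<beta> \<ge> 0" by linarith
  have n0: "real n > 0" using n by simp
  define l where "l = ln (4 / \<delta>)"
  have l1: "l \<ge> 1"
  proof -
    have "exp 1 \<le> 4 / \<delta>" using exp_le \<delta> by (simp add: pos_le_divide_eq) (smt (verit) exp_gt_zero mult_left_le)
    thus ?thesis using \<delta> by (simp add: l_def ln_ge_iff)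
  qed
  have large': "2 ^ (r + 5) * \<beta>\<^sup>2 * l \<le> real n * \<epsilon>\<^sup>2"
    using large \<epsilon> by (simp add: l_def pos_divide_le_eq)
  have "real (4 * r ^ 2) \<le> real (9 * 2 ^ r)" by (rule of_nat_mono) (rule four_squares_le)
  hence r_sq: "4 * real r ^ 2 \<le> 9 * 2 ^ r" by simp
  have "real (r * (r - 1)) \<le> real (2 ^ r)" by (rule of_nat_mono) (rule pairs_le_power_two)
  hence r_pairs: "real (r * (r - 1)) \<le> 2 ^ r" by simp
  have bias: "\<bar>?e - ?\<theta>\<bar> \<le> \<epsilon> / 8"
  proof -
    let ?p = noninjective_fraction
    note p = noninjective_fraction_bounds
    have "?e - ?\<theta> = - (?p * ?\<theta>)" unfolding expectation_V_statistic by (simp add: algebra_simps)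
    hence "\<bar>?e - ?\<theta>\<bar> = ?p * \<bar>?\<theta>\<bar>" using p(1) by (simp add: abs_mult)
    also have "\<dots> \<le> ?p * \<beta>" using p(1) \<theta> by (intro mult_left_mono)
    finally have 1: "\<bar>?e - ?\<theta>\<bar> \<le> ?p * \<beta>" .
    have "(?p * \<beta>)\<^sup>2 = ?p * ?p * \<beta>\<^sup>2" by (simp add: power2_eq_square mult_ac)
    also have "\<dots> \<le> 1 * (real (r * (r - 1)) / (2 * real n)) * \<beta>\<^sup>2"
      using p by (intro mult_right_mono mult_mono) auto
    also have "\<dots> \<le> 1 * (2 ^ r / (2 * real n)) * \<beta>\<^sup>2"
      using r_pairs n0 by (intro mult_right_mono mult_left_mono divide_right_mono) auto
    also have "\<dots> = 2 ^ (r + 5) * \<beta>\<^sup>2 * 1 / (64 * real n)"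
      using n0 by (simp add: field_simps power_add)
    also have "\<dots> \<le> 2 ^ (r + 5) * \<beta>\<^sup>2 * l / (64 * real n)"
      using l1 by (intro divide_right_mono mult_left_mono) auto
    also have "\<dots> \<le> real n * \<epsilon>\<^sup>2 / (64 * real n)"
      using large' by (intro divide_right_mono) auto
    also have "\<dots> = (\<epsilon> / 8)\<^sup>2" using n0 by (simp add: power_divide)
    finally have "?p * \<beta> \<le> \<epsilon> / 8" by (rule power2_le_imp_le) (use \<epsilon> in simp)
    with 1 show ?thesis by linarith
  qed
  show ?thesis
  proof (cases "\<beta> = 0")
    case True
    have "\<not> \<epsilon> / 2 \<le> \<bar>V_statistic r n h x - ?\<theta>\<bar>" if "x \<in> space ?T" for x
      using V_statistic_bdd[OF that] \<theta> \<epsilon> True by linarith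
    hence empty: "{x \<in> space ?T. \<bar>V_statistic r n h x - ?\<theta>\<bar> \<ge> \<epsilon> / 2} = {}" by blast
    show ?thesis unfolding empty using \<delta> by simp
  next
    case False
    hence \<beta>: "\<beta> > 0" using \<beta>0 by simp
    let ?c = "2 * \<beta> * real r / real n"
    let ?t = "3 * \<epsilon> / 8"
    have c: "?c > 0" using \<beta> r n0 by simp
    have sub: "{x \<in> space ?T. \<bar>V_statistic r n h x - ?\<theta>\<bar> \<ge> \<epsilon> / 2} \<subseteq> {x \<in> space ?T. \<bar>V_statistic r n h x - ?e\<bar> \<ge> ?t}"
    proof (intro Collect_mono impI, elim conjE, intro conjI)
      fix x assume "\<epsilon> / 2 \<le> \<bar>V_statistic r n h x - ?\<theta>\<bar>"
      thus "?t \<le> \<bar>V_statistic r n h x - ?e\<bar>" using bias by linarith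
    qed
    note measurable_V_statistic[measurable]
    have "measure ?T {x \<in> space ?T. \<bar>V_statistic r n h x - ?\<theta>\<bar> \<ge> \<epsilon> / 2} \<le>
          measure ?T {x \<in> space ?T. \<bar>V_statistic r n h x - ?e\<bar> \<ge> ?t}"
      by (rule T.finite_measure_mono[OF sub]) measurable
    also have "\<dots> \<le> 2 * exp (- 2 * ?t\<^sup>2 / (real (card {..<n}) * ?c\<^sup>2))"
      unfolding tuples_def
    proof (rule bounded_differences_tail[OF M])
      show "{..<n} \<noteq> {}" using n by (auto simp: lessThan_empty_iff)
      show "V_statistic r n h \<in> borel_measurable (PiM {..<n} (\<lambda>_. M))"
        using measurable_V_statistic by (simp add: tuples_def)
      show "\<bar>V_statistic r n h x\<bar> \<le> \<beta>" if "x \<in> space (PiM {..<n} (\<lambda>_. M))" for x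
        using V_statistic_bdd that by (simp add: tuples_def)
      show "\<bar>V_statistic r n h (x(i := y)) - V_statistic r n h x\<bar> \<le> ?c"
        if "x \<in> space (PiM {..<n} (\<lambda>_. M))" "i \<in> {..<n}" "y \<in> space M" for x i y
        using V_statistic_bounded_differences[of x i y] that by (simp add: tuples_def)
    qed (use c \<epsilon> in auto)
    also have "\<dots> \<le> 2 * exp (- l)"
    proof -
      have "l * (real n * ?c\<^sup>2) = l * (4 * real r ^ 2) * \<beta>\<^sup>2 / real n"
        using n0 by (simp add: field_simps power2_eq_square)
      also have "\<dots> \<le> l * (9 * 2 ^ r) * \<beta>\<^sup>2 / real n"
        using r_sq l1 by (intro divide_right_mono mult_right_mono mult_left_mono) auto
      also have "\<dots> = 9 / 32 * (2 ^ (r + 5) * \<beta>\<^sup>2 * l) / real n" by (simp add: power_add)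
      also have "\<dots> \<le> 9 / 32 * (real n * \<epsilon>\<^sup>2) / real n"
        using large' by (intro divide_right_mono mult_left_mono) auto
      also have "\<dots> = 2 * ?t\<^sup>2" using n0 by (simp add: power2_eq_square)
      finally have le: "l * (real n * ?c\<^sup>2) \<le> 2 * ?t\<^sup>2" .
      have "real n * ?c\<^sup>2 > 0" by (rule mult_pos_pos[OF n0 zero_less_power[OF c]])
      hence "l \<le> 2 * ?t\<^sup>2 / (real n * ?c\<^sup>2)" using le by (simp only: pos_le_divide_eq)
      thus ?thesis by simp
    qed
    also have "2 * exp (- l) = \<delta> / 2" using \<delta> by (simp add: l_def exp_minus)
    finally show ?thesis .
  qed
qed

end

section \<open>Polynomials on the cube\<close>

lemma cube_eq_cbox: "(cube :: (real ^ 'd) set) = cbox (\<chi> k. - 1) (\<chi> k. 1)"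
  by (auto simp: cube_def mem_box_cart)

lemma space_eq_cube: "sets M = sets (restrict_space borel cube) \<Longrightarrow> space M = cube"
  by (drule sets_eq_imp_space_eq) (simp add: space_restrict_space)

lemma compact_cube: "compact (cube :: (real ^ 'd) set)"
  unfolding cube_eq_cbox by (rule compact_cbox)

lemma cube_nonempty: "(cube :: (real ^ 'd) set) \<noteq> {}"
proof -
  have "(0 :: real ^ 'd) \<in> cube" by (simp add: cube_def)
  thus ?thesis by blast
qed

lemma sets_borel_cube: "(cube :: (real ^ 'd) set) \<in> sets borel"
  by (rule borel_closed[OF compact_imp_closed[OF compact_cube]])

lemma continuous_monomial_fun: "continuous_on UNIV (monomial_fun i)"
  unfolding monomial_fun_def[abs_def] by (intro continuous_intros)

lemma monomial_fun_abs_le: "x \<in> cube \<Longrightarrow> \<bar>monomial_fun i x\<bar> \<le> 1"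
  unfolding monomial_fun_def abs_prod
  by (intro prod_le_1 conjI) (auto simp: cube_def power_abs abs_le_iff intro!: power_le_one)

lemma continuous_orthonormal_poly: "continuous_on UNIV (orthonormal_poly \<gamma> i)"
  unfolding orthonormal_poly_def
proof (induction i rule: less_induct)
  case (less i)
  show ?case
    by (subst gram_schmidt_fun.simps)
      (auto simp: Let_def divide_inverse intro!: continuous_intros less continuous_monomial_fun)
qed

lemma borel_measurable_continuous_restrict:
  "continuous_on UNIV f \<Longrightarrow> f \<in> borel_measurable (restrict_space borel X)"
  by (intro measurable_restrict_space1 borel_measurable_continuous_onI)

text \<open>A polynomial of norm \<open>0\<close> vanishes \<open>\<mu>\<close>-almost everywhere. But its coefficient \<open>a i\<close> is not \<open>0\<close>, so its
zero set is a Lebesgue null set, to which \<open>\<mu>\<close> assigns measure \<open>0\<close>.\<close>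

lemma L2_norm_polynomial_pos:
  fixes \<mu> :: "(real ^ 'd::{finite,linorder}) measure"
  assumes \<mu>: "prob_space \<mu>" "sets \<mu> = sets (restrict_space borel cube)"
      "absolutely_continuous (restrict_space lborel cube) \<mu>"
    and i: "i < m" "a i = 1"
  shows "L2_inner \<mu> (\<lambda>x. \<Sum>l<m. a l * monomial_fun l x) (\<lambda>x. \<Sum>l<m. a l * monomial_fun l x) > 0"
proof -
  interpret prob_space \<mu> by fact
  let ?v = "\<lambda>x :: real ^ 'd::{finite,linorder}. \<Sum>l<m. a l * monomial_fun l x"
  have space: "space \<mu> = cube"
    by (rule space_eq_cube[OF \<mu>(2)])
  have cont: "continuous_on UNIV ?v" by (intro continuous_intros continuous_monomial_fun)
  hence "bounded (?v ` cube)"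
    by (intro compact_imp_bounded compact_continuous_image compact_cube) (rule continuous_on_subset, auto)
  then obtain b where b: "\<And>x. x \<in> cube \<Longrightarrow> \<bar>?v x\<bar> \<le> b" by (auto simp: bounded_iff)
  have meas: "?v \<in> borel_measurable \<mu>"
    using borel_measurable_continuous_restrict[OF cont] by (subst measurable_cong_sets[OF \<mu>(2) refl])
  have int: "integrable \<mu> (\<lambda>x. ?v x * ?v x)"
  proof (rule integrable_const_bound[where B = "b * b"])
    show "AE x in \<mu>. norm (?v x * ?v x) \<le> b * b"
    proof (rule AE_I2)
      fix x assume "x \<in> space \<mu>"
      hence "\<bar>?v x\<bar> \<le> b" using b by (simp add: space)
      thus "norm (?v x * ?v x) \<le> b * b"
        unfolding real_norm_def abs_mult using order_trans[OF abs_ge_zero] by (intro mult_mono) auto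
    qed
  qed (use meas in auto)
  define T where "T = (grlex_nth :: nat \<Rightarrow> 'd::{finite,linorder} \<Rightarrow> nat) ` {..<m}"
  have v: "?v x = (\<Sum>\<beta>\<in>T. a (grlex_rank \<beta>) * (\<Prod>k\<in>UNIV. x $ k ^ \<beta> k))" for x
    unfolding T_def by (subst sum.reindex) (auto simp: inj_on_subset[OF inj_grlex_nth] grlex_rank_nth monomial_fun_def)
  have "{x. ?v x = 0} \<in> null_sets lborel"
    unfolding v by (rule null_sets_zeros_of_polynomial[of T "grlex_nth i"])
      (use i in \<open>auto simp: T_def grlex_rank_nth\<close>)
  hence "{x. ?v x = 0} \<inter> cube \<in> null_sets (restrict_space lborel cube)"
    by (subst null_sets_restrict_space) (auto simp: sets_borel_cube intro: null_set_Int2)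
  hence "{x. ?v x = 0} \<inter> cube \<in> null_sets \<mu>"
    using \<mu>(3) by (auto simp: absolutely_continuous_def)
  hence nz: "AE x in \<mu>. ?v x \<noteq> 0"
    by (rule AE_I') (auto simp: space)
  have "(\<integral>x. ?v x * ?v x \<partial>\<mu>) \<noteq> 0"
  proof
    assume "(\<integral>x. ?v x * ?v x \<partial>\<mu>) = 0"
    hence "AE x in \<mu>. ?v x * ?v x = 0"
      using int by (subst (asm) integral_nonneg_eq_0_iff_AE) auto
    with nz have "AE x in \<mu>. False" by eventually_elim simp
    thus False by simp
  qed
  moreover have "(\<integral>x. ?v x * ?v x \<partial>\<mu>) \<ge> 0" by (intro integral_nonneg_AE) auto
  ultimately show ?thesis unfolding L2_inner_def by linarith
qed

lemma integrable_monomial_product: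
  fixes \<gamma> :: "(real ^ 'd::{finite,linorder}) measure"
  assumes \<gamma>: "prob_space \<gamma>" "sets \<gamma> = sets (restrict_space borel cube)"
  shows "(\<lambda>x. monomial_fun k x * monomial_fun l x) \<in> borel_measurable \<gamma>"
    and "integrable \<gamma> (\<lambda>x. monomial_fun k x * monomial_fun l x)"
proof -
  interpret prob_space \<gamma> by fact
  have space: "space \<gamma> = cube"
    by (rule space_eq_cube[OF \<gamma>(2)])
  show meas: "(\<lambda>x. monomial_fun k x * monomial_fun l x) \<in> borel_measurable \<gamma>"
    using borel_measurable_continuous_restrict[of "\<lambda>x. monomial_fun k x * monomial_fun l x" cube]
    by (subst measurable_cong_sets[OF \<gamma>(2) refl]) (auto intro!: continuous_intros continuous_monomial_fun)
  show "integrable \<gamma> (\<lambda>x. monomial_fun k x * monomial_fun l x)"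
  proof (rule integrable_const_bound[where B = 1])
    show "AE x in \<gamma>. norm (monomial_fun k x * monomial_fun l x) \<le> 1"
      by (rule AE_I2) (auto simp: space abs_mult intro!: mult_le_one monomial_fun_abs_le)
  qed (rule meas)
qed

lemma orthonormal_poly_perturbation:
  fixes \<mu> :: "(real ^ 'd::{finite,linorder}) measure"
  assumes \<mu>: "prob_space \<mu>" "sets \<mu> = sets (restrict_space borel cube)"
      "absolutely_continuous (restrict_space lborel cube) \<mu>"
  obtains L \<rho> where "L > 0" "\<rho> > 0"
    "\<And>\<gamma> i x. prob_space \<gamma> \<Longrightarrow> sets \<gamma> = sets (restrict_space borel cube) \<Longrightarrow>
       (\<Sum>k<m. \<Sum>l<m. \<bar>L2_inner \<gamma> (monomial_fun k) (monomial_fun l) - L2_inner \<mu> (monomial_fun k) (monomial_fun l)\<bar>) \<le> \<rho> \<Longrightarrow>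
       i < m \<Longrightarrow> x \<in> cube \<Longrightarrow>
       \<bar>orthonormal_poly \<mu> i x - orthonormal_poly \<gamma> i x\<bar> \<le> L *
         (\<Sum>k<m. \<Sum>l<m. \<bar>L2_inner \<gamma> (monomial_fun k) (monomial_fun l) - L2_inner \<mu> (monomial_fun k) (monomial_fun l)\<bar>)"
proof -
  define S where "S = {\<gamma> :: (real ^ 'd::{finite,linorder}) measure. prob_space \<gamma> \<and> sets \<gamma> = sets (restrict_space borel cube)}"
  let ?f = "monomial_fun :: nat \<Rightarrow> real ^ 'd::{finite,linorder} \<Rightarrow> real"
  define D where "D \<gamma> = (\<Sum>k<m. \<Sum>l<m. \<bar>L2_inner \<gamma> (?f k) (?f l) - L2_inner \<mu> (?f k) (?f l)\<bar>)" for \<gamma>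
  have D0: "D \<gamma> \<ge> 0" for \<gamma> by (auto simp: D_def intro!: sum_nonneg)
  have "\<exists>L>0. \<exists>\<rho>>0. \<forall>\<gamma>\<in>S. 0 \<le> D \<gamma> \<and> D \<gamma> \<le> \<rho> \<longrightarrow>
         (\<forall>i<m. \<forall>x\<in>cube. \<bar>gram_schmidt_fun \<mu> ?f i x - gram_schmidt_fun \<gamma> ?f i x\<bar> \<le> L * D \<gamma>)"
  proof (rule gram_schmidt_perturbation)
    show "integrable \<gamma> (\<lambda>x. ?f k x * ?f l x)" if "\<gamma> \<in> S" for \<gamma> k l
      using that by (intro integrable_monomial_product) (auto simp: S_def)
    show "calm_at S D \<mu> (\<lambda>\<gamma>. L2_inner \<gamma> (?f k) (?f l))" if k: "k < m" and l: "l < m" for k l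
    proof (rule calm_atI[of 1 1])
      fix \<gamma>
      let ?d = "\<lambda>k l. \<bar>L2_inner \<gamma> (?f k) (?f l) - L2_inner \<mu> (?f k) (?f l)\<bar>"
      have "?d k l \<le> (\<Sum>l<m. ?d k l)" using l by (intro member_le_sum) auto
      also have "\<dots> \<le> D \<gamma>" unfolding D_def using k
        by (intro member_le_sum[of k "{..<m}" "\<lambda>k. \<Sum>l<m. ?d k l"]) (auto intro!: sum_nonneg)
      finally show "?d k l \<le> 1 * D \<gamma>" by simp
    qed auto
    show "\<mu> \<in> S" using \<mu> by (simp add: S_def)
    show "L2_inner \<mu> (\<lambda>x. \<Sum>l<m. a l * ?f l x) (\<lambda>x. \<Sum>l<m. a l * ?f l x) > 0"
      if "i < m" "a i = 1" for a i
      using L2_norm_polynomial_pos[where a = a and i = i and m = m, OF \<mu> that] .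
  qed (rule monomial_fun_abs_le)
  then obtain L \<rho> where "L > 0" "\<rho> > 0"
    and *: "\<forall>\<gamma>\<in>S. 0 \<le> D \<gamma> \<and> D \<gamma> \<le> \<rho> \<longrightarrow>
         (\<forall>i<m. \<forall>x\<in>cube. \<bar>gram_schmidt_fun \<mu> ?f i x - gram_schmidt_fun \<gamma> ?f i x\<bar> \<le> L * D \<gamma>)"
    by auto
  show ?thesis
  proof (rule that[OF \<open>L > 0\<close> \<open>\<rho> > 0\<close>], fold D_def)
    fix \<gamma> :: "(real ^ 'd::{finite,linorder}) measure" and i and x :: "real ^ 'd::{finite,linorder}"
    assume "prob_space \<gamma>" "sets \<gamma> = sets (restrict_space borel cube)" "D \<gamma> \<le> \<rho>" "i < m" "x \<in> cube"
    thus "\<bar>orthonormal_poly \<mu> i x - orthonormal_poly \<gamma> i x\<bar> \<le> L * D \<gamma>"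
      using * D0 by (simp add: S_def orthonormal_poly_def)
  qed
qed

section \<open>Concentration of the orthonormal polynomials\<close>

lemma empirical_mean_tail:
  assumes M: "prob_space M" and g[measurable]: "g \<in> borel_measurable M"
    and bdd: "\<And>y. y \<in> space M \<Longrightarrow> \<bar>g y\<bar> \<le> (1 :: real)" and n: "n \<ge> 1" and s: "s > 0"
  shows "measure (tuples n M) {x \<in> space (tuples n M). \<bar>(\<Sum>i<n. g (x i)) / real n - (\<integral>y. g y \<partial>M)\<bar> \<ge> s}
           \<le> 2 * exp (- (real n * s\<^sup>2 / 2))"
proof -
  interpret M: prob_space M by fact
  interpret P: product_prob_space "\<lambda>_::nat. M" "{..<n}" ..
  let ?P = "PiM {..<n} (\<lambda>_. M)"
  let ?F = "\<lambda>x. (\<Sum>i<n. g (x i)) / real n"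
  have n0: "real n > 0" using n by simp
  have int: "integrable ?P (\<lambda>x. g (x i))" if "i < n" for i
    using bdd that by (intro P.integrable_const_bound[where B = 1]) (auto simp: space_PiM PiE_iff)
  have "(\<integral>x. g (x i) \<partial>?P) = (\<integral>y. g y \<partial>M)" if i: "i < n" for i
  proof -
    have "(\<integral>y. g y \<partial>M) = (\<integral>y. g y \<partial>distr ?P M (\<lambda>x. x i))"
      using P.PiM_component[of i] i by simp
    also have "\<dots> = (\<integral>x. g (x i) \<partial>?P)" using i by (intro integral_distr) auto
    finally show ?thesis by simp
  qed
  hence E: "(\<integral>x. ?F x \<partial>?P) = (\<integral>y. g y \<partial>M)"
    using n0 by (simp add: Bochner_Integration.integral_sum int)
  have "measure ?P {x \<in> space ?P. \<bar>?F x - (\<integral>x. ?F x \<partial>?P)\<bar> \<ge> s}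
        \<le> 2 * exp (- 2 * s\<^sup>2 / (real (card {..<n}) * (2 / real n)\<^sup>2))"
  proof (rule bounded_differences_tail[OF M])
    show "{..<n} \<noteq> {}" using n by (auto simp: lessThan_empty_iff)
    show "\<bar>?F x\<bar> \<le> 1" if x: "x \<in> space ?P" for x
    proof -
      have "\<bar>\<Sum>i<n. g (x i)\<bar> \<le> (\<Sum>i<n. 1)"
        using bdd x by (intro order_trans[OF sum_abs] sum_mono) (auto simp: space_PiM PiE_iff)
      thus ?thesis using n0 by (simp add: abs_divide)
    qed
    show "\<bar>?F (x(i := y)) - ?F x\<bar> \<le> 2 / real n"
      if x: "x \<in> space ?P" and i: "i \<in> {..<n}" and y: "y \<in> space M" for x i y
    proof -
      have "(\<Sum>j<n. g ((x(i := y)) j)) - (\<Sum>j<n. g (x j)) = (\<Sum>j<n. g ((x(i := y)) j) - g (x j))"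
        by (simp only: sum_subtractf)
      also have "\<dots> = (\<Sum>j<n. if j = i then g y - g (x i) else 0)" by (rule sum.cong) auto
      also have "\<dots> = g y - g (x i)" using i by simp
      finally have "?F (x(i := y)) - ?F x = (g y - g (x i)) / real n"
        by (simp only: diff_divide_distrib[symmetric])
      moreover have "\<bar>g y - g (x i)\<bar> \<le> 2"
        using bdd[OF y] bdd[of "x i"] x i by (auto simp: space_PiM PiE_iff)
      ultimately show ?thesis using n0 by (simp add: abs_divide divide_right_mono)
    qed
  qed (use n0 s in auto)
  also have "- 2 * s\<^sup>2 / (real (card {..<n}) * (2 / real n)\<^sup>2) = - (real n * s\<^sup>2 / 2)"
    using n0 by (simp add: field_simps power2_eq_square)
  finally show ?thesis unfolding E by (simp add: tuples_def)
qed


text \<open>Outside \<open>B\<close>, every entry of the empirical Gram matrix is within \<open>\<kappa> \<epsilon>\<close> of its expectation. The constant \<open>\<kappa>\<close> is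
so small that the \<open>m\<^sup>2\<close> deviations add up to at most \<open>\<rho>\<close>, within the range of the perturbation bound,
and, after multiplication by \<open>L\<close>, to at most \<open>\<epsilon> / 2\<close>. The first of these is possible because
\<open>\<epsilon> \<le> E\<close>.\<close>

lemma orthonormal_poly_concentration:
  fixes \<mu> :: "(real ^ 'd::{finite,linorder}) measure"
  assumes \<mu>: "prob_space \<mu>" "sets \<mu> = sets (restrict_space borel cube)"
      "absolutely_continuous (restrict_space lborel cube) \<mu>"
    and m: "m \<ge> 1" and E: "E > 0"
  obtains \<kappa> where "\<kappa> > 0"
    "\<And>\<delta> \<epsilon> n. 0 < \<delta> \<Longrightarrow> \<delta> < 1 \<Longrightarrow> 0 < \<epsilon> \<Longrightarrow> \<epsilon> \<le> E \<Longrightarrow> n \<ge> 1 \<Longrightarrow>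
       2 / \<kappa>\<^sup>2 * ln ((2 * (real m)\<^sup>2 + 1) / \<delta>) / \<epsilon>\<^sup>2 \<le> real n \<Longrightarrow>
       \<exists>B\<in>sets (tuples n \<mu>). measure (tuples n \<mu>) B < \<delta> \<and>
         (\<forall>x\<in>space (tuples n \<mu>) - B. \<forall>i<m. \<forall>y\<in>cube.
            \<bar>orthonormal_poly \<mu> i y - orthonormal_poly (empirical cube n x) i y\<bar> < \<epsilon>)"
proof -
  let ?f = "monomial_fun :: nat \<Rightarrow> real ^ 'd::{finite,linorder} \<Rightarrow> real"
  define D where "D \<gamma> = (\<Sum>k<m. \<Sum>l<m. \<bar>L2_inner \<gamma> (?f k) (?f l) - L2_inner \<mu> (?f k) (?f l)\<bar>)" for \<gamma>
  obtain L \<rho> where L: "L > 0" and \<rho>: "\<rho> > 0"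
    and pert: "\<And>\<gamma> i x. prob_space \<gamma> \<Longrightarrow> sets \<gamma> = sets (restrict_space borel cube) \<Longrightarrow>
       D \<gamma> \<le> \<rho> \<Longrightarrow> i < m \<Longrightarrow> x \<in> cube \<Longrightarrow>
       \<bar>orthonormal_poly \<mu> i x - orthonormal_poly \<gamma> i x\<bar> \<le> L * D \<gamma>"
    unfolding D_def using orthonormal_poly_perturbation[OF \<mu>, of m] by blast
  have m0: "real m > 0" using m by simp
  have space: "space \<mu> = cube"
    by (rule space_eq_cube[OF \<mu>(2)])
  define \<kappa> where "\<kappa> = min (1 / (2 * L * (real m)\<^sup>2)) (\<rho> / (E * (real m)\<^sup>2))"
  have \<kappa>: "\<kappa> > 0" using L \<rho> m0 E by (simp add: \<kappa>_def)
  show ?thesis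
  proof (rule that[OF \<kappa>])
    fix \<delta> \<epsilon> :: real and n :: nat
    assume \<delta>: "0 < \<delta>" "\<delta> < 1" and \<epsilon>: "0 < \<epsilon>" "\<epsilon> \<le> E" and n: "n \<ge> 1"
      and large: "2 / \<kappa>\<^sup>2 * ln ((2 * (real m)\<^sup>2 + 1) / \<delta>) / \<epsilon>\<^sup>2 \<le> real n"
    let ?T = "tuples n \<mu>"
    interpret T: prob_space ?T unfolding tuples_def by (rule prob_space_PiM) (rule \<mu>)
    define s where "s = \<kappa> * \<epsilon>"
    have s: "s > 0" using \<kappa> \<epsilon> by (simp add: s_def)
    define g where "g p y = ?f (fst p) y * ?f (snd p) y" for p y
    define B where "B p = {x \<in> space ?T. \<bar>(\<Sum>i<n. g p (x i)) / real n - (\<integral>y. g p y \<partial>\<mu>)\<bar> \<ge> s}" for p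
    let ?J = "{..<m} \<times> {..<m}"
    have g_meas[measurable]: "g p \<in> borel_measurable \<mu>" for p
      unfolding g_def[abs_def] by (rule integrable_monomial_product[OF \<mu>(1,2)])
    have g_bdd: "\<bar>g p y\<bar> \<le> 1" if "y \<in> space \<mu>" for p y
      using that by (auto simp: g_def abs_mult space intro!: mult_le_one monomial_fun_abs_le)
    have B_sets: "B p \<in> sets ?T" for p
      unfolding B_def tuples_def by measurable
    have B_tail: "measure ?T (B p) \<le> 2 * exp (- (real n * s\<^sup>2 / 2))" for p
      unfolding B_def by (rule empirical_mean_tail[OF \<mu>(1) g_meas g_bdd n s])
    define C where "C = 2 * (real m)\<^sup>2 + 1"
    have C: "C > 0" by (simp add: C_def add_nonneg_pos)
    have "measure ?T (\<Union>p\<in>?J. B p) \<le> (\<Sum>p\<in>?J. measure ?T (B p))"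
      using B_sets by (intro T.finite_measure_subadditive_finite) auto
    also have "\<dots> \<le> (\<Sum>p\<in>?J. 2 * exp (- (real n * s\<^sup>2 / 2)))" by (intro sum_mono B_tail)
    also have "\<dots> = 2 * (real m)\<^sup>2 * exp (- (real n * s\<^sup>2 / 2))" by (simp add: power2_eq_square)
    also have "\<dots> \<le> 2 * (real m)\<^sup>2 * exp (- ln (C / \<delta>))"
    proof -
      have "ln (C / \<delta>) = 2 / \<kappa>\<^sup>2 * ln (C / \<delta>) / \<epsilon>\<^sup>2 * (s\<^sup>2 / 2)"
        using \<kappa> \<epsilon> by (simp add: s_def power_mult_distrib)
      also have "\<dots> \<le> real n * (s\<^sup>2 / 2)"
        using large by (intro mult_right_mono) (auto simp: C_def)
      finally show ?thesis by (intro mult_left_mono) auto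
    qed
    also have "\<dots> = 2 * (real m)\<^sup>2 / C * \<delta>"
      using C \<delta> by (simp add: exp_minus)
    also have "\<dots> < 1 * \<delta>"
      using \<delta> C by (intro mult_strict_right_mono) (auto simp: C_def)
    finally have small: "measure ?T (\<Union>p\<in>?J. B p) < \<delta>" by simp
    have close: "\<bar>orthonormal_poly \<mu> i y - orthonormal_poly (empirical cube n x) i y\<bar> < \<epsilon>"
      if x: "x \<in> space ?T - (\<Union>p\<in>?J. B p)" and i: "i < m" and y: "y \<in> cube" for x i y
    proof -
      have x_cube: "x j \<in> cube" if "j < n" for j
        using x that by (auto simp: tuples_def space_PiM PiE_iff space)
      have "\<bar>L2_inner (empirical cube n x) (?f k) (?f l) - L2_inner \<mu> (?f k) (?f l)\<bar> \<le> s"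
        if kl: "k < m" "l < m" for k l
      proof -
        have "L2_inner (empirical cube n x) (?f k) (?f l) = (\<Sum>i<n. g (k, l) (x i)) / real n"
          unfolding L2_inner_def g_def fst_conv snd_conv
          by (intro integral_empirical x_cube borel_measurable_continuous_restrict continuous_intros
              continuous_monomial_fun)
        moreover have "x \<notin> B (k, l)" using x kl by auto
        ultimately show ?thesis using x by (auto simp: B_def L2_inner_def g_def)
      qed
      hence "D (empirical cube n x) \<le> (\<Sum>k<m. \<Sum>l<m. s)"
        unfolding D_def by (intro sum_mono) auto
      hence D: "D (empirical cube n x) \<le> (real m)\<^sup>2 * s" by (simp add: power2_eq_square mult.assoc)
      have "(real m)\<^sup>2 * s \<le> (real m)\<^sup>2 * (\<rho> / (E * (real m)\<^sup>2) * E)"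
        unfolding s_def using \<epsilon> \<kappa> E \<rho> by (intro mult_left_mono mult_mono) (auto simp: \<kappa>_def)
      also have "\<dots> = \<rho>" using m0 E by simp
      finally have D_le: "D (empirical cube n x) \<le> \<rho>" using D by linarith
      have emp: "prob_space (empirical cube n x)" by (rule prob_space_empirical[OF n]) (rule x_cube)
      have "\<bar>orthonormal_poly \<mu> i y - orthonormal_poly (empirical cube n x) i y\<bar> \<le> L * D (empirical cube n x)"
        by (rule pert[OF emp sets_empirical D_le i y])
      also have "\<dots> \<le> L * ((real m)\<^sup>2 * s)" using D L by (intro mult_left_mono) auto
      also have "\<dots> \<le> L * ((real m)\<^sup>2 * (1 / (2 * L * (real m)\<^sup>2) * \<epsilon>))"
        unfolding s_def using L \<epsilon> by (intro mult_left_mono mult_right_mono) (auto simp: \<kappa>_def)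
      also have "\<dots> = \<epsilon> / 2" using L m0 by simp
      also have "\<dots> < \<epsilon>" using \<epsilon> by simp
      finally show ?thesis .
    qed
    show "\<exists>B\<in>sets ?T. measure ?T B < \<delta> \<and> (\<forall>x\<in>space ?T - B. \<forall>i<m. \<forall>y\<in>cube.
            \<bar>orthonormal_poly \<mu> i y - orthonormal_poly (empirical cube n x) i y\<bar> < \<epsilon>)"
      using B_sets small close by (intro bexI[of _ "\<Union>p\<in>?J. B p"]) auto
  qed
qed

section \<open>The polynomial kernel\<close>

lemma measurable_kernel_det:
  fixes P :: "nat \<Rightarrow> 'a \<Rightarrow> real"
  assumes [measurable]: "\<And>i. P i \<in> borel_measurable N"
  shows "kernel_det (\<lambda>x y. \<Sum>i<m. P i x * P i y) r \<in> borel_measurable (PiM {..<r} (\<lambda>_. N))"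
proof -
  have "(\<lambda>y. \<Sum>p\<in>{p. p permutes {..<r}}. signof p * (\<Prod>j<r. \<Sum>i<m. P i (y j) * P i (y (p j))))
        \<in> borel_measurable (PiM {..<r} (\<lambda>_. N))"
  proof (intro borel_measurable_sum borel_measurable_times borel_measurable_prod borel_measurable_const)
    fix p j i assume "p \<in> {p. p permutes {..<r}}" "j \<in> {..<r}"
    hence "j \<in> {..<r}" "p j \<in> {..<r}" using permutes_in_image[of p "{..<r}" j] by auto
    thus "(\<lambda>y. P i (y j)) \<in> borel_measurable (PiM {..<r} (\<lambda>_. N))"
      "(\<lambda>y. P i (y (p j))) \<in> borel_measurable (PiM {..<r} (\<lambda>_. N))"
      by measurable
  qed
  thus ?thesis by (simp add: kernel_det_expand[abs_def])
qed

lemma orthonormal_poly_abs_le: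
  fixes \<mu> :: "(real ^ 'd::{finite,linorder}) measure"
  assumes "space \<mu> = cube" "i < m" "y \<in> cube"
  shows "\<bar>orthonormal_poly \<mu> i y\<bar> \<le> poly_bound \<mu> m / 2"
proof -
  let ?g = "\<lambda>x. \<bar>orthonormal_poly \<mu> i x\<bar>"
  have "continuous_on cube ?g"
    by (intro continuous_intros) (rule continuous_on_subset[OF continuous_orthonormal_poly], simp)
  hence "bdd_above (?g ` cube)"
    by (intro bounded_imp_bdd_above compact_imp_bounded compact_continuous_image compact_cube)
  hence "?g y \<le> (SUP x\<in>cube. ?g x)" using assms(3) by (intro cSUP_upper)
  also have "\<dots> \<le> (MAX i\<in>{..<m}. SUP x\<in>space \<mu>. \<bar>orthonormal_poly \<mu> i x\<bar>)"
    using assms(1,2) by (intro Max_ge) auto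
  finally show ?thesis by (simp add: poly_bound_def)
qed

text \<open>This makes the bounds \<open>M\<close> and \<open>\<K>\<^sub>\<infinity>\<close>, by which the tolerances are scaled, positive.\<close>

lemma ex_first_orthonormal_poly_nonzero:
  fixes \<mu> :: "(real ^ 'd::{finite,linorder}) measure"
  assumes \<mu>: "prob_space \<mu>" "sets \<mu> = sets (restrict_space borel cube)"
      "absolutely_continuous (restrict_space lborel cube) \<mu>"
  shows "\<exists>x\<in>cube. orthonormal_poly \<mu> 0 x \<noteq> 0"
proof -
  let ?f = "monomial_fun 0 :: real ^ 'd::{finite,linorder} \<Rightarrow> real"
  have space: "space \<mu> = cube"
    by (rule space_eq_cube[OF \<mu>(2)])
  have pos: "L2_inner \<mu> ?f ?f > 0"
    using L2_norm_polynomial_pos[where a = "\<lambda>_. 1" and i = 0 and m = 1, OF \<mu>] by simp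
  have "\<exists>x\<in>cube. ?f x \<noteq> 0"
  proof (rule ccontr)
    assume "\<not> (\<exists>x\<in>cube. ?f x \<noteq> 0)"
    hence "L2_inner \<mu> ?f ?f = (\<integral>x. 0 \<partial>\<mu>)"
      unfolding L2_inner_def by (intro Bochner_Integration.integral_cong) (auto simp: space)
    thus False using pos by simp
  qed
  thus ?thesis using pos
    by (subst orthonormal_poly_def, subst gram_schmidt_fun.simps) (auto simp: Let_def)
qed

lemma poly_kernel_abs_le:
  fixes \<mu> :: "(real ^ 'd::{finite,linorder}) measure"
  assumes "space \<mu> = cube" "x \<in> cube" "y \<in> cube"
  shows "\<bar>poly_kernel \<mu> m x y\<bar> \<le> real m * (poly_bound \<mu> m)\<^sup>2 / 4"
proof -
  have "\<bar>poly_kernel \<mu> m x y\<bar> \<le> (\<Sum>i<m. \<bar>orthonormal_poly \<mu> i x * orthonormal_poly \<mu> i y\<bar>)"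
    unfolding poly_kernel_def by (rule sum_abs)
  also have "\<dots> \<le> (\<Sum>i<m. poly_bound \<mu> m / 2 * (poly_bound \<mu> m / 2))"
    unfolding abs_mult
  proof (rule sum_mono)
    fix i assume "i \<in> {..<m}"
    hence "\<bar>orthonormal_poly \<mu> i x\<bar> \<le> poly_bound \<mu> m / 2" "\<bar>orthonormal_poly \<mu> i y\<bar> \<le> poly_bound \<mu> m / 2"
      using orthonormal_poly_abs_le[OF assms(1) _ assms(2)] orthonormal_poly_abs_le[OF assms(1) _ assms(3)]
      by auto
    thus "\<bar>orthonormal_poly \<mu> i x\<bar> * \<bar>orthonormal_poly \<mu> i y\<bar> \<le> poly_bound \<mu> m / 2 * (poly_bound \<mu> m / 2)"
      using order_trans[OF abs_ge_zero] by (intro mult_mono) auto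
  qed
  also have "\<dots> = real m * (poly_bound \<mu> m)\<^sup>2 / 4" by (simp add: power2_eq_square)
  finally show ?thesis .
qed

lemma poly_kernel_perturbation:
  fixes \<mu> \<gamma> :: "(real ^ 'd::{finite,linorder}) measure"
  assumes space: "space \<mu> = cube" and \<tau>: "\<tau> \<le> poly_bound \<mu> m"
    and close: "\<And>i y. i < m \<Longrightarrow> y \<in> cube \<Longrightarrow> \<bar>orthonormal_poly \<mu> i y - orthonormal_poly \<gamma> i y\<bar> \<le> \<tau>"
    and xy: "x \<in> cube" "y \<in> cube"
  shows "\<bar>poly_kernel \<gamma> m x y - poly_kernel \<mu> m x y\<bar> \<le> 2 * real m * poly_bound \<mu> m * \<tau>"
proof -
  let ?P = "orthonormal_poly \<mu>" and ?p = "orthonormal_poly \<gamma>" and ?M = "poly_bound \<mu> m"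
  have "\<bar>poly_kernel \<gamma> m x y - poly_kernel \<mu> m x y\<bar> \<le> (\<Sum>i<m. \<bar>?p i x * ?p i y - ?P i x * ?P i y\<bar>)"
    unfolding poly_kernel_def sum_subtractf[symmetric] by (rule sum_abs)
  also have "\<dots> \<le> (\<Sum>i<m. 2 * ?M * \<tau>)"
  proof (rule sum_mono)
    fix i assume "i \<in> {..<m}"
    hence i: "i < m" by simp
    have bx: "\<bar>?P i x\<bar> \<le> ?M / 2" "\<bar>?P i y\<bar> \<le> ?M / 2"
      using orthonormal_poly_abs_le[OF space i] xy by auto
    have cx: "\<bar>?p i x - ?P i x\<bar> \<le> \<tau>" "\<bar>?p i y - ?P i y\<bar> \<le> \<tau>"
      using close[OF i] xy by (auto simp: abs_minus_commute)
    have \<tau>0: "\<tau> \<ge> 0" using cx(1) by linarith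
    have p: "\<bar>?p i x\<bar> \<le> ?M / 2 + \<tau>" using bx(1) cx(1) by linarith
    have "?p i x * ?p i y - ?P i x * ?P i y = ?p i x * (?p i y - ?P i y) + (?p i x - ?P i x) * ?P i y"
      by (simp add: algebra_simps)
    also have "\<bar>\<dots>\<bar> \<le> \<bar>?p i x\<bar> * \<bar>?p i y - ?P i y\<bar> + \<bar>?p i x - ?P i x\<bar> * \<bar>?P i y\<bar>"
      unfolding abs_mult[symmetric] by (rule abs_triangle_ineq)
    also have "\<dots> \<le> (?M / 2 + \<tau>) * \<tau> + \<tau> * (?M / 2)"
      using p cx bx \<tau>0 \<tau> by (intro add_mono mult_mono) auto
    also have "\<dots> = (?M + \<tau>) * \<tau>" by (simp add: algebra_simps)
    also have "\<dots> \<le> (?M + ?M) * \<tau>" using \<tau> \<tau>0 by (intro mult_right_mono) auto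
    finally show "\<bar>?p i x * ?p i y - ?P i x * ?P i y\<bar> \<le> 2 * ?M * \<tau>" by simp
  qed
  also have "\<dots> = 2 * real m * ?M * \<tau>" by simp
  finally show ?thesis .
qed


lemma kernel_sup_poly_kernel:
  fixes \<mu> :: "(real ^ 'd::{finite,linorder}) measure"
  assumes \<mu>: "prob_space \<mu>" "sets \<mu> = sets (restrict_space borel cube)"
      "absolutely_continuous (restrict_space lborel cube) \<mu>"
    and m: "m \<ge> 1"
  shows "\<And>x y. x \<in> cube \<Longrightarrow> y \<in> cube \<Longrightarrow> \<bar>poly_kernel \<mu> m x y\<bar> \<le> kernel_sup cube (poly_kernel \<mu> m)"
    and "kernel_sup cube (poly_kernel \<mu> m) \<le> real m * (poly_bound \<mu> m)\<^sup>2 / 4"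
    and "kernel_sup cube (poly_kernel \<mu> m) > 0"
proof -
  have space: "space \<mu> = cube"
    by (rule space_eq_cube[OF \<mu>(2)])
  have pair_le: "(case p of (x, y) \<Rightarrow> \<bar>poly_kernel \<mu> m x y\<bar>) \<le> real m * (poly_bound \<mu> m)\<^sup>2 / 4"
    if "p \<in> cube \<times> cube" for p
    using poly_kernel_abs_le[OF space, of "fst p" "snd p" m] that by (cases p) simp
  have bdd: "bdd_above ((\<lambda>(x, y). \<bar>poly_kernel \<mu> m x y\<bar>) ` (cube \<times> cube))"
    by (rule bdd_aboveI2) (rule pair_le)
  show le: "\<bar>poly_kernel \<mu> m x y\<bar> \<le> kernel_sup cube (poly_kernel \<mu> m)" if "x \<in> cube" "y \<in> cube" for x y
    unfolding kernel_sup_def using cSUP_upper[OF _ bdd, of "(x, y)"] that by simp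
  show "kernel_sup cube (poly_kernel \<mu> m) \<le> real m * (poly_bound \<mu> m)\<^sup>2 / 4"
    unfolding kernel_sup_def
    by (rule cSUP_least) (use cube_nonempty in blast, rule pair_le)
  obtain x where x: "x \<in> cube" "orthonormal_poly \<mu> 0 x \<noteq> 0"
    using ex_first_orthonormal_poly_nonzero[OF \<mu>] by blast
  have "0 < orthonormal_poly \<mu> 0 x * orthonormal_poly \<mu> 0 x"
    using x(2) not_real_square_gt_zero[of "orthonormal_poly \<mu> 0 x"] by blast
  also have "\<dots> \<le> poly_kernel \<mu> m x x"
    unfolding poly_kernel_def using m
    by (intro member_le_sum[of 0 "{..<m}" "\<lambda>i. orthonormal_poly \<mu> i x * orthonormal_poly \<mu> i x"]) auto
  also have "\<dots> \<le> kernel_sup cube (poly_kernel \<mu> m)" using le[OF x(1,1)] by linarith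
  finally show "kernel_sup cube (poly_kernel \<mu> m) > 0" .
qed

lemma poly_bound_pos:
  fixes \<mu> :: "(real ^ 'd::{finite,linorder}) measure"
  assumes \<mu>: "prob_space \<mu>" "sets \<mu> = sets (restrict_space borel cube)"
      "absolutely_continuous (restrict_space lborel cube) \<mu>"
    and m: "m \<ge> 1"
  shows "poly_bound \<mu> m > 0"
proof -
  have space: "space \<mu> = cube"
    by (rule space_eq_cube[OF \<mu>(2)])
  obtain x where x: "x \<in> cube" "orthonormal_poly \<mu> 0 x \<noteq> 0"
    using ex_first_orthonormal_poly_nonzero[OF \<mu>] by blast
  thus ?thesis using orthonormal_poly_abs_le[OF space, of 0 m x] m by auto
qed

section \<open>Weak coherency\<close>

lemma space_tuples: "space (tuples r M) = {..<r} \<rightarrow>\<^sub>E space M"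
  by (simp add: tuples_def space_PiM)

lemma sets_tuples_cong: "sets M = sets N \<Longrightarrow> sets (tuples r M) = sets (tuples r N)"
  unfolding tuples_def by (intro sets_PiM_cong) auto

lemma bounded_measurable_cong:
  assumes "sets M = sets N"
  shows "bounded_measurable r M \<phi> \<longleftrightarrow> bounded_measurable r N \<phi>"
  using sets_tuples_cong[OF assms] sets_eq_imp_space_eq[OF sets_tuples_cong[OF assms]]
  by (simp add: bounded_measurable_def measurable_cong_sets[OF sets_tuples_cong[OF assms] refl])

text \<open>The first factor of \<open>\<beta>\<close> is a supremum of determinants without absolute values; it bounds their
absolute values because they are nonnegative.\<close>

lemma rate_beta_bound:
  fixes \<mu> :: "(real ^ 'd::{finite,linorder}) measure"
  assumes space: "space \<mu> = cube"
    and \<phi>: "bounded_measurable r \<mu> \<phi>" and y: "y \<in> space (tuples r \<mu>)"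
  shows "\<bar>\<phi> y * kernel_det (poly_kernel \<mu> m) r y\<bar> \<le> rate_beta cube (poly_kernel \<mu> m) r \<phi>"
    and "\<bar>\<phi> y\<bar> \<le> (SUP y\<in>{..<r} \<rightarrow>\<^sub>E cube. \<bar>\<phi> y\<bar>)"
proof -
  let ?K = "poly_kernel \<mu> m" and ?Y = "{..<r} \<rightarrow>\<^sub>E (cube :: (real ^ 'd::{finite,linorder}) set)"
  let ?b = "real m * (poly_bound \<mu> m)\<^sup>2 / 4"
  have sp: "space (tuples r \<mu>) = ?Y" by (simp add: space_tuples space)
  have y': "y \<in> ?Y" using y by (simp add: sp)
  have "bdd_above (kernel_det ?K r ` ?Y)"
  proof (rule bdd_aboveI2)
    fix y assume "y \<in> ?Y"
    hence "\<bar>kernel_det ?K r y\<bar> \<le> fact r * ?b ^ r"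
      by (intro kernel_det_abs_le poly_kernel_abs_le[OF space]) (auto simp: PiE_iff)
    thus "kernel_det ?K r y \<le> fact r * ?b ^ r" by linarith
  qed
  hence det: "kernel_det ?K r y \<le> (SUP y\<in>?Y. kernel_det ?K r y)" using y' by (intro cSUP_upper)
  have det0: "kernel_det ?K r y \<ge> 0"
    unfolding poly_kernel_def[abs_def] by (rule kernel_det_nonneg)
  have "bounded (\<phi> ` ?Y)" using \<phi> by (simp add: bounded_measurable_def sp)
  then obtain b where "\<And>y. y \<in> ?Y \<Longrightarrow> \<bar>\<phi> y\<bar> \<le> b" by (auto simp: bounded_iff)
  hence "bdd_above ((\<lambda>y. \<bar>\<phi> y\<bar>) ` ?Y)" by (rule bdd_aboveI2)
  thus \<phi>_le: "\<bar>\<phi> y\<bar> \<le> (SUP y\<in>?Y. \<bar>\<phi> y\<bar>)" using y' by (intro cSUP_upper)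
  show "\<bar>\<phi> y * kernel_det ?K r y\<bar> \<le> rate_beta cube ?K r \<phi>"
    unfolding rate_beta_def abs_mult
    by (subst mult.commute) (rule mult_mono, use det det0 \<phi>_le in auto)
qed

text \<open>As \<open>\<eta> \<le> b\<close>, both kernels are bounded by \<open>2 b\<close>.\<close>

lemma V_statistic_kernel_diff_le:
  assumes n: "n \<ge> 1" and x: "\<And>i. i < n \<Longrightarrow> x i \<in> X" and \<eta>: "0 \<le> \<eta>" "\<eta> \<le> b"
    and K: "\<And>s t. s \<in> X \<Longrightarrow> t \<in> X \<Longrightarrow> \<bar>K s t\<bar> \<le> b"
    and diff: "\<And>s t. s \<in> X \<Longrightarrow> t \<in> X \<Longrightarrow> \<bar>K' s t - K s t\<bar> \<le> \<eta>"
  shows "\<bar>V_statistic r n (\<lambda>y. \<phi> y * kernel_det K' r y) x - V_statistic r n (\<lambda>y. \<phi> y * kernel_det K r y) x\<bar>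
           \<le> real r * fact r * (2 * b) ^ (r - 1) * \<eta> * empirical_L1_norm n x r \<phi>"
proof -
  let ?I = "{..<r} \<rightarrow>\<^sub>E {..<n}" and ?p = "\<lambda>i. \<lambda>k\<in>{..<r}. x (i k)"
  define c where "c = real r * fact r * (2 * b) ^ (r - 1) * \<eta>"
  define d where "d i = \<phi> (?p i) * (kernel_det K' r (?p i) - kernel_det K r (?p i))" for i
  have eq: "V_statistic r n (\<lambda>y. \<phi> y * kernel_det K' r y) x - V_statistic r n (\<lambda>y. \<phi> y * kernel_det K r y) x
        = (\<Sum>i\<in>?I. d i) / real n ^ r"
    unfolding V_statistic_def d_def by (simp add: sum_subtractf right_diff_distrib diff_divide_distrib)
  have d: "\<bar>d i\<bar> \<le> \<bar>\<phi> (?p i)\<bar> * c" if i: "i \<in> ?I" for i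
  proof -
    have X: "?p i k \<in> X" if "k < r" for k using i that x by (auto simp: PiE_iff)
    have "\<bar>kernel_det K' r (?p i) - kernel_det K r (?p i)\<bar> \<le> c"
      unfolding c_def
    proof (rule kernel_det_diff_le)
      fix j k assume jk: "j < r" "k < r"
      show "\<bar>K' (?p i j) (?p i k) - K (?p i j) (?p i k)\<bar> \<le> \<eta>" using diff[OF X X, OF jk] .
      thus "\<bar>K' (?p i j) (?p i k)\<bar> \<le> 2 * b" "\<bar>K (?p i j) (?p i k)\<bar> \<le> 2 * b"
        using K[OF X X, OF jk] \<eta> by linarith+
    qed
    thus ?thesis unfolding d_def abs_mult by (intro mult_left_mono) auto
  qed
  have "\<bar>\<Sum>i\<in>?I. d i\<bar> \<le> (\<Sum>i\<in>?I. \<bar>\<phi> (?p i)\<bar>) * c"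
    unfolding sum_distrib_right by (rule order_trans[OF sum_abs]) (rule sum_mono, rule d)
  hence "\<bar>\<Sum>i\<in>?I. d i\<bar> / real n ^ r \<le> (\<Sum>i\<in>?I. \<bar>\<phi> (?p i)\<bar>) * c / real n ^ r"
    by (rule divide_right_mono) simp
  thus ?thesis unfolding eq empirical_L1_norm_def c_def[symmetric] by (simp add: abs_divide mult.commute)
qed

lemma weakly_coherent_of_bounded_rate:
  assumes rate: "weak_coherency_rate \<mu> Qn Q N"
    and bound: "\<And>r \<phi> \<delta> \<epsilon>. r \<ge> 1 \<Longrightarrow> test_function r \<mu> \<phi> \<Longrightarrow> 0 < \<delta> \<Longrightarrow> \<delta> < 1 \<Longrightarrow> \<epsilon> > 0 \<Longrightarrow>
      \<exists>N0. \<forall>n\<ge>1. \<forall>x\<in>space (tuples n \<mu>). N n x \<delta> \<epsilon> r \<phi> \<le> N0"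
  shows "weakly_coherent \<mu> Qn Q"
  unfolding weakly_coherent_def
proof (intro allI impI ballI)
  fix r \<phi> and \<delta> \<epsilon> :: real
  assume r: "r \<ge> 1" and \<phi>: "test_function r \<mu> \<phi>" and \<delta>: "\<delta> \<in> {0<..<1}" and \<epsilon>: "\<epsilon> > 0"
  obtain N0 where N0: "\<forall>n\<ge>1. \<forall>x\<in>space (tuples n \<mu>). N n x \<delta> \<epsilon> r \<phi> \<le> N0"
    using bound[OF r \<phi> _ _ \<epsilon>, of \<delta>] \<delta> by auto
  show "\<exists>N. \<forall>n\<ge>1. N \<le> real n \<longrightarrow> deviation_prob \<mu> Qn Q r \<phi> \<epsilon> n \<le> \<delta>"
  proof (intro exI[of _ N0] allI impI)
    fix n :: nat assume n: "n \<ge> 1" "N0 \<le> real n"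
    have "AE x in tuples n \<mu>. real n \<ge> N n x \<delta> \<epsilon> r \<phi>"
    proof (rule AE_I2)
      fix x assume "x \<in> space (tuples n \<mu>)"
      with N0 n(1) have "N n x \<delta> \<epsilon> r \<phi> \<le> N0" by simp
      with n(2) show "N n x \<delta> \<epsilon> r \<phi> \<le> real n" by linarith
    qed
    thus "deviation_prob \<mu> Qn Q r \<phi> \<epsilon> n \<le> \<delta>"
      using rate[unfolded weak_coherency_rate_def, rule_format, OF r \<phi> \<delta> \<epsilon> n(1)] by simp
  qed
qed

lemma expected_statistic_empirical_DPP:
  fixes x :: "nat \<Rightarrow> real ^ 'd::{finite,linorder}"
  assumes Q: "is_DPP Q (poly_kernel (empirical cube n x) m) (empirical cube n x)"
    and n: "n \<ge> 1" and x: "\<And>i. i < n \<Longrightarrow> x i \<in> cube" and r: "r \<ge> 1"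
    and \<mu>: "sets \<mu> = sets (restrict_space borel cube)" and \<phi>: "bounded_measurable r \<mu> \<phi>"
  shows "expected_statistic r \<phi> Q =
           V_statistic r n (\<lambda>y. \<phi> y * kernel_det (poly_kernel (empirical cube n x) m) r y) x"
proof -
  let ?E = "empirical cube n x" and ?R = "restrict_space borel (cube :: (real ^ 'd::{finite,linorder}) set)"
  have "sets \<mu> = sets ?E" by (simp add: \<mu> sets_empirical)
  hence "bounded_measurable r ?E \<phi>" using \<phi> by (subst (asm) bounded_measurable_cong)
  hence "expected_statistic r \<phi> Q = (\<integral>y. \<phi> y * kernel_det (poly_kernel ?E m) r y \<partial>tuples r ?E)"
    using Q r by (simp add: is_DPP_def)
  also have "\<dots> = V_statistic r n (\<lambda>y. \<phi> y * kernel_det (poly_kernel ?E m) r y) x"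
  proof (rule integral_tuples_empirical[OF n x])
    have "bounded_measurable r ?R \<phi>" using \<phi> \<mu> by (subst (asm) bounded_measurable_cong)
    moreover have "kernel_det (poly_kernel ?E m) r \<in> borel_measurable (PiM {..<r} (\<lambda>_. ?R))"
      unfolding poly_kernel_def[abs_def]
      by (intro measurable_kernel_det borel_measurable_continuous_restrict continuous_orthonormal_poly)
    ultimately show "(\<lambda>y. \<phi> y * kernel_det (poly_kernel ?E m) r y) \<in> borel_measurable (PiM {..<r} (\<lambda>_. ?R))"
      by (intro borel_measurable_times) (auto simp: bounded_measurable_def tuples_def)
  qed
  finally show ?thesis .
qed

lemma associated_rate_le_iff:
  "associated_rate \<mu> K NK n x \<delta> \<epsilon> r \<phi> \<le> t \<longleftrightarrow>
     NK (\<delta> / 4) (kernel_sup (space \<mu>) K) \<le> t \<and>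
     NK (\<delta> / 4) (\<epsilon> / rate_c (space \<mu>) K n x r \<phi>) \<le> t \<and>
     2 ^ (r + 5) * (rate_beta (space \<mu>) K r \<phi>)\<^sup>2 * ln (4 / \<delta>) / \<epsilon>\<^sup>2 \<le> t \<and>
     rate_C \<mu> K r \<phi> / \<epsilon> \<le> t"
  unfolding associated_rate_def by (subst Max_le_iff) auto

text \<open>For this kernel rate, the requirements on \<open>n\<close> are \<open>D / \<K>\<^sub>\<infinity>\<^sup>2 \<le> n\<close> and \<open>D / (\<epsilon> / c)\<^sup>2 \<le> n\<close> almost surely.
In terms of \<open>\<eta> = sqrt (D / n)\<close> they say \<open>\<eta> \<le> \<K>\<^sub>\<infinity>\<close> and \<open>c \<eta> \<le> \<epsilon>\<close> almost surely, and \<open>n\<close> equals the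
kernel rate at \<open>\<eta>\<close>. So outside \<open>B1\<close>, of probability less than \<open>\<delta> / 4\<close>, the kernels are \<open>\<eta>\<close>-close,
and replacing one by the other costs at most \<open>c \<eta> / 2 \<le> \<epsilon> / 2\<close>. The V-statistic costs less than \<open>\<epsilon> / 2\<close>
outside \<open>B2\<close>, of probability at most \<open>\<delta> / 2\<close>.\<close>

lemma poly_kernel_weak_coherency_rate:
  fixes \<mu> :: "(real ^ 'd::{finite,linorder}) measure"
  assumes \<mu>: "prob_space \<mu>" "sets \<mu> = sets (restrict_space borel cube)"
      "absolutely_continuous (restrict_space lborel cube) \<mu>"
    and m: "m \<ge> 1" and \<kappa>: "\<kappa> > 0" and C: "C \<ge> 1" and AB: "A\<^sup>2 * B\<^sup>2 = 8 / \<kappa>\<^sup>2"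
    and conc: "\<And>\<delta> \<epsilon> n. 0 < \<delta> \<Longrightarrow> \<delta> < 1 \<Longrightarrow> 0 < \<epsilon> \<Longrightarrow> \<epsilon> \<le> poly_bound \<mu> m \<Longrightarrow> n \<ge> 1 \<Longrightarrow>
       2 / \<kappa>\<^sup>2 * ln (C / \<delta>) / \<epsilon>\<^sup>2 \<le> real n \<Longrightarrow>
       \<exists>B\<in>sets (tuples n \<mu>). measure (tuples n \<mu>) B < \<delta> \<and>
         (\<forall>x\<in>space (tuples n \<mu>) - B. \<forall>i<m. \<forall>y\<in>cube.
            \<bar>orthonormal_poly \<mu> i y - orthonormal_poly (empirical cube n x) i y\<bar> < \<epsilon>)"
    and Q: "is_DPP Q (poly_kernel \<mu> m) \<mu>"
    and Qn: "\<And>n x. n \<ge> 1 \<Longrightarrow> x \<in> space (tuples n \<mu>) \<Longrightarrow>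
               is_DPP (Qn n x) (poly_kernel (empirical cube n x) m) (empirical cube n x)"
  shows "weak_coherency_rate \<mu> Qn Q (associated_rate \<mu> (poly_kernel \<mu> m) (poly_kernel_rate \<mu> m A B C))"
  unfolding weak_coherency_rate_def
proof (intro allI impI ballI)
  fix r :: nat and \<phi> and \<delta> \<epsilon> :: real and n :: nat
  assume r: "1 \<le> r" and test: "test_function r \<mu> \<phi>" and \<delta>': "\<delta> \<in> {0<..<1}" and \<epsilon>: "0 < \<epsilon>" and n: "1 \<le> n"
    and AE_rate: "AE x in tuples n \<mu>. associated_rate \<mu> (poly_kernel \<mu> m) (poly_kernel_rate \<mu> m A B C) n x \<delta> \<epsilon> r \<phi> \<le> real n"
  have \<delta>: "0 < \<delta>" "\<delta> < 1" using \<delta>' by auto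
  let ?T = "tuples n \<mu>" and ?K = "poly_kernel \<mu> m"
  interpret T: prob_space ?T unfolding tuples_def by (rule prob_space_PiM) (rule \<mu>)
  have space: "space \<mu> = cube"
    by (rule space_eq_cube[OF \<mu>(2)])
  have \<phi>: "bounded_measurable r \<mu> \<phi>" using test by (simp add: test_function_def)
  define M where "M = poly_bound \<mu> m"
  define Ks where "Ks = kernel_sup cube ?K"
  define \<beta> where "\<beta> = rate_beta cube ?K r \<phi>"
  define c where "c x = rate_c cube ?K n x r \<phi>" for x
  define D where "D = A\<^sup>2 * B\<^sup>2 * (real m)\<^sup>2 * M\<^sup>2 * ln (C / (\<delta> / 4))"
  have m0: "real m > 0" and n0: "real n > 0" using m n by auto
  have M: "M > 0" unfolding M_def by (rule poly_bound_pos[OF \<mu> m])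
  have Ks: "Ks > 0" "Ks \<le> real m * M\<^sup>2 / 4" "\<And>x y. x \<in> cube \<Longrightarrow> y \<in> cube \<Longrightarrow> \<bar>?K x y\<bar> \<le> Ks"
    unfolding Ks_def M_def using kernel_sup_poly_kernel[OF \<mu> m] by auto
  have ln_pos: "ln (C / (\<delta> / 4)) > 0" using C \<delta> by (intro ln_gt_zero) (simp add: field_simps)
  have D: "D > 0" unfolding D_def AB using \<kappa> m0 M ln_pos by (intro mult_pos_pos) auto
  have NK: "poly_kernel_rate \<mu> m A B C (\<delta> / 4) e = D / e\<^sup>2" for e
    by (simp add: poly_kernel_rate_def D_def M_def)
  have "AE x in ?T. D / Ks\<^sup>2 \<le> real n \<and> 2 ^ (r + 5) * \<beta>\<^sup>2 * ln (4 / \<delta>) / \<epsilon>\<^sup>2 \<le> real n \<and> D / (\<epsilon> / c x)\<^sup>2 \<le> real n"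
    using AE_rate unfolding associated_rate_le_iff NK space
    by eventually_elim (simp add: Ks_def \<beta>_def c_def)
  hence "(AE x in ?T. D / Ks\<^sup>2 \<le> real n) \<and> (AE x in ?T. 2 ^ (r + 5) * \<beta>\<^sup>2 * ln (4 / \<delta>) / \<epsilon>\<^sup>2 \<le> real n) \<and>
      (AE x in ?T. D / (\<epsilon> / c x)\<^sup>2 \<le> real n)"
    by (simp only: AE_conj_iff)
  hence large_K: "D / Ks\<^sup>2 \<le> real n" and large_\<beta>: "2 ^ (r + 5) * \<beta>\<^sup>2 * ln (4 / \<delta>) / \<epsilon>\<^sup>2 \<le> real n"
    and large_c: "AE x in ?T. D / (\<epsilon> / c x)\<^sup>2 \<le> real n"
    by (simp_all only: T.AE_const)
  define \<eta> where "\<eta> = sqrt (D / real n)"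
  have \<eta>: "\<eta> > 0" and \<eta>_sq: "\<eta>\<^sup>2 = D / real n" using D n0 by (auto simp: \<eta>_def)
  have \<eta>_le: "\<eta> \<le> Ks"
  proof (rule power2_le_imp_le)
    show "\<eta>\<^sup>2 \<le> Ks\<^sup>2" unfolding \<eta>_sq using large_K Ks(1) n0 by (simp add: field_simps)
  qed (use Ks in simp)
  \<comment> \<open>the tolerance for the polynomials that makes the kernels \<open>\<eta>\<close>-close\<close>
  define \<tau> where "\<tau> = \<eta> / (2 * real m * M)"
  have \<tau>: "\<tau> > 0" using \<eta> m0 M by (simp add: \<tau>_def)
  have \<tau>_le: "\<tau> \<le> M"
  proof -
    have "\<eta> \<le> real m * M\<^sup>2 / 4" using \<eta>_le Ks(2) by linarith
    also have "\<dots> \<le> M * (2 * real m * M)" using m0 M by (simp add: power2_eq_square field_simps)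
    finally show ?thesis using m0 M by (simp add: \<tau>_def pos_divide_le_eq)
  qed
  have "2 / \<kappa>\<^sup>2 * ln (C / (\<delta> / 4)) / \<tau>\<^sup>2 = (A\<^sup>2 * B\<^sup>2) * (real m)\<^sup>2 * M\<^sup>2 * ln (C / (\<delta> / 4)) / \<eta>\<^sup>2"
    unfolding AB \<tau>_def using m0 M \<eta> by (simp add: power_divide power_mult_distrib)
  also have "\<dots> = D / \<eta>\<^sup>2" by (simp add: D_def)
  also have "\<dots> = real n" unfolding \<eta>_sq using D n0 by simp
  finally have "2 / \<kappa>\<^sup>2 * ln (C / (\<delta> / 4)) / \<tau>\<^sup>2 \<le> real n" by simp
  from conc[OF _ _ \<tau> \<tau>_le[unfolded M_def] n this] \<delta> obtain B1 where B1: "B1 \<in> sets ?T" "measure ?T B1 < \<delta> / 4"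
    and close: "\<And>x i y. x \<in> space ?T - B1 \<Longrightarrow> i < m \<Longrightarrow> y \<in> cube \<Longrightarrow>
            \<bar>orthonormal_poly \<mu> i y - orthonormal_poly (empirical cube n x) i y\<bar> < \<tau>"
    by auto

  define h where "h y = \<phi> y * kernel_det ?K r y" for y
  let ?\<theta> = "\<integral>y. h y \<partial>tuples r \<mu>"
  have det_meas: "kernel_det ?K r \<in> borel_measurable (tuples r \<mu>)"
    unfolding poly_kernel_def[abs_def] tuples_def
  proof (rule measurable_kernel_det)
    show "orthonormal_poly \<mu> i \<in> borel_measurable \<mu>" for i
      using borel_measurable_continuous_restrict[OF continuous_orthonormal_poly, of \<mu> i cube]
      by (subst measurable_cong_sets[OF \<mu>(2) refl])
  qed
  have h_meas: "h \<in> borel_measurable (tuples r \<mu>)"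
    unfolding h_def[abs_def] using \<phi> det_meas
    by (intro borel_measurable_times) (auto simp: bounded_measurable_def)
  have h_bdd: "\<bar>h y\<bar> \<le> \<beta>" if "y \<in> space (tuples r \<mu>)" for y
    unfolding h_def \<beta>_def by (rule rate_beta_bound[OF space \<phi> that])
  have h_diag: "h y = 0" if "a < r" "b < r" "a \<noteq> b" "y a = y b" for y a b
    using kernel_det_eq_0[OF that] by (simp add: h_def)
  define B2 where "B2 = {x \<in> space ?T. \<bar>V_statistic r n h x - ?\<theta>\<bar> \<ge> \<epsilon> / 2}"
  have B2: "measure ?T B2 \<le> \<delta> / 2"
    unfolding B2_def by (rule V_statistic_tail[OF \<mu>(1) n r h_meas h_bdd h_diag \<delta> \<epsilon> large_\<beta>])
  have V_meas: "V_statistic r n h \<in> borel_measurable ?T"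
    by (rule measurable_V_statistic[OF \<mu>(1) n r h_meas h_bdd h_diag])
  have B2_sets: "B2 \<in> sets ?T" unfolding B2_def using V_meas by measurable

  obtain N where N: "{x \<in> space ?T. \<not> D / (\<epsilon> / c x)\<^sup>2 \<le> real n} \<subseteq> N" "N \<in> sets ?T" "emeasure ?T N = 0"
    using large_c by (rule AE_E)
  have "\<bar>expected_statistic r \<phi> (Qn n x) - expected_statistic r \<phi> Q\<bar> < \<epsilon>"
    if x: "x \<in> space ?T" "x \<notin> B1" "x \<notin> B2" "x \<notin> N" for x
  proof -
    let ?E = "empirical cube n x"
    let ?Kn = "poly_kernel ?E m"
    have x_cube: "x i \<in> cube" if "i < n" for i
      using x(1) that by (auto simp: space_tuples PiE_iff space)
    have L1: "empirical_L1_norm n x r \<phi> \<ge> 0"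
      by (auto simp: empirical_L1_norm_def intro!: divide_nonneg_nonneg sum_nonneg)
    have c0: "c x \<ge> 0" using L1 Ks(1) by (simp add: c_def rate_c_def Ks_def)
    have c_\<eta>: "c x * \<eta> \<le> \<epsilon>"
    proof (cases "c x = 0")
      case False
      have "D / (\<epsilon> / c x)\<^sup>2 \<le> real n" using N(1) x(1,4) by blast
      hence "D * (c x)\<^sup>2 \<le> real n * \<epsilon>\<^sup>2" using \<epsilon> False by (simp add: power_divide pos_divide_le_eq)
      hence "(c x)\<^sup>2 * (D / real n) \<le> \<epsilon>\<^sup>2" using n0 by (simp add: field_simps)
      hence "(c x * \<eta>)\<^sup>2 \<le> \<epsilon>\<^sup>2" by (simp add: power_mult_distrib \<eta>_sq)
      thus ?thesis using \<epsilon> by (intro power2_le_imp_le[of "c x * \<eta>" \<epsilon>]) auto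
    qed (use \<epsilon> in simp)
    have kernel: "\<bar>?Kn s t - ?K s t\<bar> \<le> \<eta>" if "s \<in> cube" "t \<in> cube" for s t
    proof -
      have "\<bar>?Kn s t - ?K s t\<bar> \<le> 2 * real m * poly_bound \<mu> m * \<tau>"
        using close[of x] x(1,2) that \<tau>_le
        by (intro poly_kernel_perturbation[OF space]) (auto simp: M_def intro: less_imp_le)
      also have "\<dots> = \<eta>" using m0 M by (simp add: \<tau>_def M_def[symmetric])
      finally show ?thesis .
    qed
    have "\<bar>V_statistic r n (\<lambda>y. \<phi> y * kernel_det ?Kn r y) x - V_statistic r n h x\<bar>
          \<le> real r * fact r * (2 * Ks) ^ (r - 1) * \<eta> * empirical_L1_norm n x r \<phi>"
      unfolding h_def[abs_def]
      by (rule V_statistic_kernel_diff_le[OF n x_cube less_imp_le[OF \<eta>] \<eta>_le Ks(3) kernel])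
    also have "\<dots> = c x * \<eta> / 2"
      using r by (cases r) (simp_all add: c_def rate_c_def Ks_def power_mult_distrib)
    also have "\<dots> \<le> \<epsilon> / 2" using c_\<eta> by simp
    finally have 1: "\<bar>V_statistic r n (\<lambda>y. \<phi> y * kernel_det ?Kn r y) x - V_statistic r n h x\<bar> \<le> \<epsilon> / 2" .
    have 2: "\<bar>V_statistic r n h x - ?\<theta>\<bar> < \<epsilon> / 2" using x(1,3) by (auto simp: B2_def)
    have 3: "expected_statistic r \<phi> (Qn n x) = V_statistic r n (\<lambda>y. \<phi> y * kernel_det ?Kn r y) x"
      by (rule expected_statistic_empirical_DPP[OF Qn[OF n x(1)] n x_cube r \<mu>(2) \<phi>])
    have 4: "expected_statistic r \<phi> Q = ?\<theta>"
      using Q r \<phi> by (simp add: is_DPP_def h_def)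
    show ?thesis unfolding 3 4 using 1 2 by linarith
  qed
  hence sub: "{x \<in> space ?T. \<bar>expected_statistic r \<phi> (Qn n x) - expected_statistic r \<phi> Q\<bar> \<ge> \<epsilon>} \<subseteq> B1 \<union> B2 \<union> N"
    by (auto simp: not_less[symmetric])
  have "deviation_prob \<mu> Qn Q r \<phi> \<epsilon> n \<le> measure ?T (B1 \<union> B2 \<union> N)"
    unfolding deviation_prob_def using sub B1(1) B2_sets N(2) by (intro T.finite_measure_mono) auto
  also have "\<dots> \<le> measure ?T (B1 \<union> B2) + measure ?T N"
    using B1(1) B2_sets N(2) by (intro measure_Un_le) auto
  also have "\<dots> \<le> measure ?T B1 + measure ?T B2 + measure ?T N"
    using B1(1) B2_sets by (intro add_right_mono measure_Un_le) auto
  also have "\<dots> \<le> \<delta> / 4 + \<delta> / 2 + 0"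
    using B1(2) B2 N(3) by (simp add: measure_def)
  also have "\<dots> \<le> \<delta>" using \<delta> by simp
  finally show "deviation_prob \<mu> Qn Q r \<phi> \<epsilon> n \<le> \<delta>" .
qed

text \<open>The rate depends on the sample only through the empirical \<open>L\<^sup>1\<close> norm of \<open>\<phi>\<close>, which the supremum
bounds.\<close>

lemma associated_poly_kernel_rate_bounded:
  fixes \<mu> :: "(real ^ 'd::{finite,linorder}) measure"
  assumes \<mu>: "prob_space \<mu>" "sets \<mu> = sets (restrict_space borel cube)"
      "absolutely_continuous (restrict_space lborel cube) \<mu>"
    and m: "m \<ge> 1" and C: "C \<ge> 1"
    and test: "test_function r \<mu> \<phi>" and \<delta>: "0 < \<delta>" "\<delta> < 1" and \<epsilon>: "\<epsilon> > 0"
  shows "\<exists>N0. \<forall>n\<ge>1. \<forall>x\<in>space (tuples n \<mu>).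
    associated_rate \<mu> (poly_kernel \<mu> m) (poly_kernel_rate \<mu> m A B C) n x \<delta> \<epsilon> r \<phi> \<le> N0"
proof -
  let ?K = "poly_kernel \<mu> m"
  have space: "space \<mu> = cube"
    by (rule space_eq_cube[OF \<mu>(2)])
  have \<phi>: "bounded_measurable r \<mu> \<phi>" using test by (simp add: test_function_def)
  define D where "D = A\<^sup>2 * B\<^sup>2 * (real m)\<^sup>2 * (poly_bound \<mu> m)\<^sup>2 * ln (C / (\<delta> / 4))"
  have "ln (C / (\<delta> / 4)) \<ge> 0" using C \<delta> by (intro ln_ge_zero) (simp add: field_simps)
  hence D: "D \<ge> 0" by (simp add: D_def)
  have NK: "poly_kernel_rate \<mu> m A B C (\<delta> / 4) e = D / e\<^sup>2" for e
    by (simp add: poly_kernel_rate_def D_def)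
  define s where "s = (SUP y\<in>{..<r} \<rightarrow>\<^sub>E cube. \<bar>\<phi> y\<bar>)"
  define c where "c = 2 ^ r * (real r * fact r) * s * kernel_sup cube ?K ^ (r - 1)"
  have Ks: "kernel_sup cube ?K > 0" by (rule kernel_sup_poly_kernel[OF \<mu> m])
  let ?N = "max (max (D / (kernel_sup cube ?K)\<^sup>2) (D * (c / \<epsilon>)\<^sup>2))
    (max (2 ^ (r + 5) * (rate_beta cube ?K r \<phi>)\<^sup>2 * ln (4 / \<delta>) / \<epsilon>\<^sup>2) (rate_C \<mu> ?K r \<phi> / \<epsilon>))"
  show ?thesis
  proof (intro exI[of _ ?N] allI impI ballI)
    fix n :: nat and x assume n: "n \<ge> 1" and x: "x \<in> space (tuples n \<mu>)"
    have "\<bar>\<phi> (\<lambda>k\<in>{..<r}. x (i k))\<bar> \<le> s" if "i \<in> {..<r} \<rightarrow>\<^sub>E {..<n}" for i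
      unfolding s_def
      by (rule rate_beta_bound(2)[OF space \<phi>]) (use that x in \<open>auto simp: space_tuples PiE_iff\<close>)
    hence "(\<Sum>i\<in>{..<r} \<rightarrow>\<^sub>E {..<n}. \<bar>\<phi> (\<lambda>k\<in>{..<r}. x (i k))\<bar>) \<le> (\<Sum>i\<in>{..<r} \<rightarrow>\<^sub>E {..<n}. s)"
      by (rule sum_mono)
    also have "\<dots> = s * real n ^ r" by (simp add: card_PiE)
    finally have L1: "empirical_L1_norm n x r \<phi> \<le> s"
      using n by (simp add: empirical_L1_norm_def pos_divide_le_eq)
    have L1_0: "empirical_L1_norm n x r \<phi> \<ge> 0"
      by (auto simp: empirical_L1_norm_def intro!: divide_nonneg_nonneg sum_nonneg)
    have "rate_c cube ?K n x r \<phi> \<le> c"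
      unfolding rate_c_def c_def using L1 Ks by (intro mult_right_mono mult_left_mono) auto
    moreover have "rate_c cube ?K n x r \<phi> \<ge> 0" using L1_0 Ks by (simp add: rate_c_def)
    ultimately have "(rate_c cube ?K n x r \<phi> / \<epsilon>)\<^sup>2 \<le> (c / \<epsilon>)\<^sup>2"
      using \<epsilon> by (intro power_mono divide_right_mono) auto
    hence "D * (rate_c cube ?K n x r \<phi> / \<epsilon>)\<^sup>2 \<le> D * (c / \<epsilon>)\<^sup>2" using D by (rule mult_left_mono)
    moreover have "D / (\<epsilon> / rate_c cube ?K n x r \<phi>)\<^sup>2 = D * (rate_c cube ?K n x r \<phi> / \<epsilon>)\<^sup>2"
      by (simp add: power_divide)
    ultimately show "associated_rate \<mu> ?K (poly_kernel_rate \<mu> m A B C) n x \<delta> \<epsilon> r \<phi> \<le> ?N"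
      unfolding associated_rate_le_iff NK space by (simp add: le_max_iff_disj)
  qed
qed

theorem theorem5p2:
  fixes \<mu> :: "(real ^ 'd::{finite,linorder}) measure" and m :: nat and E :: real
  assumes "prob_space \<mu>"
    and "sets \<mu> = sets (restrict_space borel cube)"
    and "absolutely_continuous (restrict_space lborel cube) \<mu>"
    and "m \<ge> 1"
    and "E > 0"
  shows "\<exists>A>0. \<exists>B>0. \<exists>C>0.
    (\<forall>\<delta>\<in>{0<..<1}. \<forall>\<epsilon>\<in>{0<..E}. \<forall>n\<ge>1.
       real n \<ge> A\<^sup>2 * B\<^sup>2 * ln (C / \<delta>) / \<epsilon>\<^sup>2 \<longrightarrow>
       \<P>(x in tuples n \<mu>.
          (MAX i\<in>{..<m}. MAX y\<in>x ` {..<n}.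
             \<bar>orthonormal_poly \<mu> i y - orthonormal_poly (empirical cube n x) i y\<bar>) \<ge> \<epsilon>) < \<delta>) \<and>
    (\<forall>Q Qn.
       is_DPP Q (poly_kernel \<mu> m) \<mu> \<longrightarrow>
       (\<forall>n\<ge>1. \<forall>x\<in>space (tuples n \<mu>).
          is_DPP (Qn n x) (poly_kernel (empirical cube n x) m) (empirical cube n x)) \<longrightarrow>
       weakly_coherent \<mu> Qn Q \<and>
       weak_coherency_rate \<mu> Qn Q
         (associated_rate \<mu> (poly_kernel \<mu> m) (poly_kernel_rate \<mu> m A B C)))"
proof -
  note \<mu> = assms(1-3) and m = assms(4) and E = assms(5)
  have space: "space \<mu> = cube"
    by (rule space_eq_cube[OF \<mu>(2)])
  define C where "C = 2 * (real m)\<^sup>2 + 1"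
  have C: "C \<ge> 1" by (simp add: C_def)
  \<comment> \<open>The kernel estimate uses tolerances up to \<open>poly_bound \<mu> m\<close>.\<close>
  have E': "max E (poly_bound \<mu> m) > 0" using E by simp
  obtain \<kappa> where \<kappa>: "\<kappa> > 0" and conc:
    "\<And>\<delta> \<epsilon> n. 0 < \<delta> \<Longrightarrow> \<delta> < 1 \<Longrightarrow> 0 < \<epsilon> \<Longrightarrow> \<epsilon> \<le> max E (poly_bound \<mu> m) \<Longrightarrow> n \<ge> 1 \<Longrightarrow>
       2 / \<kappa>\<^sup>2 * ln (C / \<delta>) / \<epsilon>\<^sup>2 \<le> real n \<Longrightarrow>
       \<exists>B\<in>sets (tuples n \<mu>). measure (tuples n \<mu>) B < \<delta> \<and>
         (\<forall>x\<in>space (tuples n \<mu>) - B. \<forall>i<m. \<forall>y\<in>cube.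
            \<bar>orthonormal_poly \<mu> i y - orthonormal_poly (empirical cube n x) i y\<bar> < \<epsilon>)"
    unfolding C_def using orthonormal_poly_concentration[OF \<mu> m E'] by blast
  \<comment> \<open>The factor \<open>2 / \<kappa>\<^sup>2\<close> would do for the polynomials; the kernel rate needs four times this, since
    polynomials that are \<open>\<tau>\<close>-close give kernels that are only \<open>2 m M \<tau>\<close>-close.\<close>
  define A where "A = sqrt 8 / \<kappa>"
  have A: "A > 0" and AB: "A\<^sup>2 * 1\<^sup>2 = 8 / \<kappa>\<^sup>2" using \<kappa> by (auto simp: A_def power_divide)
  have part1: "\<P>(x in tuples n \<mu>. (MAX i\<in>{..<m}. MAX y\<in>x ` {..<n}.
             \<bar>orthonormal_poly \<mu> i y - orthonormal_poly (empirical cube n x) i y\<bar>) \<ge> \<epsilon>) < \<delta>"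
    if \<delta>: "0 < \<delta>" "\<delta> < 1" and \<epsilon>: "0 < \<epsilon>" "\<epsilon> \<le> E" and n: "n \<ge> 1"
      and large: "A\<^sup>2 * 1\<^sup>2 * ln (C / \<delta>) / \<epsilon>\<^sup>2 \<le> real n" for \<delta> \<epsilon> n
  proof -
    interpret T: prob_space "tuples n \<mu>" unfolding tuples_def by (rule prob_space_PiM) (rule \<mu>)
    have "ln (C / \<delta>) \<ge> 0" using C \<delta> by (intro ln_ge_zero) (simp add: field_simps)
    hence "2 / \<kappa>\<^sup>2 * ln (C / \<delta>) / \<epsilon>\<^sup>2 \<le> A\<^sup>2 * 1\<^sup>2 * ln (C / \<delta>) / \<epsilon>\<^sup>2"
      unfolding AB by (intro divide_right_mono mult_right_mono) auto
    hence "2 / \<kappa>\<^sup>2 * ln (C / \<delta>) / \<epsilon>\<^sup>2 \<le> real n" using large by linarith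
    then obtain B where B: "B \<in> sets (tuples n \<mu>)" "measure (tuples n \<mu>) B < \<delta>"
      and close: "\<And>x i y. x \<in> space (tuples n \<mu>) - B \<Longrightarrow> i < m \<Longrightarrow> y \<in> cube \<Longrightarrow>
            \<bar>orthonormal_poly \<mu> i y - orthonormal_poly (empirical cube n x) i y\<bar> < \<epsilon>"
      using conc[OF \<delta> \<epsilon>(1) _ n] \<epsilon>(2) by (auto simp: le_max_iff_disj)
    have "(MAX i\<in>{..<m}. MAX y\<in>x ` {..<n}.
             \<bar>orthonormal_poly \<mu> i y - orthonormal_poly (empirical cube n x) i y\<bar>) < \<epsilon>"
      if x: "x \<in> space (tuples n \<mu>) - B" for x
    proof -
      have "x j \<in> cube" if "j < n" for j using x that by (auto simp: space_tuples PiE_iff space)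
      thus ?thesis
        using m n close[OF x] by (subst Max_less_iff) (auto simp: lessThan_empty_iff)
    qed
    hence "{x \<in> space (tuples n \<mu>). (MAX i\<in>{..<m}. MAX y\<in>x ` {..<n}.
             \<bar>orthonormal_poly \<mu> i y - orthonormal_poly (empirical cube n x) i y\<bar>) \<ge> \<epsilon>} \<subseteq> B"
      by (force simp: not_le[symmetric])
    from T.finite_measure_mono[OF this B(1)] B(2) show ?thesis by linarith
  qed
  have part2: "weakly_coherent \<mu> Qn Q \<and>
       weak_coherency_rate \<mu> Qn Q (associated_rate \<mu> (poly_kernel \<mu> m) (poly_kernel_rate \<mu> m A 1 C))"
    if Q: "is_DPP Q (poly_kernel \<mu> m) \<mu>"
      and Qn: "\<forall>n\<ge>1. \<forall>x\<in>space (tuples n \<mu>).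
          is_DPP (Qn n x) (poly_kernel (empirical cube n x) m) (empirical cube n x)" for Q Qn
  proof -
    have rate: "weak_coherency_rate \<mu> Qn Q (associated_rate \<mu> (poly_kernel \<mu> m) (poly_kernel_rate \<mu> m A 1 C))"
      using Qn by (intro poly_kernel_weak_coherency_rate[OF \<mu> m \<kappa> C AB conc Q]) auto
    have "weakly_coherent \<mu> Qn Q"
      by (rule weakly_coherent_of_bounded_rate[OF rate])
        (rule associated_poly_kernel_rate_bounded[OF \<mu> m C])
    thus ?thesis using rate ..
  qed
  define rates where "rates A B C \<longleftrightarrow>
    (\<forall>\<delta>\<in>{0<..<1}. \<forall>\<epsilon>\<in>{0<..E}. \<forall>n\<ge>1.
       real n \<ge> A\<^sup>2 * B\<^sup>2 * ln (C / \<delta>) / \<epsilon>\<^sup>2 \<longrightarrow>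
       \<P>(x in tuples n \<mu>.
          (MAX i\<in>{..<m}. MAX y\<in>x ` {..<n}.
             \<bar>orthonormal_poly \<mu> i y - orthonormal_poly (empirical cube n x) i y\<bar>) \<ge> \<epsilon>) < \<delta>) \<and>
    (\<forall>Q Qn.
       is_DPP Q (poly_kernel \<mu> m) \<mu> \<longrightarrow>
       (\<forall>n\<ge>1. \<forall>x\<in>space (tuples n \<mu>).
          is_DPP (Qn n x) (poly_kernel (empirical cube n x) m) (empirical cube n x)) \<longrightarrow>
       weakly_coherent \<mu> Qn Q \<and>
       weak_coherency_rate \<mu> Qn Q
         (associated_rate \<mu> (poly_kernel \<mu> m) (poly_kernel_rate \<mu> m A B C)))" for A B C
  have all: "rates A 1 C"
    unfolding rates_def
  proof (intro conjI[OF ballI[OF ballI[OF allI[OF impI[OF impI]]]] allI[OF allI[OF impI[OF impI]]]])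
    fix \<delta> \<epsilon> :: real and n :: nat
    assume "\<delta> \<in> {0<..<1}" "\<epsilon> \<in> {0<..E}" "n \<ge> 1" "A\<^sup>2 * 1\<^sup>2 * ln (C / \<delta>) / \<epsilon>\<^sup>2 \<le> real n"
    thus "\<P>(x in tuples n \<mu>. (MAX i\<in>{..<m}. MAX y\<in>x ` {..<n}.
             \<bar>orthonormal_poly \<mu> i y - orthonormal_poly (empirical cube n x) i y\<bar>) \<ge> \<epsilon>) < \<delta>"
      by (intro part1) auto
  qed (rule part2)
  have C0: "C > 0" using C by linarith
  have "\<exists>A>0. \<exists>B>0. \<exists>C>0. rates A B C"
  proof (intro exI conjI)
    show "0 < A" by (rule A)
    show "0 < (1 :: real)" by simp
    show "0 < C" by (rule C0)
    show "rates A 1 C" by (rule all)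
  qed
  thus ?thesis unfolding rates_def .
qed

end
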